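(* Let $\mathsf{M}$ be a loopless matroid of rank $r>0$ on the ground set $[n]=\{1,\dots,n\}$. If $t>n-r$ or $s>r-1$, then $\operatorname{Tor}_{t}^{S_{\mathsf{M}}^{\circ}}\left(\mathbb{C}[\Sigma_{\mathsf{M}}]\right)_{s}=0$. Moreover, \[ \dim \operatorname{Tor}_{n-r}^{S_{\mathsf{M}}^{\circ}}\left(\mathbb{C}[\Sigma_{\mathsf{M}}]\right)_{r-1}=|\mathrm{NBC}(\mathsf{M})|>0 . \]
   Context: Matroids: a matroid on $[n]$ is given by its nonempty set of bases satisfying basis exchange; rank, flats, circuits as usual; loopless means every singleton is independent. For a basis $B$ and $x\notin B$, $C_{B\cup x}$ denotes the unique circuit contained in $B\cup x$; $x$ is externally active w.r.t. $B$ if $x=\min C_{B\cup x}$ and externally passive otherwise. $\mathrm{NBC}(\mathsf{M})$ is the set of bases with no externally active element. Rings: $S_{\mathsf{M}}=\mathbb{C}[x_1,\dots,x_n]$ and $S^{\circ}_{\mathsf{M}}=\mathbb{C}[x_1-x_n,\dots,x_{n-1}-x_n]\subseteq S_{\mathsf{M}}$. Let $\mathbb{C}[\Sigma_{\mathsf{M}}]=\mathbb{C}[x_F : F \text{ a proper nonempty flat}]/\langle x_Fx_G : F,G \text{ incomparable}\rangle$, graded by polynomial degree (the "Stanley–Reisner degree"), and made an $S_{\mathsf{M}}$-algebra (hence $S^{\circ}_{\mathsf{M}}$-algebra) by $x_i\mapsto \sum_{F\ni i}x_F$. Tor groups: for a polynomial ring $R$ over $\mathbb{C}$ generated by a space $V$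 of degree-one elements and a graded $R$-module $A=\bigoplus_s A_s$, the Koszul complex has terms $A\otimes_{\mathbb{C}}\bigwedge^t V$ and differential $d(a\otimes \ell_1\wedge\cdots\wedge\ell_t)=\sum_{j=1}^t(-1)^j(\ell_j a)\otimes \ell_1\wedge\cdots\widehat{\ell_j}\cdots\wedge\ell_t$, mapping $A_s\otimes\bigwedge^tV\to A_{s+1}\otimes\bigwedge^{t-1}V$. Define $\operatorname{Tor}^R_t(A)_s$ (i.e. $\operatorname{Tor}^R_t(A,\mathbb{C})$ in Tor degree $t$ and Stanley–Reisner degree $s$) to be the homology at $A_s\otimes\bigwedge^tV$. For $S^{\circ}_{\mathsf{M}}$, $V$ is the space of linear forms $\sum c_ix_i$ with $\sum c_i=0$. *)

theory Defs
  imports "HOL-Algebra.Algebra" "HOL-Algebra.Algebraic_Closure_Type" "HOL-Library.Poly_Mapping"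
begin

section \<open>Matroids on \<open>{1..n}\<close>, given by their bases\<close>

definition matroid :: "nat \<Rightarrow> nat set set \<Rightarrow> bool" where
  "matroid n Bs \<longleftrightarrow> Bs \<noteq> {} \<and> (\<forall>B\<in>Bs. B \<subseteq> {1..n}) \<and>
     (\<forall>A\<in>Bs. \<forall>B\<in>Bs. \<forall>a\<in>A - B. \<exists>b\<in>B - A. insert b (A - {a}) \<in> Bs)"

definition indep :: "nat set set \<Rightarrow> nat set \<Rightarrow> bool" where
  "indep Bs I \<longleftrightarrow> (\<exists>B\<in>Bs. I \<subseteq> B)"

definition rk :: "nat set set \<Rightarrow> nat set \<Rightarrow> nat" where
  "rk Bs S = Max (card ` {I. I \<subseteq> S \<and> indep Bs I})"

definition loopless :: "nat \<Rightarrow> nat set set \<Rightarrow> bool" where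
  "loopless n Bs \<longleftrightarrow> (\<forall>i\<in>{1..n}. indep Bs {i})"

definition flat :: "nat \<Rightarrow> nat set set \<Rightarrow> nat set \<Rightarrow> bool" where
  "flat n Bs F \<longleftrightarrow> F \<subseteq> {1..n} \<and> (\<forall>x\<in>{1..n} - F. rk Bs (insert x F) > rk Bs F)"

definition proper_flats :: "nat \<Rightarrow> nat set set \<Rightarrow> nat set set" where
  "proper_flats n Bs = {F. flat n Bs F \<and> F \<noteq> {} \<and> F \<noteq> {1..n}}"

definition circuit :: "nat \<Rightarrow> nat set set \<Rightarrow> nat set \<Rightarrow> bool" where
  "circuit n Bs C \<longleftrightarrow> C \<subseteq> {1..n} \<and> \<not> indep Bs C \<and> (\<forall>D. D \<subset> C \<longrightarrow> indep Bs D)"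

definition fund_circuit :: "nat \<Rightarrow> nat set set \<Rightarrow> nat set \<Rightarrow> nat \<Rightarrow> nat set" where
  "fund_circuit n Bs B x = (THE C. circuit n Bs C \<and> C \<subseteq> insert x B)"

definition ext_active :: "nat \<Rightarrow> nat set set \<Rightarrow> nat set \<Rightarrow> nat \<Rightarrow> bool" where
  "ext_active n Bs B x \<longleftrightarrow> x \<in> {1..n} - B \<and> x = Min (fund_circuit n Bs B x)"

definition NBC :: "nat \<Rightarrow> nat set set \<Rightarrow> nat set set" where
  "NBC n Bs = {B\<in>Bs. \<not> (\<exists>x. ext_active n Bs B x)}"


section \<open>Vector spaces, quotients and dimension\<close>

abbreviation complex_ring :: "complex ring" where
  "complex_ring \<equiv> ring_of_type_algebra"

definition quot_module :: "('a, 'b) module \<Rightarrow> 'b set \<Rightarrow> ('a, 'b set) module" where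
  "quot_module M N =
     \<lparr>carrier = a_rcosets\<^bsub>M\<^esub> N, monoid.mult = undefined, one = undefined, ring.zero = N, add = set_add M,
      module.smult = (\<lambda>c Q. \<Union>x\<in>Q. N +>\<^bsub>M\<^esub> (c \<odot>\<^bsub>M\<^esub> x))\<rparr>"

definition finite_basis :: "('a, 'c) ring_scheme \<Rightarrow> ('a, 'b, 'd) module_scheme \<Rightarrow> 'b set \<Rightarrow> bool" where
  "finite_basis K M S \<longleftrightarrow> finite S \<and> S \<subseteq> carrier M \<and>
     (\<forall>v\<in>carrier M. \<exists>!c. c \<in> S \<rightarrow>\<^sub>E carrier K \<and> v = (\<Oplus>\<^bsub>M\<^esub>s\<in>S. c s \<odot>\<^bsub>M\<^esub> s))"

definition has_dim :: "('a, 'c) ring_scheme \<Rightarrow> ('a, 'b, 'd) module_scheme \<Rightarrow> nat \<Rightarrow> bool" where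
  "has_dim K M d \<longleftrightarrow> (\<exists>S. finite_basis K M S \<and> card S = d)"


section \<open>The Stanley--Reisner ring of the order complex of proper flats\<close>

type_synonym 'x mpoly = "('x \<Rightarrow>\<^sub>0 nat) \<Rightarrow>\<^sub>0 complex"

definition Var :: "'x \<Rightarrow> 'x mpoly" where
  "Var x = Poly_Mapping.single (Poly_Mapping.single x 1) 1"

definition Const :: "complex \<Rightarrow> 'x mpoly" where
  "Const c = Poly_Mapping.single 0 c"

definition mpoly_ring :: "'x set \<Rightarrow> 'x mpoly ring" where
  "mpoly_ring E = ring_of_type_algebra\<lparr>carrier := {p. \<forall>m\<in>Poly_Mapping.keys p. Poly_Mapping.keys m \<subseteq> E}\<rparr>"

definition homogeneous :: "nat \<Rightarrow> 'x mpoly \<Rightarrow> bool" where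
  "homogeneous s p \<longleftrightarrow> (\<forall>m\<in>Poly_Mapping.keys p. (\<Sum>x\<in>Poly_Mapping.keys m. Poly_Mapping.lookup m x) = s)"

definition sr_ideal :: "nat \<Rightarrow> nat set set \<Rightarrow> nat set mpoly set" where
  "sr_ideal n Bs = genideal (mpoly_ring (proper_flats n Bs))
     {Var F * Var G | F G. F \<in> proper_flats n Bs \<and> G \<in> proper_flats n Bs \<and>
        \<not> F \<subseteq> G \<and> \<not> G \<subseteq> F}"

definition sr_class :: "nat \<Rightarrow> nat set set \<Rightarrow> nat set mpoly \<Rightarrow> nat set mpoly set" where
  "sr_class n Bs p = sr_ideal n Bs +>\<^bsub>mpoly_ring (proper_flats n Bs)\<^esub> p"

definition sr_ring :: "nat \<Rightarrow> nat set set \<Rightarrow> nat set mpoly set ring" where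
  "sr_ring n Bs = mpoly_ring (proper_flats n Bs) Quot sr_ideal n Bs"

definition sr_algebra :: "nat \<Rightarrow> nat set set \<Rightarrow> (complex, nat set mpoly set) module" where
  "sr_algebra n Bs = ring.extend (sr_ring n Bs)
     (module.fields (\<lambda>c a. sr_class n Bs (Const c) \<otimes>\<^bsub>sr_ring n Bs\<^esub> a))"

definition sr_grade :: "nat \<Rightarrow> nat set set \<Rightarrow> nat \<Rightarrow> nat set mpoly set set" where
  "sr_grade n Bs s =
     {sr_class n Bs p | p. p \<in> carrier (mpoly_ring (proper_flats n Bs)) \<and> homogeneous s p}"

text \<open>The image of the variable \<open>x\<^sub>i\<close> of \<open>\<complex>[x\<^sub>1, \<dots>, x\<^sub>n]\<close> under the structure map.\<close>

definition sr_var :: "nat \<Rightarrow> nat set set \<Rightarrow> nat \<Rightarrow> nat set mpoly set" where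
  "sr_var n Bs i = sr_class n Bs (\<Sum>F\<in>{F\<in>proper_flats n Bs. i \<in> F}. Var F)"


lemma mpoly_ring_cring: "cring (mpoly_ring E)"
proof -
  define S :: "'a mpoly set" where "S = {p. \<forall>m\<in>Poly_Mapping.keys p. Poly_Mapping.keys m \<subseteq> E}"
  have add: "a + b \<in> S" if "a \<in> S" "b \<in> S" for a b
    using that Poly_Mapping.keys_add[of a b] unfolding S_def by blast
  have mult: "a * b \<in> S" if "a \<in> S" "b \<in> S" for a b
    unfolding S_def
  proof clarify
    fix m x assume m: "m \<in> Poly_Mapping.keys (a * b)" and x: "x \<in> Poly_Mapping.keys m"
    from m obtain u v where "u \<in> Poly_Mapping.keys a" "v \<in> Poly_Mapping.keys b" "m = u + v"
      using Poly_Mapping.keys_mult[of a b] by blast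
    with x that show "x \<in> E" using Poly_Mapping.keys_add[of u v] unfolding S_def by blast
  qed
  have one: "1 \<in> S" and zero: "0 \<in> S" by (simp_all add: S_def)
  have neg: "\<exists>b\<in>S. a + b = 0" if "a \<in> S" for a
    using that by (intro bexI[of _ "- a"]) (auto simp: S_def in_keys_iff)
  have R: "mpoly_ring E = \<lparr>carrier = S, monoid.mult = (*), one = 1, ring.zero = 0, add = (+)\<rparr>"
    by (simp add: mpoly_ring_def ring_of_type_algebra_def S_def)
  show ?thesis
    unfolding R
    by (intro cringI abelian_groupI comm_monoidI)
      (simp_all add: add mult one zero neg algebra_simps)
qed

lemma sr_algebra: "algebra complex_ring (sr_algebra n Bs)"
proof -
  let ?P = "mpoly_ring (proper_flats n Bs)" and ?R = "sr_ring n Bs" and ?h = "\<lambda>c. sr_class n Bs (Const c)"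
  interpret P: cring ?P by (rule mpoly_ring_cring)
  have Var: "Var F \<in> carrier ?P" if "F \<in> proper_flats n Bs" for F
    using that by (simp add: mpoly_ring_def Var_def)
  have mult: "a \<otimes>\<^bsub>?P\<^esub> b = a * b" for a b by (simp add: mpoly_ring_def ring_of_type_algebra_def)
  have I: "ideal (sr_ideal n Bs) ?P"
    unfolding sr_ideal_def
    by (rule P.genideal_ideal) (use Var in \<open>auto simp flip: mult\<close>)
  interpret I: ideal "sr_ideal n Bs" ?P by (rule I)
  interpret R: cring ?R unfolding sr_ring_def by (rule I.quotient_is_cring[OF P.is_cring])
  have "Const \<in> ring_hom complex_ring ?P"
    by (rule ring_hom_memI)
      (simp_all add: mpoly_ring_def ring_of_type_algebra_def Const_def mult_single single_add)
  then have h: "?h \<in> ring_hom complex_ring ?R"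
    using ring_hom_trans[OF _ I.rcos_ring_hom] by (simp add: sr_class_def[abs_def] sr_ring_def comp_def)
  interpret h: ring_hom_ring complex_ring ?R ?h
    by (rule ring_hom_ringI2) (use h R.ring_axioms in \<open>auto intro: ring_from_type_algebra\<close>)
  have cl: "?h c \<in> carrier ?R" for c using h.hom_closed[of c] by (simp add: ring_of_type_algebra_def)
  have eqs: "carrier (sr_algebra n Bs) = carrier ?R" "\<one>\<^bsub>sr_algebra n Bs\<^esub> = \<one>\<^bsub>?R\<^esub>"
    "\<zero>\<^bsub>sr_algebra n Bs\<^esub> = \<zero>\<^bsub>?R\<^esub>" "a \<oplus>\<^bsub>sr_algebra n Bs\<^esub> b = a \<oplus>\<^bsub>?R\<^esub> b"
    "a \<otimes>\<^bsub>sr_algebra n Bs\<^esub> b = a \<otimes>\<^bsub>?R\<^esub> b" "c \<odot>\<^bsub>sr_algebra n Bs\<^esub> b = ?h c \<otimes>\<^bsub>?R\<^esub> b" for a b c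
    by (simp_all add: sr_algebra_def ring.defs module.defs)
  have inv: "\<exists>b\<in>carrier ?R. b \<oplus>\<^bsub>?R\<^esub> a = \<zero>\<^bsub>?R\<^esub>" if "a \<in> carrier ?R" for a
    using that by (intro bexI[of _ "\<ominus>\<^bsub>?R\<^esub> a"]) (simp_all add: R.l_neg)
  have "cring (sr_algebra n Bs)"
    by (intro cringI abelian_groupI comm_monoidI)
      (simp_all add: eqs R.a_assoc R.m_assoc R.m_comm R.a_comm R.a_lcomm R.m_lcomm R.l_distr R.r_distr inv)
  have hs: "?h (a + b) = ?h a \<oplus>\<^bsub>?R\<^esub> ?h b" "?h (a * b) = ?h a \<otimes>\<^bsub>?R\<^esub> ?h b" "?h 1 = \<one>\<^bsub>?R\<^esub>" for a b
    using h.hom_add[of a b] h.hom_mult[of a b] h.hom_one by (simp_all add: ring_of_type_algebra_def)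
  have C: "a \<oplus>\<^bsub>complex_ring\<^esub> b = a + b" "a \<otimes>\<^bsub>complex_ring\<^esub> b = a * b" "\<one>\<^bsub>complex_ring\<^esub> = 1" for a b
    by (simp_all add: ring_of_type_algebra_def)
  show ?thesis
  proof (rule algebraI)
    show "cring complex_ring" by (rule cring_from_type_algebra)
    show "cring (sr_algebra n Bs)" by fact
    fix a b x y assume x: "x \<in> carrier (sr_algebra n Bs)" and y: "y \<in> carrier (sr_algebra n Bs)"
    note xy = x[unfolded eqs] y[unfolded eqs]
    show "a \<odot>\<^bsub>sr_algebra n Bs\<^esub> x \<in> carrier (sr_algebra n Bs)"
      unfolding eqs by (intro R.m_closed cl xy)
    show "(a \<oplus>\<^bsub>complex_ring\<^esub> b) \<odot>\<^bsub>sr_algebra n Bs\<^esub> x =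
        (a \<odot>\<^bsub>sr_algebra n Bs\<^esub> x) \<oplus>\<^bsub>sr_algebra n Bs\<^esub> (b \<odot>\<^bsub>sr_algebra n Bs\<^esub> x)"
      unfolding eqs C hs by (intro R.l_distr cl xy)
    show "a \<odot>\<^bsub>sr_algebra n Bs\<^esub> (x \<oplus>\<^bsub>sr_algebra n Bs\<^esub> y) =
        (a \<odot>\<^bsub>sr_algebra n Bs\<^esub> x) \<oplus>\<^bsub>sr_algebra n Bs\<^esub> (a \<odot>\<^bsub>sr_algebra n Bs\<^esub> y)"
      unfolding eqs by (intro R.r_distr cl xy)
    show "(a \<otimes>\<^bsub>complex_ring\<^esub> b) \<odot>\<^bsub>sr_algebra n Bs\<^esub> x =
        a \<odot>\<^bsub>sr_algebra n Bs\<^esub> (b \<odot>\<^bsub>sr_algebra n Bs\<^esub> x)"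
      unfolding eqs C hs by (intro R.m_assoc cl xy)
    show "\<one>\<^bsub>complex_ring\<^esub> \<odot>\<^bsub>sr_algebra n Bs\<^esub> x = x"
      unfolding eqs C hs by (intro R.l_one xy)
    show "(a \<odot>\<^bsub>sr_algebra n Bs\<^esub> x) \<otimes>\<^bsub>sr_algebra n Bs\<^esub> y =
        a \<odot>\<^bsub>sr_algebra n Bs\<^esub> (x \<otimes>\<^bsub>sr_algebra n Bs\<^esub> y)"
      unfolding eqs by (intro R.m_assoc cl xy)
  qed
qed


section \<open>Koszul complexes and Tor\<close>

text \<open>
  A linear form \<open>\<Sum>i=1..n. c i * x\<^sub>i\<close> is represented by its coefficient function \<open>c\<close>, and an
  element of \<open>A \<otimes> \<Lambda>(\<complex>\<^sup>n)\<close> by the function sending a set \<open>J \<subseteq> {1..n}\<close> to its coefficient at the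
  wedge, in increasing order, of the \<open>x\<^sub>j\<close> with \<open>j \<in> J\<close>. For a space \<open>V\<close> of linear forms,
  \<open>A\<^sub>s \<otimes> \<Lambda>\<^sup>t V\<close> is regarded as a subspace of \<open>A \<otimes> \<Lambda>\<^sup>t(\<complex>\<^sup>n)\<close>; over a field the
  canonical map between the two is injective.
\<close>

text \<open>The coefficient of \<open>l\<^sub>1 \<and> \<dots> \<and> l\<^sub>t\<close> at \<open>J\<close>; moving \<open>x\<^sub>i\<close> from the front to its place in the
  increasing order passes the elements of \<open>J\<close> below \<open>i\<close>.\<close>

fun wedge :: "(nat \<Rightarrow> complex) list \<Rightarrow> nat set \<Rightarrow> complex" where
  "wedge [] J = (if J = {} then 1 else 0)"
| "wedge (l # ls) J = (\<Sum>i\<in>J. (-1) ^ card {k\<in>J. k < i} * l i * wedge ls (J - {i}))"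

definition tensor :: "(complex, 'b) module \<Rightarrow> 'b \<Rightarrow> (nat \<Rightarrow> complex) list \<Rightarrow> nat set \<Rightarrow> 'b" where
  "tensor A a ls = (\<lambda>J. wedge ls J \<odot>\<^bsub>A\<^esub> a)"

definition chains :: "(complex, 'b) module \<Rightarrow> (complex, nat set \<Rightarrow> 'b) module" where
  "chains A =
     \<lparr>carrier = UNIV \<rightarrow> carrier A, monoid.mult = undefined, one = undefined,
      ring.zero = (\<lambda>J. \<zero>\<^bsub>A\<^esub>), add = (\<lambda>u v J. u J \<oplus>\<^bsub>A\<^esub> v J), module.smult = (\<lambda>c u J. c \<odot>\<^bsub>A\<^esub> u J)\<rparr>"

text \<open>\<open>A\<^sub>s \<otimes> \<Lambda>\<^sup>t V\<close>, where \<open>gr s\<close> is the graded piece \<open>A\<^sub>s\<close> of \<open>A\<close>. The sums of elementary tensors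
  already form a complex subspace, since \<open>A\<^sub>s\<close> is closed under scalars.\<close>

definition koszul_term ::
  "(nat \<Rightarrow> complex) set \<Rightarrow> (complex, 'b) module \<Rightarrow> (nat \<Rightarrow> 'b set) \<Rightarrow> nat \<Rightarrow> nat \<Rightarrow> (nat set \<Rightarrow> 'b) set"
  where
  "koszul_term V A gr t s = generate (add_monoid (chains A))
     {tensor A a ls | a ls. a \<in> gr s \<and> set ls \<subseteq> V \<and> length ls = t}"

text \<open>
  The differential of \<open>A \<otimes> \<Lambda>(\<complex>\<^sup>n)\<close>, with \<open>x i \<in> A\<close> the image of the variable \<open>x\<^sub>i\<close>. An index
  \<open>i \<notin> J\<close> has position \<open>card {k\<in>J. k < i} + 1\<close> in \<open>J \<union> {i}\<close>. The lemma \<open>koszul_d_tensor\<close> below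
  is the usual formula on \<open>a \<otimes> l\<^sub>1 \<and> \<dots> \<and> l\<^sub>t\<close>.
\<close>

definition koszul_d ::
  "nat \<Rightarrow> (complex, 'b) module \<Rightarrow> (nat \<Rightarrow> 'b) \<Rightarrow> (nat set \<Rightarrow> 'b) \<Rightarrow> nat set \<Rightarrow> 'b" where
  "koszul_d n A x w = (\<lambda>J. \<Oplus>\<^bsub>A\<^esub>i\<in>{1..n} - J.
     ((-1) ^ (card {k\<in>J. k < i} + 1)) \<odot>\<^bsub>A\<^esub> (x i \<otimes>\<^bsub>A\<^esub> w (insert i J)))"

definition koszul_cycles ::
  "nat \<Rightarrow> (nat \<Rightarrow> complex) set \<Rightarrow> (complex, 'b) module \<Rightarrow> (nat \<Rightarrow> 'b set) \<Rightarrow> (nat \<Rightarrow> 'b) \<Rightarrow> nat \<Rightarrow> nat \<Rightarrow>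
     (nat set \<Rightarrow> 'b) set" where
  "koszul_cycles n V A gr x t s =
     {w\<in>koszul_term V A gr t s. koszul_d n A x w = \<zero>\<^bsub>chains A\<^esub>}"

definition koszul_boundaries ::
  "nat \<Rightarrow> (nat \<Rightarrow> complex) set \<Rightarrow> (complex, 'b) module \<Rightarrow> (nat \<Rightarrow> 'b set) \<Rightarrow> (nat \<Rightarrow> 'b) \<Rightarrow> nat \<Rightarrow> nat \<Rightarrow>
     (nat set \<Rightarrow> 'b) set" where
  "koszul_boundaries n V A gr x t s =
     (case s of 0 \<Rightarrow> {\<zero>\<^bsub>chains A\<^esub>}
      | Suc s' \<Rightarrow> koszul_d n A x ` koszul_term V A gr (Suc t) s')"

definition koszul_Tor ::
  "nat \<Rightarrow> (nat \<Rightarrow> complex) set \<Rightarrow> (complex, 'b) module \<Rightarrow> (nat \<Rightarrow> 'b set) \<Rightarrow> (nat \<Rightarrow> 'b) \<Rightarrow> nat \<Rightarrow> nat \<Rightarrow>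
     (complex, (nat set \<Rightarrow> 'b) set) module" where
  "koszul_Tor n V A gr x t s =
     quot_module (chains A\<lparr>carrier := koszul_cycles n V A gr x t s\<rparr>)
       (koszul_boundaries n V A gr x t s)"

definition sum_zero_forms :: "nat \<Rightarrow> (nat \<Rightarrow> complex) set" where
  "sum_zero_forms n = {c. (\<forall>i. i \<notin> {1..n} \<longrightarrow> c i = 0) \<and> (\<Sum>i=1..n. c i) = 0}"

text \<open>The Tor group, in Tor degree \<open>t\<close> and Stanley--Reisner degree \<open>s\<close>, of \<open>\<complex>[\<Sigma>\<^sub>M]\<close> over
  \<open>\<complex>[x\<^sub>1 - x\<^sub>n, \<dots>, x\<^sub>n\<^sub>-\<^sub>1 - x\<^sub>n]\<close>.\<close>

definition sr_Tor ::
  "nat \<Rightarrow> nat set set \<Rightarrow> nat \<Rightarrow> nat \<Rightarrow> (complex, (nat set \<Rightarrow> nat set mpoly set) set) module" where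
  "sr_Tor n Bs t s =
     koszul_Tor n (sum_zero_forms n) (sr_algebra n Bs) (sr_grade n Bs) (sr_var n Bs) t s"


section \<open>The differential on elementary tensors\<close>

lemma wedge_infinite: "infinite J \<Longrightarrow> wedge ls J = 0"
  by (cases ls) auto

definition contract :: "nat \<Rightarrow> (nat set \<Rightarrow> complex) \<Rightarrow> nat set \<Rightarrow> complex" where
  "contract i w J = (if i \<in> J then 0 else (-1) ^ card {k\<in>J. k < i} * w (insert i J))"

lemma contract_wedge_Cons:
  assumes "finite J"
  shows "contract i (wedge (l # ls)) J =
    l i * wedge ls J - (\<Sum>m\<in>J. (-1) ^ card {k\<in>J. k < m} * l m * contract i (wedge ls) (J - {m}))"
proof (cases "i \<in> J")
  case True
  have "(\<Sum>m\<in>J. (-1) ^ card {k\<in>J. k < m} * l m * contract i (wedge ls) (J - {m}))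
     = (\<Sum>m\<in>J. if m = i then (-1) ^ card {k\<in>J. k < i} * l i * contract i (wedge ls) (J - {i}) else 0)"
    using True by (intro sum.cong) (auto simp: contract_def)
  also have "\<dots> = (-1) ^ card {k\<in>J. k < i} * l i * contract i (wedge ls) (J - {i})"
    using True assms by simp
  also have "\<dots> = l i * wedge ls J"
  proof -
    have "{k \<in> J - {i}. k < i} = {k\<in>J. k < i}" by auto
    moreover have "insert i (J - {i}) = J" using True by auto
    moreover have "((-1::complex) ^ c) * (-1) ^ c = 1" for c :: nat
      by (simp flip: power_add)
    ultimately show ?thesis by (simp add: contract_def)
  qed
  finally show ?thesis using True by (simp add: contract_def)
next
  case False
  have eq0: "{k \<in> insert i J. k < i} = {k\<in>J. k < i}" by auto
  have "(-1) ^ card {k\<in>J. k < i} *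
      ((-1) ^ card {k\<in>insert i J. k < m} * l m * wedge ls (insert i J - {m})) =
      - ((-1) ^ card {k\<in>J. k < m} * l m * contract i (wedge ls) (J - {m}))" if m: "m \<in> J" for m
  proof -
    have ne: "m \<noteq> i" using m False by auto
    have ins: "insert i J - {m} = insert i (J - {m})" using ne by auto
    show ?thesis
    proof (cases "i < m")
      case True
      have "{k\<in>insert i J. k < m} = insert i {k\<in>J. k < m}" using True by auto
      then have "card {k\<in>insert i J. k < m} = Suc (card {k\<in>J. k < m})"
        using assms False by simp
      moreover have "{k\<in>J - {m}. k < i} = {k\<in>J. k < i}" using True by auto
      ultimately show ?thesis using False by (simp add: contract_def ins)
    next
      case F: False
      then have mi: "m < i" using ne by simp
      have e1: "{k\<in>insert i J. k < m} = {k\<in>J. k < m}" using F by auto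
      have "{k\<in>J. k < i} = insert m {k\<in>J - {m}. k < i}" using mi m by auto
      then have "card {k\<in>J. k < i} = Suc (card {k\<in>J - {m}. k < i})"
        using assms by simp
      then show ?thesis unfolding contract_def ins e1 using False by simp
    qed
  qed
  note step = this
  have sgn: "((-1::complex) ^ c) * ((-1) ^ c * z) = z" for c :: nat and z
    by (simp flip: power_add mult.assoc)
  have "contract i (wedge (l # ls)) J = (-1) ^ card {k\<in>J. k < i} *
      ((-1) ^ card {k\<in>insert i J. k < i} * l i * wedge ls (insert i J - {i})) +
      (\<Sum>m\<in>J. (-1) ^ card {k\<in>J. k < i} *
        ((-1) ^ card {k\<in>insert i J. k < m} * l m * wedge ls (insert i J - {m})))"
    using False assms by (simp add: contract_def sum_distrib_left distrib_left)
  also have "(-1) ^ card {k\<in>J. k < i} *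
      ((-1) ^ card {k\<in>insert i J. k < i} * l i * wedge ls (insert i J - {i})) = l i * wedge ls J"
    using False by (simp only: eq0 mult.assoc sgn) simp
  also have "(\<Sum>m\<in>J. (-1) ^ card {k\<in>J. k < i} *
        ((-1) ^ card {k\<in>insert i J. k < m} * l m * wedge ls (insert i J - {m}))) =
      - (\<Sum>m\<in>J. (-1) ^ card {k\<in>J. k < m} * l m * contract i (wedge ls) (J - {m}))"
    unfolding sum_negf[symmetric] by (rule sum.cong[OF refl step])
  finally show ?thesis by (simp only: diff_conv_add_uminus)
qed

lemma contract_wedge:
  assumes "finite J"
  shows "contract i (wedge ls) J =
    (\<Sum>j<length ls. (-1) ^ j * (ls ! j) i * wedge (take j ls @ drop (Suc j) ls) J)"
  using assms
proof (induction ls arbitrary: J)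
  case Nil
  then show ?case by (simp add: contract_def)
next
  case (Cons l ls)
  have "(\<Sum>m\<in>J. (-1) ^ card {k\<in>J. k < m} * l m * contract i (wedge ls) (J - {m}))
    = (\<Sum>m\<in>J. \<Sum>j<length ls. (-1) ^ card {k\<in>J. k < m} * l m *
        ((-1) ^ j * (ls ! j) i * wedge (take j ls @ drop (Suc j) ls) (J - {m})))"
    using Cons.prems by (simp add: Cons.IH sum_distrib_left)
  also have "\<dots> = (\<Sum>j<length ls. (-1) ^ j * (ls ! j) i *
        (\<Sum>m\<in>J. (-1) ^ card {k\<in>J. k < m} * l m * wedge (take j ls @ drop (Suc j) ls) (J - {m})))"
    by (subst sum.swap) (simp add: sum_distrib_left algebra_simps)
  finally show ?case
    unfolding contract_wedge_Cons[OF Cons.prems]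
    by (simp add: sum.lessThan_Suc_shift sum_negf del: sum.lessThan_Suc)
qed

lemma koszul_d_tensor:
  fixes A (structure)
  assumes "algebra complex_ring A" and a: "a \<in> carrier A" and x: "\<And>i. i \<in> {1..n} \<Longrightarrow> x i \<in> carrier A"
    and J: "finite J"
  shows "koszul_d n A x (tensor A a ls) J =
    (\<Oplus>j\<in>{..<length ls}. ((-1) ^ (j + 1)) \<odot>
      tensor A ((\<Oplus>i\<in>{1..n}. (ls ! j) i \<odot> x i) \<otimes> a) (take j ls @ drop (Suc j) ls) J)"
proof -
  interpret algebra complex_ring A by fact
  have K: "carrier complex_ring = UNIV" "\<And>a b. a \<oplus>\<^bsub>complex_ring\<^esub> b = a + b"
      "\<And>a b. a \<otimes>\<^bsub>complex_ring\<^esub> b = a * b" "\<zero>\<^bsub>complex_ring\<^esub> = 0"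
    by (simp_all add: ring_of_type_algebra_def)
  have sm: "c \<odot> (d \<odot> v) = (c * d) \<odot> v" if "v \<in> carrier A" for c d v
    using smult_assoc1[of c d v] that by (simp add: K)
  have cl: "c \<odot> v \<in> carrier A" if "v \<in> carrier A" for c v
    using smult_closed[of c v] that by (simp add: K)
  have z: "0 \<odot> v = \<zero>" if "v \<in> carrier A" for v
    using smult_l_null[of v] that by (simp add: K)
  have ssum: "(\<Sum>q\<in>Q. f q) \<odot> v = (\<Oplus>q\<in>Q. f q \<odot> v)" if "finite Q" "v \<in> carrier A" for f :: "nat \<Rightarrow> complex" and Q v
    using that
  proof (induction Q)
    case empty then show ?case by (simp add: z)
  next
    case (insert q Q)
    then show ?case using smult_l_distr[of "f q" "sum f Q" v] by (simp add: K cl)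
  qed
  have rsum: "c \<odot> (\<Oplus>q\<in>Q. g q) = (\<Oplus>q\<in>Q. c \<odot> g q)" if "finite Q" "g \<in> Q \<rightarrow> carrier A" for c g and Q :: "nat set"
    using that finsum_smult_ldistr[of Q c g] by (simp add: K)
  have swap: "(\<Oplus>i\<in>P. \<Oplus>j\<in>Q. g i j) = (\<Oplus>j\<in>Q. \<Oplus>i\<in>P. g i j)"
    if "finite P" "finite Q" "\<And>i j. i \<in> P \<Longrightarrow> j \<in> Q \<Longrightarrow> g i j \<in> carrier A"
    for g and P Q :: "nat set"
    using that
  proof (induction P)
    case (insert p P)
    have "(\<Oplus>j\<in>Q. \<Oplus>i\<in>insert p P. g i j) = (\<Oplus>j\<in>Q. g p j \<oplus> (\<Oplus>i\<in>P. g i j))"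
      using insert by (intro finsum_cong') (auto intro!: finsum_insert finsum_closed)
    also have "\<dots> = (\<Oplus>j\<in>Q. g p j) \<oplus> (\<Oplus>j\<in>Q. \<Oplus>i\<in>P. g i j)"
      using insert by (intro finsum_addf) (auto intro!: finsum_closed)
    finally show ?case using insert by (subst finsum_insert) (auto intro!: finsum_closed)
  qed simp
  let ?N = "\<lambda>j. take j ls @ drop (Suc j) ls"
  let ?c = "\<lambda>i j. (-1) ^ (j + 1) * (ls ! j) i * wedge (?N j) J"
  have xa: "x i \<otimes> a \<in> carrier A" if "i \<in> {1..n}" for i using that x a by simp
  have neg: "(if i \<in> J then 0 else (-1) ^ (card {k\<in>J. k < i} + 1) * wedge ls (insert i J)) =
      (\<Sum>j<length ls. ?c i j)" for i
  proof -
    have "(if i \<in> J then 0 else (-1) ^ (card {k\<in>J. k < i} + 1) * wedge ls (insert i J)) =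
        - contract i (wedge ls) J" by (simp add: contract_def)
    also have "\<dots> = (\<Sum>j<length ls. ?c i j)" by (simp add: contract_wedge[OF J] sum_negf)
    finally show ?thesis .
  qed
  have "koszul_d n A x (tensor A a ls) J =
      (\<Oplus>i\<in>{1..n} - J. ((-1) ^ (card {k\<in>J. k < i} + 1) * wedge ls (insert i J)) \<odot> (x i \<otimes> a))"
    unfolding koszul_d_def tensor_def
  proof (rule finsum_cong')
    fix i assume i: "i \<in> {1..n} - J"
    have "x i \<otimes> (wedge ls (insert i J) \<odot> a) = wedge ls (insert i J) \<odot> (x i \<otimes> a)"
      using i x a smult_assoc2[of "wedge ls (insert i J)" a "x i"] by (simp add: K cl m_comm)
    then show "(- 1) ^ (card {k \<in> J. k < i} + 1) \<odot> (x i \<otimes> (wedge ls (insert i J) \<odot> a)) =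
        ((-1) ^ (card {k\<in>J. k < i} + 1) * wedge ls (insert i J)) \<odot> (x i \<otimes> a)"
      using i xa by (simp add: sm)
  qed (use xa cl in auto)
  also have "\<dots> = (\<Oplus>i\<in>{1..n}. (\<Sum>j<length ls. ?c i j) \<odot> (x i \<otimes> a))"
    unfolding neg[symmetric]
    by (rule add.finprod_mono_neutral_cong_left) (use xa cl z in auto)
  also have "\<dots> = (\<Oplus>i\<in>{1..n}. \<Oplus>j\<in>{..<length ls}. ?c i j \<odot> (x i \<otimes> a))"
    by (rule finsum_cong') (use xa cl ssum in auto)
  also have "\<dots> = (\<Oplus>j\<in>{..<length ls}. \<Oplus>i\<in>{1..n}. ?c i j \<odot> (x i \<otimes> a))"
    by (rule swap) (use xa cl in auto)
  also have "\<dots> = (\<Oplus>j\<in>{..<length ls}. ((-1) ^ (j + 1)) \<odot>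
      tensor A ((\<Oplus>i\<in>{1..n}. (ls ! j) i \<odot> x i) \<otimes> a) (?N j) J)"
  proof (rule finsum_cong')
    fix j
    have "(\<Oplus>i\<in>{1..n}. (ls ! j) i \<odot> x i) \<otimes> a = (\<Oplus>i\<in>{1..n}. (ls ! j) i \<odot> x i \<otimes> a)"
      by (rule finsum_ldistr) (use a x cl in auto)
    also have "\<dots> = (\<Oplus>i\<in>{1..n}. (ls ! j) i \<odot> (x i \<otimes> a))"
      by (rule finsum_cong') (use a x cl smult_assoc2 in \<open>auto simp: K\<close>)
    finally have e: "(\<Oplus>i\<in>{1..n}. (ls ! j) i \<odot> x i) \<otimes> a = (\<Oplus>i\<in>{1..n}. (ls ! j) i \<odot> (x i \<otimes> a))" .
    have "(-1) ^ (j + 1) \<odot> tensor A ((\<Oplus>i\<in>{1..n}. (ls ! j) i \<odot> x i) \<otimes> a) (?N j) J =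
        ((-1) ^ (j + 1) * wedge (?N j) J) \<odot> (\<Oplus>i\<in>{1..n}. (ls ! j) i \<odot> (x i \<otimes> a))"
      unfolding tensor_def e by (rule sm) (use xa cl in auto)
    also have "\<dots> = (\<Oplus>i\<in>{1..n}. ((-1) ^ (j + 1) * wedge (?N j) J) \<odot> ((ls ! j) i \<odot> (x i \<otimes> a)))"
      by (rule rsum) (use xa cl in auto)
    also have "\<dots> = (\<Oplus>i\<in>{1..n}. ?c i j \<odot> (x i \<otimes> a))"
      by (rule finsum_cong') (use xa cl sm in \<open>auto simp: mult_ac\<close>)
    finally show "(\<Oplus>i\<in>{1..n}. ?c i j \<odot> (x i \<otimes> a)) =
      (-1) ^ (j + 1) \<odot> tensor A ((\<Oplus>i\<in>{1..n}. (ls ! j) i \<odot> x i) \<otimes> a) (?N j) J" by simp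
  next
    show "(\<lambda>j. (-1) ^ (j + 1) \<odot> tensor A ((\<Oplus>i\<in>{1..n}. (ls ! j) i \<odot> x i) \<otimes> a) (?N j) J)
        \<in> {..<length ls} \<rightarrow> carrier A"
      unfolding tensor_def using a x by (auto intro!: cl m_closed finsum_closed)
  qed auto
  finally show ?thesis .
qed

end

theory Submission
  imports Defs
begin

text \<open>
  The ring \<open>\<complex>[\<Sigma>\<^sub>M]\<close> has the monomials supported on chains of proper flats as a basis. Label a
  complete flag \<open>F\<^sub>0 \<subset> \<dots> \<subset> F\<^sub>r\<close> of flats by the sequence \<open>min (F\<^sub>k\<^sub>+\<^sub>1 - F\<^sub>k)\<close> and attach to a monomial the
  lexicographically least flag through its support. Multiplication can only enlarge this flag, so
  the flags filter the ring by ideals; this is the shelling filtration, and the piece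
  belonging to a flag is a free rank one module over the polynomial ring in the members of the
  flag, generated by the product of the members at which the labels descend. On each piece the
  Koszul complex contracts onto that generator tensored with the forms killed by contraction with
  every member of the flag. Such forms vanish in exterior degree greater than \<open>n - r\<close> and
  form a line in degree \<open>n - r\<close>, while the generator has degree at most \<open>r - 1\<close>, with
  equality exactly if the labels decrease throughout. This gives the vanishing, and it shows that
  the remaining group has a basis indexed by the flags with decreasing labels, which
  correspond to the NBC bases by taking the set of labels.
\<close>

section \<open>Rank and flats of a matroid\<close>

text \<open>The sum-zero forms enter as the kernel of contraction with \<open>{1..n}\<close>. This
  set is also the last member \<open>f r\<close> of every flag, so the condition joins those of the
  r - 1 proper members, and the r functionals adding up the coordinates in \<open>f k\<close> have
  an explicit dual family made from the labels. On an n-dimensional space they leave n - r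
  dimensions, whence the bound on \<open>t\<close>. The obstacle is that dividing by the variable of
  a flat makes sense only among the monomials of a single flag and does not respect the differential
  across flags. Hence no global homotopy is built. A cycle is corrected at one flag, the errors
  appear only at flags of larger weight, and this is repeated over the finitely many weights.
  Weights separate flags, so each round meets at most one. The classes in the top group are honest
  cycles because their supports are maximal chains: a further flat either belongs to the flag, where
  contraction kills the form, or leaves the chain monomials. They are independent because a relation
  would be a boundary from degree r - 2, too low to meet a piece whose generator has degree r -
  1.\<close>

locale matroid_on =
  fixes n :: nat and Bs :: "nat set set"
  assumes matroid: "matroid n Bs"
begin

lemma basis_subset: "B \<in> Bs \<Longrightarrow> B \<subseteq> {1..n}"
  using matroid by (auto simp: matroid_def)

lemma basis_finite: "B \<in> Bs \<Longrightarrow> finite B"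
  using basis_subset finite_subset by blast

lemma basis_exchange:
  assumes "A \<in> Bs" "B \<in> Bs" "a \<in> A - B"
  obtains b where "b \<in> B - A" "insert b (A - {a}) \<in> Bs"
  using matroid assms unfolding matroid_def by blast

text \<open>Each exchange trades an element of \<open>A - B\<close> for one of \<open>B - A\<close>,
  which keeps the cardinality and shrinks \<open>A - B\<close>. Once \<open>A - B\<close> is empty,
  an exchange out of \<open>B\<close> would have to produce an element of it, so the bases
  coincide.\<close>

lemma bases_card_eq: "A \<in> Bs \<Longrightarrow> B \<in> Bs \<Longrightarrow> card A = card B"
proof (induction "card (A - B)" arbitrary: A)
  case 0
  then have "A \<subseteq> B" using basis_finite by auto
  moreover have "B \<subseteq> A" using basis_exchange[OF \<open>B \<in> Bs\<close> \<open>A \<in> Bs\<close>] \<open>A \<subseteq> B\<close> by blast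
  ultimately show ?case by simp
next
  case (Suc k)
  then obtain a where a: "a \<in> A - B" by (metis card.empty equals0I nat.distinct(1))
  obtain b where b: "b \<in> B - A" "insert b (A - {a}) \<in> Bs"
    using basis_exchange[OF \<open>A \<in> Bs\<close> \<open>B \<in> Bs\<close> a] .
  have "insert b (A - {a}) - B = (A - B) - {a}" using a b by auto
  then have "k = card (insert b (A - {a}) - B)"
    using Suc(2) a basis_finite[OF \<open>A \<in> Bs\<close>] by simp
  from Suc.hyps(1)[OF this b(2) \<open>B \<in> Bs\<close>] have "card (insert b (A - {a})) = card B" .
  moreover have "card (insert b (A - {a})) = Suc (card (A - {a}))"
    using b basis_finite[OF \<open>A \<in> Bs\<close>] by simp
  moreover have "Suc (card (A - {a})) = card A"
    using a basis_finite[OF \<open>A \<in> Bs\<close>] by (intro card_Suc_Diff1) auto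
  ultimately show ?case by simp
qed

lemma indep_mono: "indep Bs J \<Longrightarrow> I \<subseteq> J \<Longrightarrow> indep Bs I"
  by (auto simp: indep_def)

lemma indep_subset: "indep Bs I \<Longrightarrow> I \<subseteq> {1..n}"
  using basis_subset by (auto simp: indep_def)

lemma indep_finite: "indep Bs I \<Longrightarrow> finite I"
  using indep_subset finite_subset by blast

lemma indep_empty: "indep Bs {}"
  using matroid by (auto simp: matroid_def indep_def)

text \<open>Extend \<open>I\<close> to a basis \<open>A\<close>, and \<open>J\<close> to a basis
  \<open>B\<close> with as little as possible outside \<open>J \<union> A\<close>. If no element of
  \<open>J - I\<close> could be added to \<open>I\<close>, exchange would force
  \<open>A - B \<subseteq> I - J\<close> and \<open>B - A = J - I\<close>; as bases have equal size,
  this gives \<open>card J \<le> card I\<close>.\<close>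

lemma indep_augment:
  assumes I: "indep Bs I" and J: "indep Bs J" and less: "card I < card J"
  obtains x where "x \<in> J - I" "indep Bs (insert x I)"
proof -
  have "\<exists>x\<in>J - I. indep Bs (insert x I)"
  proof (rule ccontr)
    assume neg: "\<not> ?thesis"
    have no: "\<not> indep Bs (insert x I)" if "x \<in> J - I" for x using that neg by blast
    obtain A where A: "A \<in> Bs" "I \<subseteq> A" using I by (auto simp: indep_def)
    have fA: "finite A" using A basis_finite by blast
    define P where "P = (\<lambda>B. B \<in> Bs \<and> J \<subseteq> B)"
    have "\<exists>B. P B" using J by (auto simp: P_def indep_def)
    then obtain B where B: "P B" and min: "\<And>B'. P B' \<Longrightarrow> card (B - (J \<union> A)) \<le> card (B' - (J \<union> A))"
      using exists_least_iff[of "\<lambda>k. \<exists>B. P B \<and> card (B - (J \<union> A)) = k"] by (metis not_le_imp_less)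
    then have BB: "B \<in> Bs" "J \<subseteq> B" by (auto simp: P_def)
    have fB: "finite B" using BB basis_finite by blast
    \<comment> \<open>An element of \<open>B\<close> outside \<open>J \<union> A\<close> could be
      exchanged for one of \<open>A\<close>, against the minimal choice of \<open>B\<close>.\<close>
    have BJA: "B \<subseteq> J \<union> A"
    proof
      fix b assume "b \<in> B"
      show "b \<in> J \<union> A"
      proof (rule ccontr)
        assume b: "b \<notin> J \<union> A"
        then obtain a where a: "a \<in> A - B" "insert a (B - {b}) \<in> Bs"
          using basis_exchange[OF BB(1) A(1)] \<open>b \<in> B\<close> by blast
        have "insert a (B - {b}) - (J \<union> A) = (B - (J \<union> A)) - {b}" using a by auto
        moreover have "card \<dots> < card (B - (J \<union> A))"
          using fB b \<open>b \<in> B\<close> by (intro psubset_card_mono) auto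
        moreover have "P (insert a (B - {b}))" using a b BB by (auto simp: P_def)
        ultimately show False using min by (metis not_le)
      qed
    qed
    have JA: "J \<inter> A \<subseteq> I"
    proof
      fix x assume x: "x \<in> J \<inter> A"
      then have "indep Bs (insert x I)" using A unfolding indep_def by blast
      then show "x \<in> I" using no x by blast
    qed
    have "A - B \<subseteq> I"
    proof
      fix a assume a: "a \<in> A - B"
      show "a \<in> I"
      proof (rule ccontr)
        assume aI: "a \<notin> I"
        obtain b where b: "b \<in> B - A" "insert b (A - {a}) \<in> Bs"
          using basis_exchange[OF A(1) BB(1) a] .
        have "b \<in> J - I" using b BJA A(2) by auto
        moreover have "indep Bs (insert b I)" using b(2) A(2) aI unfolding indep_def by (intro bexI[OF _ b(2)]) auto
        ultimately show False using no by blast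
      qed
    qed
    then have "card (A - B) \<le> card (I - J)"
      using BB(2) fA A(2) by (intro card_mono) (auto intro: finite_subset)
    moreover have "B - A = J - I" using BJA JA A(2) BB(2) by auto
    moreover have "card (A - B) = card (B - A)"
    proof -
      have "card A = card (A - B) + card (A \<inter> B)" "card B = card (B - A) + card (A \<inter> B)"
        using fA fB by (metis Int_commute add.commute card_Int_Diff)+
      then show ?thesis using bases_card_eq[OF A(1) BB(1)] by linarith
    qed
    moreover have "card I = card (I - J) + card (I \<inter> J)" "card J = card (J - I) + card (I \<inter> J)"
      using indep_finite[OF I] indep_finite[OF J] by (metis Int_commute add.commute card_Int_Diff)+
    ultimately show False using less by simp
  qed
  then show thesis using that by blast
qed

lemma finite_indeps: "finite {I. I \<subseteq> S \<and> indep Bs I}"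
  by (rule finite_subset[of _ "Pow {1..n}"]) (use indep_subset in auto)

lemma card_le_rk: "indep Bs I \<Longrightarrow> I \<subseteq> S \<Longrightarrow> card I \<le> rk Bs S"
  unfolding rk_def using finite_indeps[of S] by (intro Max_ge) auto

lemma rk_witness:
  obtains I where "I \<subseteq> S" "indep Bs I" "card I = rk Bs S"
proof -
  have "rk Bs S \<in> card ` {I. I \<subseteq> S \<and> indep Bs I}"
    unfolding rk_def using finite_indeps[of S] indep_empty by (intro Max_in) auto
  then show ?thesis using that by auto
qed

lemma indep_extend:
  assumes "indep Bs J" "J \<subseteq> S"
  obtains I where "J \<subseteq> I" "I \<subseteq> S" "indep Bs I" "card I = rk Bs S"
proof -
  have "\<exists>I. J \<subseteq> I \<and> I \<subseteq> S \<and> indep Bs I \<and> card I = rk Bs S"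
    using assms
  proof (induction "rk Bs S - card J" arbitrary: J rule: less_induct)
    case less
    obtain K where K: "K \<subseteq> S" "indep Bs K" "card K = rk Bs S" by (rule rk_witness)
    show ?case
    proof (cases "card J < card K")
      case True
      obtain x where x: "x \<in> K - J" "indep Bs (insert x J)"
        using indep_augment[OF less.prems(1) K(2) True] .
      have "card (insert x J) = Suc (card J)" using x indep_finite[OF less.prems(1)] by simp
      then have "\<exists>I. insert x J \<subseteq> I \<and> I \<subseteq> S \<and> indep Bs I \<and> card I = rk Bs S"
        using True K x less.prems by (intro less.hyps) auto
      then show ?thesis by blast
    next
      case False
      then have "card J = rk Bs S" using K card_le_rk[OF less.prems] by simp
      then show ?thesis using less.prems by blast
    qed
  qed
  then show ?thesis using that by blast
qed

lemma rk_mono: "S \<subseteq> T \<Longrightarrow> rk Bs S \<le> rk Bs T"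
  by (metis card_le_rk order_trans rk_witness)

lemma rk_indep: "indep Bs I \<Longrightarrow> rk Bs I = card I"
  by (metis card_le_rk card_mono indep_finite le_antisym order_refl rk_witness)

lemma rk_insert_le: "rk Bs (insert x S) \<le> Suc (rk Bs S)"
proof -
  obtain I where I: "I \<subseteq> insert x S" "indep Bs I" "card I = rk Bs (insert x S)" by (rule rk_witness)
  have "card (I - {x}) \<le> rk Bs S"
    using I indep_mono[OF I(2)] by (intro card_le_rk) auto
  moreover have "card I \<le> Suc (card (I - {x}))" by (cases "x \<in> I") simp_all
  ultimately show ?thesis using I(3) by simp
qed

text \<open>The form of submodularity that makes \<open>closure_in\<close> a closure operator. A
  maximal independent subset of \<open>S\<close> extends to one of \<open>T\<close>; if
  \<open>x\<close> raised the rank of \<open>T\<close>, augmentation could add only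
  \<open>x\<close>, and then \<open>x\<close> would already raise the rank of
  \<open>S\<close>.\<close>

lemma rk_insert_mono:
  assumes "S \<subseteq> T" "rk Bs (insert x S) = rk Bs S"
  shows "rk Bs (insert x T) = rk Bs T"
proof (rule ccontr)
  assume "rk Bs (insert x T) \<noteq> rk Bs T"
  then have lt: "rk Bs T < rk Bs (insert x T)" using rk_mono[OF subset_insertI, of T x] by linarith
  obtain I where I: "I \<subseteq> S" "indep Bs I" "card I = rk Bs S" by (rule rk_witness)
  obtain K where K: "I \<subseteq> K" "K \<subseteq> T" "indep Bs K" "card K = rk Bs T"
    using indep_extend[OF I(2), of T] I assms(1) by blast
  obtain L where L: "L \<subseteq> insert x T" "indep Bs L" "card L = rk Bs (insert x T)" by (rule rk_witness)
  obtain z where z: "z \<in> L - K" "indep Bs (insert z K)"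
    using indep_augment[OF K(3) L(2)] K L lt by auto
  have "card (insert z K) = Suc (rk Bs T)" using K z indep_finite[OF K(3)] by simp
  then have "z = x" using card_le_rk[OF z(2), of T] z L K by auto
  then have "indep Bs (insert x I)" using z K by (meson indep_mono insert_mono)
  moreover have "x \<notin> I" using z K \<open>z = x\<close> by auto
  ultimately show False
    using card_le_rk[of "insert x I" "insert x S"] I assms(2) indep_finite[OF I(2)] by auto
qed

section \<open>Closure and flats\<close>

definition closure_in :: "nat set \<Rightarrow> nat set" where
  "closure_in S = {x\<in>{1..n}. rk Bs (insert x S) = rk Bs S}"

lemma closure_subset: "closure_in S \<subseteq> {1..n}"
  by (auto simp: closure_in_def)

lemma closure_superset: "S \<subseteq> {1..n} \<Longrightarrow> S \<subseteq> closure_in S"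
  by (auto simp: closure_in_def insert_absorb)

lemma rk_closure:
  assumes "S \<subseteq> {1..n}"
  shows "rk Bs (closure_in S) = rk Bs S"
proof (rule ccontr)
  assume "rk Bs (closure_in S) \<noteq> rk Bs S"
  then have lt: "rk Bs S < rk Bs (closure_in S)"
    using rk_mono[OF closure_superset[OF assms]] by simp
  obtain I where I: "I \<subseteq> S" "indep Bs I" "card I = rk Bs S" by (rule rk_witness)
  obtain L where L: "L \<subseteq> closure_in S" "indep Bs L" "card L = rk Bs (closure_in S)" by (rule rk_witness)
  obtain z where z: "z \<in> L - I" "indep Bs (insert z I)"
    using indep_augment[OF I(2) L(2)] I L lt by auto
  have "card (insert z I) \<le> rk Bs (insert z S)" using z I by (intro card_le_rk) auto
  also have "\<dots> = rk Bs S" using z L by (auto simp: closure_in_def)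
  finally show False using I z indep_finite[OF I(2)] by simp
qed

lemma flat_closure:
  assumes "S \<subseteq> {1..n}"
  shows "flat n Bs (closure_in S)"
  unfolding flat_def
proof (intro conjI ballI closure_subset)
  fix x assume x: "x \<in> {1..n} - closure_in S"
  have "rk Bs S < rk Bs (insert x S)" using x rk_mono[of S "insert x S"] by (force simp: closure_in_def)
  also have "\<dots> \<le> rk Bs (insert x (closure_in S))"
    using closure_superset[OF assms] by (intro rk_mono) auto
  finally show "rk Bs (closure_in S) < rk Bs (insert x (closure_in S))" using rk_closure[OF assms] by simp
qed

lemma flat_subset: "flat n Bs F \<Longrightarrow> F \<subseteq> {1..n}"
  by (simp add: flat_def)

lemma closure_least:
  assumes "flat n Bs G" "S \<subseteq> G"
  shows "closure_in S \<subseteq> G"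
proof
  fix x assume x: "x \<in> closure_in S"
  then have "rk Bs (insert x G) = rk Bs G" using rk_insert_mono[OF assms(2)] by (simp add: closure_in_def)
  then show "x \<in> G" using assms(1) x by (force simp: flat_def closure_in_def)
qed

lemma flat_eq_of_rk:
  assumes F: "flat n Bs F" and G: "flat n Bs G" and "F \<subseteq> G" "rk Bs G \<le> rk Bs F"
  shows "F = G"
proof (rule ccontr)
  assume "F \<noteq> G"
  then obtain x where x: "x \<in> G - F" using \<open>F \<subseteq> G\<close> by blast
  then have "rk Bs F < rk Bs (insert x F)" using F flat_subset[OF G] by (auto simp: flat_def)
  also have "\<dots> \<le> rk Bs G" using x \<open>F \<subseteq> G\<close> by (intro rk_mono) auto
  finally show False using assms by simp
qed

lemma rk_flat_insert:
  assumes F: "flat n Bs F" and "x \<in> {1..n} - F"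
  shows "rk Bs (insert x F) = Suc (rk Bs F)"
  using assms rk_insert_le[of x F] by (force simp: flat_def)

lemma flat_ground: "flat n Bs {1..n}"
  by (auto simp: flat_def)

section \<open>Bases and fundamental circuits\<close>

lemma rk_basis: "B \<in> Bs \<Longrightarrow> card B = rk Bs {1..n}"
  by (metis basis_subset bases_card_eq card_le_rk card_mono basis_finite indep_def le_antisym order_refl rk_witness)

lemma indep_card_basis: "indep Bs I \<Longrightarrow> card I = rk Bs {1..n} \<Longrightarrow> I \<in> Bs"
  by (metis card_subset_eq basis_finite indep_def rk_basis)

text \<open>Replaces the \<open>THE\<close> of the definition by a deletion test, on which all later
  arguments about activity rest. A circuit inside \<open>insert x B\<close> contains every
  \<open>y\<close> whose deletion leaves an independent set. Conversely, the circuit without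
  \<open>y\<close> extends to an independent set of size \<open>card B\<close> inside
  \<open>insert x B\<close>, and this can only be the set with \<open>y\<close> deleted.\<close>

lemma fund_circuit_eq:
  assumes B: "B \<in> Bs" and x: "x \<in> {1..n} - B"
  shows "fund_circuit n Bs B x = {y\<in>insert x B. indep Bs (insert x B - {y})}"
proof -
  let ?D = "insert x B" and ?C = "{y\<in>insert x B. indep Bs (insert x B - {y})}"
  have D: "?D \<subseteq> {1..n}" using basis_subset[OF B] x by auto
  have fB: "finite B" using basis_finite[OF B] .
  have dep: "\<not> indep Bs ?D"
  proof
    assume "indep Bs ?D"
    from card_le_rk[OF this D] rk_basis[OF B] show False using x fB by simp
  qed
  have rkD: "rk Bs ?D = card B"
  proof (rule antisym)
    show "rk Bs ?D \<le> card B" using rk_mono[OF D] rk_basis[OF B] by simp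
    have "indep Bs B" using B by (auto simp: indep_def)
    then show "card B \<le> rk Bs ?D" by (rule card_le_rk) auto
  qed
  have unique: "C = ?C" if C: "circuit n Bs C" "C \<subseteq> ?D" for C
  proof
    show "?C \<subseteq> C"
    proof
      fix y assume y: "y \<in> ?C"
      then have "\<not> C \<subseteq> ?D - {y}"
        using C(1) indep_mono[of "?D - {y}" C] by (auto simp: circuit_def)
      then show "y \<in> C" using C by blast
    qed
    show "C \<subseteq> ?C"
    proof
      fix y assume y: "y \<in> C"
      have "indep Bs (C - {y})" using C y by (auto simp: circuit_def)
      then obtain I where I: "C - {y} \<subseteq> I" "I \<subseteq> ?D" "indep Bs I" "card I = card B"
        using indep_extend[of "C - {y}" ?D] C rkD by auto
      have "y \<notin> I" using I C y indep_mono[of I C] by (auto simp: circuit_def)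
      then have "I = ?D - {y}"
        using I y C x fB by (intro card_subset_eq) (auto simp: card.insert_remove)
      then show "y \<in> ?C" using I y C by auto
    qed
  qed
  have "\<exists>C. circuit n Bs C \<and> C \<subseteq> ?D"
  proof -
    have "finite {C. C \<subseteq> ?D \<and> \<not> indep Bs C}" using fB by simp
    from finite_has_minimal2[OF this, of ?D] obtain C where C: "C \<subseteq> ?D" "\<not> indep Bs C"
      and min: "\<forall>C'. C' \<subseteq> ?D \<and> \<not> indep Bs C' \<longrightarrow> C' \<subseteq> C \<longrightarrow> C = C'"
      using dep by auto
    then have "circuit n Bs C" using D unfolding circuit_def by blast
    with C show ?thesis by blast
  qed
  then obtain C0 where C0: "circuit n Bs C0 \<and> C0 \<subseteq> ?D" by blast
  have "fund_circuit n Bs B x = C0"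
    unfolding fund_circuit_def by (rule the_equality) (use C0 unique in blast)+
  then show ?thesis using C0 unique by blast
qed

end


section \<open>Complete flags of flats\<close>

fun lex_value :: "nat \<Rightarrow> (nat \<Rightarrow> nat) \<Rightarrow> nat \<Rightarrow> nat" where
  "lex_value N a 0 = 0"
| "lex_value N a (Suc k) = lex_value N a k * N + a k"

lemma lex_value_cong: "(\<And>i. i < k \<Longrightarrow> a i = b i) \<Longrightarrow> lex_value N a k = lex_value N b k"
  by (induction k) auto

text \<open>The digits of \<open>a\<close> are below \<open>N\<close>, so its tail stays below one
  unit of the differing place; the tail of \<open>b\<close> can only enlarge the right-hand
  side.\<close>

lemma lex_value_less:
  assumes "i < k" "\<And>j. j < i \<Longrightarrow> a j = b j" "a i < b i" "\<And>j. j < k \<Longrightarrow> a j < N"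
  shows "lex_value N a k < lex_value N b k"
  using assms(1,4)
proof (induction k)
  case (Suc k)
  show ?case
  proof (cases "i = k")
    case True
    then show ?thesis using lex_value_cong[of k a b N] assms(2,3) by simp
  next
    case False
    then have "lex_value N a k < lex_value N b k" using Suc by simp
    then have "Suc (lex_value N a k) * N \<le> lex_value N b k * N" by (intro mult_le_mono1) simp
    moreover have "a k < N" using Suc.prems by simp
    ultimately show ?thesis by simp
  qed
qed simp

lemma lex_value_bound: "(\<And>j. j < k \<Longrightarrow> a j < N) \<Longrightarrow> lex_value N a k < N ^ k"
proof (induction k)
  case (Suc k)
  then have "Suc (lex_value N a k) * N \<le> N ^ k * N" by (intro mult_le_mono1) simp
  moreover have "a k < N" using Suc.prems by simp
  ultimately show ?case by (simp add: mult.commute)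
qed simp

locale loopless_matroid = matroid_on +
  fixes r :: nat
  assumes loopless: "loopless n Bs" and rank: "r = rk Bs {1..n}" and rank_pos: "r > 0"
begin

text \<open>A flag is a total function, constant from \<open>r\<close> on, so that flags with the
  same members are equal as functions and can be counted. The values at \<open>0\<close> and
  \<open>r\<close> are forced: looplessness gives \<open>{}\<close> and full rank gives
  \<open>{1..n}\<close>.\<close>

definition is_flag :: "(nat \<Rightarrow> nat set) \<Rightarrow> bool" where
  "is_flag f \<longleftrightarrow> (\<forall>k\<le>r. flat n Bs (f k) \<and> rk Bs (f k) = k) \<and> (\<forall>k<r. f k \<subseteq> f (Suc k)) \<and>
     (\<forall>k>r. f k = {1..n})"

definition flag_sets :: "(nat \<Rightarrow> nat set) \<Rightarrow> nat set set" where
  "flag_sets f = f ` {1..<r}"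

definition label :: "(nat \<Rightarrow> nat set) \<Rightarrow> nat \<Rightarrow> nat" where
  "label f k = Min (f (Suc k) - f k)"

text \<open>The members that can be traded for a different flat so as to obtain a lexicographically
  smaller flag. In shelling language this is the restriction face of the facet
  \<open>flag_sets f\<close>.\<close>

definition descents :: "(nat \<Rightarrow> nat set) \<Rightarrow> nat set set" where
  "descents f = f ` {k\<in>{1..<r}. label f k < label f (k - 1)}"

text \<open>The order of weights is the lexicographic order of label sequences.\<close>

definition weight :: "(nat \<Rightarrow> nat set) \<Rightarrow> nat" where
  "weight f = lex_value (Suc n) (label f) r"

definition is_chain :: "nat set set \<Rightarrow> bool" where
  "is_chain c \<longleftrightarrow> c \<subseteq> proper_flats n Bs \<and> (\<forall>F\<in>c. \<forall>G\<in>c. F \<subseteq> G \<or> G \<subseteq> F)"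

definition least_flag :: "nat set set \<Rightarrow> nat \<Rightarrow> nat set" where
  "least_flag c = (ARG_MIN weight f. is_flag f \<and> c \<subseteq> flag_sets f)"

lemma is_chain_mono: "is_chain c \<Longrightarrow> b \<subseteq> c \<Longrightarrow> is_chain b"
  unfolding is_chain_def by blast

section \<open>Elementary facts about flags and labels\<close>

lemma flag_flat: "is_flag f \<Longrightarrow> k \<le> r \<Longrightarrow> flat n Bs (f k)"
  and flag_rk: "is_flag f \<Longrightarrow> k \<le> r \<Longrightarrow> rk Bs (f k) = k"
  by (auto simp: is_flag_def)

lemma flag_top: "is_flag f \<Longrightarrow> r \<le> k \<Longrightarrow> f k = {1..n}"
proof (cases "k = r")
  case True
  assume f: "is_flag f"
  show ?thesis
    using flat_eq_of_rk[OF flag_flat[OF f, of r] flat_ground] flag_rk[OF f, of r]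
      flat_subset[OF flag_flat[OF f, of r]] rank True by simp
qed (auto simp: is_flag_def)

lemma flag_subset_ground: "is_flag f \<Longrightarrow> f k \<subseteq> {1..n}"
  using flag_flat flat_subset flag_top by (metis nat_le_linear order_refl)

lemma flag_finite: "is_flag f \<Longrightarrow> finite (f k)"
  using flag_subset_ground finite_subset by blast

lemma flag_mono: "is_flag f \<Longrightarrow> i \<le> j \<Longrightarrow> f i \<subseteq> f j"
proof (rule lift_Suc_mono_le[of f])
  fix k assume f: "is_flag f"
  show "f k \<subseteq> f (Suc k)"
  proof (cases "k < r")
    case True then show ?thesis using f by (auto simp: is_flag_def)
  next
    case False then show ?thesis using flag_top[OF f] by simp
  qed
qed auto

lemma flag_inj: "is_flag f \<Longrightarrow> i \<le> r \<Longrightarrow> j \<le> r \<Longrightarrow> f i = f j \<Longrightarrow> i = j"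
  using flag_rk by metis

lemma flat_rk_0: "flat n Bs F \<Longrightarrow> rk Bs F = 0 \<Longrightarrow> F = {}"
proof (rule ccontr)
  assume F: "flat n Bs F" "rk Bs F = 0" "F \<noteq> {}"
  then obtain x where x: "x \<in> F" by blast
  then have "indep Bs {x}" using flat_subset[OF F(1)] loopless by (auto simp: loopless_def)
  then show False using card_le_rk[of "{x}" F] x F by simp
qed

lemma flag_0: "is_flag f \<Longrightarrow> f 0 = {}"
  using flag_flat flag_rk flat_rk_0 by simp

lemma label_mem: "is_flag f \<Longrightarrow> k < r \<Longrightarrow> label f k \<in> f (Suc k) - f k"
proof -
  assume f: "is_flag f" and k: "k < r"
  have "f (Suc k) - f k \<noteq> {}"
    using flag_mono[OF f, of k "Suc k"] flag_inj[OF f, of k "Suc k"] k by auto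
  then show ?thesis unfolding label_def using flag_finite[OF f, of "Suc k"] by (intro Min_in) auto
qed

lemma label_le: "is_flag f \<Longrightarrow> x \<in> f (Suc k) - f k \<Longrightarrow> label f k \<le> x"
  unfolding label_def using flag_finite[of f "Suc k"] by (intro Min_le) auto

lemma label_mem_iff: "is_flag f \<Longrightarrow> l < r \<Longrightarrow> label f l \<in> f j \<longleftrightarrow> l < j"
  using label_mem[of f l] flag_mono[of f j l] flag_mono[of f "Suc l" j] by (metis DiffD1 DiffD2 Suc_leI in_mono leI)

lemma label_bound: "is_flag f \<Longrightarrow> k < r \<Longrightarrow> label f k \<in> {1..n}"
  using label_mem flag_subset_ground by blast

text \<open>Any element new at step \<open>k\<close> spans the next member, by comparison of ranks.
  Hence a flag is determined by its label sequence, which makes \<open>weight\<close>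
  injective.\<close>

lemma flag_step:
  assumes f: "is_flag f" and k: "k < r" and x: "x \<in> f (Suc k) - f k"
  shows "f (Suc k) = closure_in (insert x (f k))"
proof -
  have sub: "insert x (f k) \<subseteq> f (Suc k)" using flag_mono[OF f, of k "Suc k"] x by auto
  have g: "insert x (f k) \<subseteq> {1..n}" using sub flag_subset_ground[OF f] by blast
  have "rk Bs (closure_in (insert x (f k))) = Suc k"
    using rk_closure[OF g] rk_flat_insert[OF flag_flat[OF f], of k x] flag_rk[OF f, of k] k x g by auto
  then show ?thesis
    using flat_eq_of_rk[OF flat_closure[OF g] flag_flat[OF f], of "Suc k"] k flag_rk[OF f, of "Suc k"]
      closure_least[OF flag_flat[OF f] sub] by simp
qed

lemma first_difference:
  assumes f: "is_flag f" and g: "is_flag g" and "f \<noteq> g"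
  obtains i where "i < r" "\<And>k. k \<le> i \<Longrightarrow> f k = g k" "f (Suc i) \<noteq> g (Suc i)"
    "\<And>k. k < i \<Longrightarrow> label f k = label g k" "label f i \<noteq> label g i"
proof -
  define j where "j = (LEAST j. f j \<noteq> g j)"
  have "\<exists>j. f j \<noteq> g j" using \<open>f \<noteq> g\<close> by auto
  then have j: "f j \<noteq> g j" unfolding j_def by (rule LeastI_ex)
  have least: "f k = g k" if "k < j" for k using that not_less_Least unfolding j_def by blast
  have "j \<noteq> 0" using j flag_0[OF f] flag_0[OF g] by metis
  then obtain i where i: "j = Suc i" using not0_implies_Suc by blast
  have "i < r" using j flag_top[OF f, of j] flag_top[OF g, of j] i by (metis Suc_leI leI le_SucI)
  moreover have "label f i \<noteq> label g i"
    using flag_step[OF f \<open>i < r\<close> label_mem[OF f \<open>i < r\<close>]]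
      flag_step[OF g \<open>i < r\<close> label_mem[OF g \<open>i < r\<close>]] least[of i] i j by auto
  ultimately show ?thesis using that[of i] i j least by (simp add: label_def)
qed

section \<open>Lexicographic comparison of flags\<close>

lemma weight_less:
  assumes "is_flag f" "i < r" "\<And>k. k < i \<Longrightarrow> label f k = label g k" "label f i < label g i"
  shows "weight f < weight g"
  unfolding weight_def by (rule lex_value_less[where i = i]) (use assms label_bound[OF assms(1)] in \<open>auto simp: less_Suc_eq_le\<close>)

lemma weight_inj:
  assumes f: "is_flag f" and g: "is_flag g" and eq: "weight f = weight g"
  shows "f = g"
proof (rule ccontr)
  assume "f \<noteq> g"
  then obtain i where i: "i < r" "\<And>k. k < i \<Longrightarrow> label f k = label g k" "label f i \<noteq> label g i"
    using first_difference[OF f g] by metis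
  then show False
    using weight_less[OF f, of i g] weight_less[OF g, of i f] eq by (metis less_irrefl linorder_neqE_nat)
qed

lemma weight_bound: "is_flag f \<Longrightarrow> weight f < Suc n ^ r"
  unfolding weight_def using label_bound[of f] by (intro lex_value_bound) (auto simp: less_Suc_eq_le)

lemma finite_flags: "finite {f. is_flag f}"
proof (rule finite_imageD)
  show "finite (weight ` {f. is_flag f})"
    by (rule finite_subset[of _ "{..<Suc n ^ r}"]) (use weight_bound in auto)
qed (use weight_inj in \<open>auto simp: inj_on_def\<close>)

lemma flag_sets_chain: "is_flag f \<Longrightarrow> is_chain (flag_sets f)"
  unfolding is_chain_def
proof (intro conjI subsetI ballI)
  assume f: "is_flag f"
  fix F assume "F \<in> flag_sets f"
  then obtain k where k: "k \<in> {1..<r}" "F = f k" by (auto simp: flag_sets_def)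
  then show "F \<in> proper_flats n Bs"
    using flag_flat[OF f, of k] flag_inj[OF f, of k 0] flag_inj[OF f, of k r] flag_0[OF f] flag_top[OF f, of r]
    by (auto simp: proper_flats_def)
next
  fix F G assume f: "is_flag f" and "F \<in> flag_sets f" "G \<in> flag_sets f"
  then obtain i j where "F = f i" "G = f j" by (auto simp: flag_sets_def)
  then show "F \<subseteq> G \<or> G \<subseteq> F" using flag_mono[OF f, of i j] flag_mono[OF f, of j i] by (cases "i \<le> j") auto
qed

lemma descents_subset: "descents f \<subseteq> flag_sets f"
  by (auto simp: descents_def flag_sets_def)

lemma card_flag_sets: "is_flag f \<Longrightarrow> card (flag_sets f) = r - 1"
  unfolding flag_sets_def using flag_inj by (subst card_image) (auto simp: inj_on_def)

lemma flag_difference_step: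
  assumes f: "is_flag f" and x: "x \<in> f j - f i"
  obtains l where "i \<le> l" "l < j" "x \<in> f (Suc l) - f l"
proof -
  define m where "m = (LEAST m. x \<in> f m)"
  have m: "x \<in> f m" unfolding m_def using x by (auto intro: LeastI)
  have "m \<le> j" unfolding m_def using x by (auto intro: Least_le)
  have "i < m" using m x flag_mono[OF f, of m i] by (metis DiffD2 in_mono leI)
  then obtain l where l: "m = Suc l" by (cases m) auto
  have "x \<notin> f l" using not_less_Least[of l "\<lambda>m. x \<in> f m"] l unfolding m_def by simp
  then show ?thesis using that[of l] l m \<open>i < m\<close> \<open>m \<le> j\<close> by auto
qed

text \<open>Between the first divergence, after index \<open>i\<close>, and the next agreement at
  \<open>k\<close>, no member of \<open>f\<close> is a descent: it would belong to \<open>c\<close>,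
  hence to \<open>g\<close>, at the same rank. So the labels of \<open>f\<close> do not fall from
  \<open>i\<close> on, and \<open>label f i\<close> is the minimum of \<open>f k - f i\<close>, a
  set that contains \<open>label g i\<close>.\<close>

lemma weight_less_of_descents:
  assumes f: "is_flag f" and g: "is_flag g" and "f \<noteq> g"
    and c: "descents f \<subseteq> c" "c \<subseteq> flag_sets f" "c \<subseteq> flag_sets g"
  shows "weight f < weight g"
proof -
  obtain i where i: "i < r" "\<And>k. k \<le> i \<Longrightarrow> f k = g k" "f (Suc i) \<noteq> g (Suc i)"
    "\<And>k. k < i \<Longrightarrow> label f k = label g k" "label f i \<noteq> label g i"
    using first_difference[OF f g \<open>f \<noteq> g\<close>] by metis
  \<comment> \<open>Both flags end in the ground set, so index \<open>r\<close> satisfies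
    \<open>P\<close> and the least such index exists.\<close>
  define P where "P = (\<lambda>k. i < k \<and> k \<le> r \<and> f k = g k)"
  define k where "k = (LEAST k. P k)"
  have "P r" using i flag_top[OF f] flag_top[OF g] by (auto simp: P_def)
  then have k: "P k" unfolding k_def by (rule LeastI)
  have least: "\<not> P l" if "l < k" for l using that not_less_Least unfolding k_def by blast
  have rising: "label f (l - 1) \<le> label f l" if "i < l" "l < k" for l
  proof (rule ccontr)
    assume "\<not> label f (l - 1) \<le> label f l"
    then have "f l \<in> descents f" using that k by (auto simp: descents_def P_def)
    then have "f l \<in> flag_sets g" using c by auto
    then obtain m where m: "m < r" "f l = g m" by (auto simp: flag_sets_def)
    then have "m = l" using flag_rk[OF f, of l] flag_rk[OF g, of m] that k by (auto simp: P_def)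
    then show False using least[OF that(2)] m that k by (auto simp: P_def)
  qed
  have min: "label f i \<le> label f l" if "i \<le> l" "l < k" for l
    using that
  proof (induction l rule: dec_induct)
    case (step l)
    then show ?case using rising[of "Suc l"] by auto
  qed simp
  have "label g i \<in> g (Suc i) - g i" by (rule label_mem[OF g i(1)])
  then have "label g i \<in> f k - f i"
    using flag_mono[OF g, of "Suc i" k] k i by (auto simp: P_def)
  then obtain l where "i \<le> l" "l < k" "label g i \<in> f (Suc l) - f l"
    by (rule flag_difference_step[OF f])
  then have "label f i \<le> label g i" using min label_le[OF f] by (meson order_trans)
  then show ?thesis using weight_less[OF f i(1,4)] i(5) by simp
qed

text \<open>Bring the label of the descent forward by one step: \<open>f k\<close> is replaced by
  the closure of its predecessor together with \<open>label f k\<close>. The label at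
  \<open>k - 1\<close> becomes at most \<open>label f k\<close>, hence smaller than before, and the
  only member given up is \<open>f k\<close>, which is not in \<open>c\<close>.\<close>

lemma descent_exchange:
  assumes f: "is_flag f" and c: "c \<subseteq> flag_sets f" and F: "F \<in> descents f" "F \<notin> c"
  obtains g where "is_flag g" "c \<subseteq> flag_sets g" "weight g < weight f"
proof -
  obtain k where k: "1 \<le> k" "k < r" "label f k < label f (k - 1)" "F = f k"
    using F by (auto simp: descents_def)
  then obtain j where j: "k = Suc j" by (metis One_nat_def Suc_le_D)
  define x where "x = label f k"
  define G where "G = closure_in (insert x (f j))"
  define g where "g = f(k := G)"
  have x: "x \<in> f (Suc k)" "x \<notin> f k" "x \<notin> f j"
    using label_mem[OF f k(2)] flag_mono[OF f, of j k] j by (auto simp: x_def)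
  have sub: "insert x (f j) \<subseteq> f (Suc k)" using x flag_mono[OF f, of j "Suc k"] j by auto
  have g0: "insert x (f j) \<subseteq> {1..n}" using sub flag_subset_ground[OF f] by blast
  have rkG: "rk Bs G = k"
    unfolding G_def rk_closure[OF g0]
    using rk_flat_insert[OF flag_flat[OF f], of j x] flag_rk[OF f, of j] k j x g0 by auto
  have flatG: "flat n Bs G" unfolding G_def by (rule flat_closure[OF g0])
  have "f j \<subseteq> G" "x \<in> G" using closure_superset[OF g0] by (auto simp: G_def)
  have "G \<subseteq> f (Suc k)" unfolding G_def using closure_least[OF flag_flat[OF f] sub] k by simp
  have g: "is_flag g"
    unfolding is_flag_def
  proof (intro conjI allI impI)
    fix i assume "i \<le> r" then show "flat n Bs (g i)" "rk Bs (g i) = i"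
      using flatG rkG flag_flat[OF f] flag_rk[OF f] by (auto simp: g_def)
  next
    fix i assume "i < r"
    then show "g i \<subseteq> g (Suc i)"
      using \<open>f j \<subseteq> G\<close> \<open>G \<subseteq> f (Suc k)\<close> flag_mono[OF f, of i "Suc i"] j by (auto simp: g_def)
  next
    fix i assume "r < i" then show "g i = {1..n}" using k flag_top[OF f, of i] by (auto simp: g_def)
  qed
  have "c \<subseteq> flag_sets g"
  proof
    fix H assume "H \<in> c"
    then obtain i where "i \<in> {1..<r}" "H = f i" using c by (auto simp: flag_sets_def)
    then show "H \<in> flag_sets g" using F k \<open>H \<in> c\<close> by (auto simp: flag_sets_def g_def intro!: image_eqI[of _ _ i])
  qed
  moreover have "weight g < weight f"
  proof (rule weight_less[OF g, of j])
    show "j < r" using j k by simp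
    show "label g i = label f i" if "i < j" for i using that j by (simp add: label_def g_def)
    have "label g j \<le> x" using \<open>x \<in> G\<close> x j by (intro label_le[OF g]) (auto simp: g_def)
    then show "label g j < label f j" using k j by (simp add: x_def)
  qed
  ultimately show ?thesis using that g by blast
qed

lemma rk_proper_flat:
  assumes "H \<in> proper_flats n Bs"
  shows "flat n Bs H" "1 \<le> rk Bs H" "rk Bs H < r"
proof -
  show H: "flat n Bs H" using assms by (simp add: proper_flats_def)
  show "1 \<le> rk Bs H" using flat_rk_0[OF H] assms by (cases "rk Bs H") (auto simp: proper_flats_def)
  show "rk Bs H < r"
    using flat_eq_of_rk[OF H flat_ground flat_subset[OF H]] assms rank
    by (force simp: proper_flats_def)
qed

lemma finite_proper_flats: "finite (proper_flats n Bs)"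
  by (rule finite_subset[of _ "Pow {1..n}"]) (auto simp: proper_flats_def flat_def)

text \<open>The flag grows one rank at a time, each new member comparable with all of
  \<open>c\<close>. It is spanned inside the smallest element of \<open>c\<close>, or the ground
  set, that is not yet contained in the previous member; this preserves comparability. An element of
  \<open>c\<close> of rank \<open>k\<close> is then comparable with the \<open>k\<close>-th member
  and of equal rank, hence equal to it.\<close>

lemma flag_extending_chain:
  assumes c: "is_chain c"
  obtains f where "is_flag f" "c \<subseteq> flag_sets f"
proof -
  define Q where "Q = (\<lambda>f k. (\<forall>j\<le>k. flat n Bs (f j) \<and> rk Bs (f j) = j \<and> (\<forall>H\<in>c. f j \<subseteq> H \<or> H \<subseteq> f j)) \<and>
     (\<forall>j<k. f j \<subseteq> f (Suc j)))"
  have "\<exists>f. Q f k" if "k \<le> r" for k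
    using that
  proof (induction k)
    case 0
    have "flat n Bs {}"
      unfolding flat_def
    proof (intro conjI ballI)
      fix x assume "x \<in> {1..n} - {}"
      then have "indep Bs {x}" using loopless by (auto simp: loopless_def)
      then show "rk Bs {} < rk Bs (insert x {})" using rk_indep indep_empty by simp
    qed simp
    then have "Q (\<lambda>_. {}) 0" using rk_indep[OF indep_empty] by (simp add: Q_def)
    then show ?case by blast
  next
    case (Suc k)
    then obtain f where f: "Q f k" by auto
    define F where "F = f k"
    have F: "flat n Bs F" "rk Bs F = k" "\<And>H. H \<in> c \<Longrightarrow> F \<subseteq> H \<or> H \<subseteq> F"
      using f by (auto simp: Q_def F_def)
    \<comment> \<open>The ground set is added so that there is still a target once all of
      \<open>c\<close> has been absorbed.\<close>
    define Above where "Above = {H\<in>insert {1..n} c. \<not> H \<subseteq> F}"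
    have "F \<noteq> {1..n}" using F(2) Suc.prems rank by auto
    then have "{1..n} \<in> Above" using flat_subset[OF F(1)] by (auto simp: Above_def)
    then obtain G where G: "G \<in> Above" and Gmin: "\<And>H. H \<in> Above \<Longrightarrow> card G \<le> card H"
      using arg_min_nat_lemma[of "\<lambda>H. H \<in> Above" _ card] by metis
    have ground: "H \<subseteq> {1..n}" if "H \<in> insert {1..n} c" for H
      using that c flat_subset unfolding is_chain_def proper_flats_def by auto
    have flatG: "flat n Bs G" using G c flat_ground unfolding is_chain_def proper_flats_def Above_def by auto
    have GH: "G \<subseteq> H" if "H \<in> Above" for H
    proof -
      have "G \<in> insert {1..n} c" "H \<in> insert {1..n} c" using G that by (auto simp: Above_def)
      then have "G \<subseteq> H \<or> H \<subseteq> G"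
        using ground[of G] ground[of H] c unfolding is_chain_def by blast
      moreover have "H = G" if "H \<subseteq> G"
        using that Gmin[OF \<open>H \<in> Above\<close>] flat_subset[OF flatG] by (intro card_seteq) (auto intro: finite_subset)
      ultimately show ?thesis by auto
    qed
    obtain x where x: "x \<in> G - F" using G by (auto simp: Above_def)
    have sub: "insert x F \<subseteq> G" using x F(3)[of G] G flat_subset[OF F(1)] by (auto simp: Above_def)
    have g: "insert x F \<subseteq> {1..n}" using sub flat_subset[OF flatG] by blast
    define N where "N = closure_in (insert x F)"
    have N: "flat n Bs N" "rk Bs N = Suc k" "F \<subseteq> N" "N \<subseteq> G"
      using flat_closure[OF g] rk_closure[OF g] rk_flat_insert[OF F(1), of x] x g F(2) closure_superset[OF g]
        closure_least[OF flatG sub] by (auto simp: N_def)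
    have NH: "N \<subseteq> H \<or> H \<subseteq> N" if "H \<in> c" for H
      using GH[of H] N that by (auto simp: Above_def)
    have "Q (f(Suc k := N)) (Suc k)"
      using f N NH unfolding Q_def F_def by (auto simp: le_Suc_eq less_Suc_eq)
    then show ?case by blast
  qed
  then obtain f where f: "Q f r" by blast
  define g where "g = (\<lambda>k. if k \<le> r then f k else {1..n})"
  have "is_flag g" using f by (auto simp: is_flag_def g_def Q_def)
  moreover have "c \<subseteq> flag_sets g"
  proof
    fix H assume H: "H \<in> c"
    then have P: "H \<in> proper_flats n Bs" using c by (auto simp: is_chain_def)
    define k where "k = rk Bs H"
    have k: "1 \<le> k" "k < r" "flat n Bs H" using rk_proper_flat[OF P] by (auto simp: k_def)
    have fk: "flat n Bs (f k)" "rk Bs (f k) = k" "f k \<subseteq> H \<or> H \<subseteq> f k"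
      using f H k by (auto simp: Q_def)
    then have "H = f k"
      using flat_eq_of_rk[OF fk(1) k(3)] flat_eq_of_rk[OF k(3) fk(1)] by (auto simp: k_def)
    then show "H \<in> flag_sets g" using k by (auto simp: flag_sets_def g_def)
  qed
  ultimately show ?thesis using that by blast
qed

lemma least_flag:
  assumes "is_chain c"
  shows "is_flag (least_flag c)" "c \<subseteq> flag_sets (least_flag c)"
    "\<And>f. is_flag f \<Longrightarrow> c \<subseteq> flag_sets f \<Longrightarrow> weight (least_flag c) \<le> weight f"
proof -
  obtain f where "is_flag f \<and> c \<subseteq> flag_sets f" using flag_extending_chain[OF assms] by blast
  from arg_min_nat_lemma[of "\<lambda>f. is_flag f \<and> c \<subseteq> flag_sets f", OF this, of weight]
  show "is_flag (least_flag c)" "c \<subseteq> flag_sets (least_flag c)"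
    "\<And>f. is_flag f \<Longrightarrow> c \<subseteq> flag_sets f \<Longrightarrow> weight (least_flag c) \<le> weight f"
    unfolding least_flag_def by auto
qed

text \<open>The intervals from \<open>descents f\<close> to \<open>flag_sets f\<close> partition the
  set of all chains, which is the shelling property. A descent missing from \<open>c\<close> would
  allow a lighter flag by exchange; conversely, a flag whose descents all lie in \<open>c\<close> is
  lighter than every other flag through \<open>c\<close>.\<close>

lemma least_flag_eq_iff:
  assumes f: "is_flag f" and c: "is_chain c"
  shows "least_flag c = f \<longleftrightarrow> descents f \<subseteq> c \<and> c \<subseteq> flag_sets f"
proof
  assume eq: "least_flag c = f"
  have "descents f \<subseteq> c"
  proof
    fix F assume F: "F \<in> descents f"
    show "F \<in> c"
    proof (rule ccontr)
      assume "F \<notin> c"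
      then obtain g where "is_flag g" "c \<subseteq> flag_sets g" "weight g < weight f"
        using descent_exchange[OF f _ F] least_flag(2)[OF c] eq by metis
      then show False using least_flag(3)[OF c] eq by (metis not_le)
    qed
  qed
  then show "descents f \<subseteq> c \<and> c \<subseteq> flag_sets f" using least_flag(2)[OF c] eq by simp
next
  assume "descents f \<subseteq> c \<and> c \<subseteq> flag_sets f"
  then show "least_flag c = f"
    using weight_less_of_descents[OF f least_flag(1)[OF c], of c] least_flag(2)[OF c] least_flag(3)[OF c f]
    by (metis not_le)
qed

lemma weight_least_flag_mono:
  "is_chain c \<Longrightarrow> b \<subseteq> c \<Longrightarrow> weight (least_flag b) \<le> weight (least_flag c)"
  using least_flag(3)[OF is_chain_mono[of c b], of "least_flag c"] least_flag(1,2)[of c] by blast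

text \<open>The difference of the coordinate vectors at the labels just before and just after
  \<open>f k\<close>; for \<open>k = r\<close> no label follows and one coordinate vector remains.
  The family is dual to the functionals adding up the coordinates in \<open>f 1\<close>, ...,
  \<open>f r\<close>. For \<open>k < r\<close> the coordinates sum to zero, so wedging with the
  vector stays within the sum-zero forms.\<close>

definition dual_vector :: "(nat \<Rightarrow> nat set) \<Rightarrow> nat \<Rightarrow> nat \<Rightarrow> complex" where
  "dual_vector f k i = of_bool (i = label f (k - 1)) - of_bool (k < r \<and> i = label f k)"

lemma sum_dual_vector:
  assumes f: "is_flag f" and jk: "1 \<le> k" "k \<le> r" "j \<le> r"
  shows "(\<Sum>i\<in>f j. dual_vector f k i) = of_bool (j = k)"
proof -
  have *: "(\<Sum>i\<in>f j. of_bool (P \<and> i = x) :: complex) = of_bool (P \<and> x \<in> f j)" for P x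
    using flag_finite[OF f, of j] by (cases P) (auto simp: of_bool_def)
  have "(\<Sum>i\<in>f j. dual_vector f k i) = of_bool (k - 1 < j) - of_bool (k < r \<and> k < j)"
    using *[of True "label f (k - 1)"] *[of "k < r" "label f k"] jk
      label_mem_iff[OF f, of "k - 1" j] label_mem_iff[OF f, of k j]
    unfolding dual_vector_def sum_subtractf by (cases "k < r") simp_all
  moreover have "k - 1 < j \<longleftrightarrow> k \<le> j" "k < r \<and> k < j \<longleftrightarrow> k < j" using jk by linarith+
  ultimately show ?thesis by (simp add: of_bool_def)
qed

lemma dual_vector_support: "is_flag f \<Longrightarrow> 1 \<le> k \<Longrightarrow> k \<le> r \<Longrightarrow> dual_vector f k i \<noteq> 0 \<Longrightarrow> i \<in> {1..n}"
  using label_bound[of f "k - 1"] label_bound[of f k] by (auto simp: dual_vector_def of_bool_def split: if_splits)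

end


section \<open>Decreasing flags and NBC bases\<close>

context loopless_matroid
begin

text \<open>The flags whose restriction face is the whole facet, the homology facets of the
  shelling.\<close>

definition decreasing :: "(nat \<Rightarrow> nat set) \<Rightarrow> bool" where
  "decreasing f \<longleftrightarrow> is_flag f \<and> descents f = flag_sets f"

lemma decreasing_iff: "decreasing f \<longleftrightarrow> is_flag f \<and> (\<forall>k. Suc k < r \<longrightarrow> label f (Suc k) < label f k)"
proof (cases "is_flag f")
  case f: True
  have "descents f = flag_sets f \<longleftrightarrow> (\<forall>k\<in>{1..<r}. label f k < label f (k - 1))"
  proof
    assume eq: "descents f = flag_sets f"
    show "\<forall>k\<in>{1..<r}. label f k < label f (k - 1)"
    proof
      fix k assume k: "k \<in> {1..<r}"
      then have "f k \<in> descents f" using eq by (auto simp: flag_sets_def)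
      then obtain j where "j \<in> {1..<r}" "label f j < label f (j - 1)" "f k = f j"
        by (auto simp: descents_def)
      then show "label f k < label f (k - 1)" using flag_inj[OF f, of k j] k by auto
    qed
  qed (auto simp: descents_def flag_sets_def)
  also have "\<dots> \<longleftrightarrow> (\<forall>k. Suc k < r \<longrightarrow> label f (Suc k) < label f k)"
    by (metis One_nat_def Suc_le_D atLeastLessThan_iff diff_Suc_1 le_add1 plus_1_eq_Suc)
  finally show ?thesis using f by (simp add: decreasing_def)
qed (simp add: decreasing_def)

lemma decreasing_less:
  assumes "decreasing f" "i < j" "j < r"
  shows "label f j < label f i"
  using assms(2,3)
proof (induction j rule: less_Suc_induct)
  case (1 i)
  then show ?case using assms(1) by (simp add: decreasing_iff)
qed auto

lemma rk_insert_indep: "indep Bs (insert x I) \<Longrightarrow> x \<notin> I \<Longrightarrow> rk Bs (insert x I) \<noteq> rk Bs I"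
  using rk_indep[of "insert x I"] rk_indep[OF indep_mono[OF _ subset_insertI], of x I]
    indep_finite[of "insert x I"] by auto

lemma indep_insert_of_flat:
  assumes F: "flat n Bs F" and I: "indep Bs I" "I \<subseteq> F" and x: "x \<in> {1..n} - F"
  shows "indep Bs (insert x I)"
proof -
  have "rk Bs (insert x F) \<noteq> rk Bs F" using rk_flat_insert[OF F x] by simp
  then have ne: "rk Bs (insert x I) \<noteq> rk Bs I" using rk_insert_mono[OF I(2)] by blast
  obtain J where J: "I \<subseteq> J" "J \<subseteq> insert x I" "indep Bs J" "card J = rk Bs (insert x I)"
    using indep_extend[OF I(1), of "insert x I"] by blast
  then have "J \<noteq> I" using ne rk_indep[OF I(1)] by auto
  then have "J = insert x I" using J by auto
  then show ?thesis using J by simp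
qed

lemma indep_labels:
  assumes f: "is_flag f"
  shows "k \<le> r \<Longrightarrow> indep Bs (label f ` {..<k})"
proof (induction k)
  case (Suc k)
  then have k: "k < r" by simp
  have "label f ` {..<k} \<subseteq> f k" using label_mem_iff[OF f, of _ k] k by auto
  then have "indep Bs (insert (label f k) (label f ` {..<k}))"
    using Suc label_mem[OF f k] label_bound[OF f k]
    by (intro indep_insert_of_flat[OF flag_flat[OF f, of k]]) auto
  then show ?case by (simp add: lessThan_Suc)
qed (simp add: indep_empty)

lemma inj_on_label:
  assumes f: "is_flag f"
  shows "inj_on (label f) {..<r}"
proof (rule inj_onI)
  fix i j assume "i \<in> {..<r}" "j \<in> {..<r}" "label f i = label f j"
  then show "i = j" using label_mem_iff[OF f] by (metis lessThan_iff linorder_neqE_nat not_less_iff_gr_or_eq)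
qed

lemma card_labels: "is_flag f \<Longrightarrow> k \<le> r \<Longrightarrow> card (label f ` {..<k}) = k"
  using inj_on_label[of f] by (subst card_image) (auto intro: inj_on_subset)

lemma ext_active_iff:
  assumes "B \<in> Bs" "x \<in> {1..n} - B"
  shows "ext_active n Bs B x \<longleftrightarrow> x = Min {y\<in>insert x B. indep Bs (insert x B - {y})}"
  using assms fund_circuit_eq[OF assms] by (simp add: ext_active_def)

text \<open>An external \<open>x\<close> enters the flag at some step \<open>i\<close>, whose label
  \<open>b\<close> satisfies \<open>b \<le> x\<close>. The labels before \<open>b\<close> together
  with \<open>x\<close> already span \<open>f (Suc i)\<close>, so \<open>x\<close> can replace
  \<open>b\<close> in the basis. Thus \<open>b\<close> lies on the fundamental circuit of
  \<open>x\<close> and is smaller, and \<open>x\<close> is not active.\<close>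

lemma labels_NBC:
  assumes dec: "decreasing f"
  shows "label f ` {..<r} \<in> NBC n Bs"
proof -
  have f: "is_flag f" using dec by (simp add: decreasing_def)
  define B where "B = label f ` {..<r}"
  have B: "B \<in> Bs" unfolding B_def
    by (rule indep_card_basis[OF indep_labels[OF f order_refl]]) (simp add: card_labels[OF f] rank)
  have "\<not> ext_active n Bs B x" for x
  proof
    assume act: "ext_active n Bs B x"
    then have x: "x \<in> {1..n} - B" by (simp add: ext_active_def)
    let ?C = "{y\<in>insert x B. indep Bs (insert x B - {y})}"
    have xMin: "x = Min ?C" using act ext_active_iff[OF B x] by simp
    have "x \<in> f r - f 0" using x flag_top[OF f order_refl] flag_0[OF f] by simp
    then obtain i where i: "i < r" "x \<in> f (Suc i) - f i" using flag_difference_step[OF f] by metis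
    define b where "b = label f i"
    define P where "P = label f ` {..<i}"
    have b: "b \<in> B" using i by (simp add: b_def B_def)
    have bP: "b \<notin> P"
    proof
      assume "b \<in> P"
      then obtain j where "j < i" "label f i = label f j" by (auto simp: P_def b_def)
      then show False using inj_onD[OF inj_on_label[OF f], of i j] i by auto
    qed
    have P: "indep Bs P" "P \<subseteq> f i" "card P = i"
      using indep_labels[OF f] card_labels[OF f] label_mem_iff[OF f, of _ i] i by (auto simp: P_def)
    have xP: "indep Bs (insert x P)"
      using indep_insert_of_flat[OF flag_flat[OF f] P(1,2)] i x by simp
    have bsub: "insert b (insert x P) \<subseteq> f (Suc i)"
      using P(2) flag_mono[OF f, of i "Suc i"] i label_mem[OF f i(1)] by (auto simp: b_def)
    have "x \<notin> P" using P(2) i by auto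
    then have "rk Bs (insert x P) = Suc i" using rk_indep[OF xP] P i indep_finite[OF P(1)] card_insert_disjoint[of P x] by auto
    then have eq: "rk Bs (insert b (insert x P)) = rk Bs (insert x P)"
      using rk_mono[OF bsub] rk_mono[OF subset_insertI, of "insert x P" b] flag_rk[OF f, of "Suc i"] i by simp
    have "insert x P \<subseteq> insert x (B - {b})" using bP i by (auto simp: P_def B_def)
    from rk_insert_mono[OF this eq]
    have "rk Bs (insert x (B - {b})) = rk Bs (insert x B)"
      using b by (metis insert_Diff insert_commute)
    moreover have "card B \<le> rk Bs (insert x B)"
      using B by (intro card_le_rk) (auto simp: indep_def)
    moreover obtain J where J: "B - {b} \<subseteq> J" "J \<subseteq> insert x (B - {b})" "indep Bs J"
        "card J = rk Bs (insert x (B - {b}))"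
      using indep_extend[of "B - {b}" "insert x (B - {b})"] B by (auto simp: indep_def)
    moreover have "card B > card (B - {b})" using b basis_finite[OF B] by (intro card_Diff1_less) auto
    ultimately have "J \<noteq> B - {b}" by auto
    then have "J = insert x (B - {b})" using J by auto
    also have "\<dots> = insert x B - {b}" using b x by auto
    finally have "b \<in> ?C" using J b by simp
    moreover have "finite ?C" using basis_finite[OF B] by simp
    ultimately have "x \<le> b" using xMin Min_le by metis
    moreover have "b \<le> x" using label_le[OF f i(2)] by (simp add: b_def)
    ultimately show False using b x by auto
  qed
  then show ?thesis using B by (auto simp: NBC_def B_def)
qed

text \<open>A decreasing label sequence lists its set in descending order, so the set determines the
  sequence, hence the weight and the flag.\<close>

lemma labels_decreasing_inj: "inj_on (\<lambda>f. label f ` {..<r}) {f. decreasing f}"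
proof (rule inj_onI; clarify)
  fix f g assume dec: "decreasing f" "decreasing g" and eq: "label f ` {..<r} = label g ` {..<r}"
  have *: "sorted_list_of_set (label f ` {..<r}) = rev (map (label f) [0..<r])" if "decreasing f" for f
  proof -
    let ?xs = "rev (map (label f) [0..<r])"
    have set: "label f ` {..<r} = set ?xs" by (simp add: atLeast0LessThan)
    have distinct: "distinct ?xs"
      using inj_on_label that by (simp add: decreasing_def distinct_map atLeast0LessThan)
    have "sorted ?xs"
      unfolding sorted_wrt_rev by (auto simp: sorted_wrt_iff_nth_less decreasing_less[OF that] less_imp_le)
    with distinct show ?thesis unfolding set by (intro sorted_distinct_set_unique) simp_all
  qed
  have "rev (map (label f) [0..<r]) = rev (map (label g) [0..<r])"
    unfolding *[OF dec(1), symmetric] *[OF dec(2), symmetric] eq ..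
  then have lab: "label f k = label g k" if "k < r" for k using that by simp
  have fg: "is_flag f" "is_flag g" using dec by (auto simp: decreasing_def)
  have "weight f = weight g"
    unfolding weight_def using lab by (rule lex_value_cong)
  then show "f = g" using weight_inj fg by simp
qed

text \<open>List \<open>B\<close> in descending order and take closures of the initial segments. An
  \<open>x\<close> outside \<open>B\<close> that is new at step \<open>k\<close> has a smaller
  element \<open>y\<close> on its fundamental circuit, since it is not active. If \<open>y\<close>
  came after \<open>bs ! k\<close>, then \<open>x\<close> would be independent of the first
  \<open>k + 1\<close> entries; so \<open>y\<close> is among them and
  \<open>bs ! k \<le> y < x\<close>, which makes \<open>bs ! k\<close> the label.\<close>

lemma NBC_labels:
  assumes "B \<in> NBC n Bs"
  shows "\<exists>f. decreasing f \<and> label f ` {..<r} = B"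
proof -
  have B: "B \<in> Bs" and nbc: "\<And>x. \<not> ext_active n Bs B x" using assms by (auto simp: NBC_def)
  have fB: "finite B" by (rule basis_finite[OF B])
  have cB: "card B = r" using rk_basis[OF B] rank by simp
  define bs where "bs = rev (sorted_list_of_set B)"
  have bs: "set bs = B" "distinct bs" "length bs = r" using fB cB by (auto simp: bs_def)
  have desc: "bs ! j < bs ! i" if "i < j" "j < r" for i j
  proof -
    have "sorted_wrt (>) bs" unfolding bs_def sorted_wrt_rev using strict_sorted_list_of_set by simp
    then show ?thesis using that bs by (simp add: sorted_wrt_iff_nth_less)
  qed
  define P where "P = (\<lambda>k. (!) bs ` {..<k})"
  have P: "P k \<subseteq> B" "card (P k) = k" "indep Bs (P k)" if "k \<le> r" for k
  proof -
    show "P k \<subseteq> B" using that bs by (auto simp: P_def)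
    then show "indep Bs (P k)" using B by (auto simp: indep_def)
    show "card (P k) = k" unfolding P_def using that bs
      by (subst card_image) (auto simp: inj_on_def nth_eq_iff_index_eq)
  qed
  have PS: "P (Suc k) = insert (bs ! k) (P k)" for k by (simp add: P_def lessThan_Suc)
  have Pg: "P k \<subseteq> {1..n}" if "k \<le> r" for k using P(1)[OF that] basis_subset[OF B] by blast
  define f where "f = (\<lambda>k. if k \<le> r then closure_in (P k) else {1..n})"
  have f: "is_flag f"
    unfolding is_flag_def
  proof (intro conjI allI impI)
    fix k assume "k \<le> r"
    then show "flat n Bs (f k)" "rk Bs (f k) = k"
      using flat_closure[OF Pg] rk_closure[OF Pg] rk_indep[OF P(3)] P(2) by (auto simp: f_def)
  next
    fix k assume k: "k < r"
    have "P k \<subseteq> closure_in (P (Suc k))" using closure_superset[OF Pg[of "Suc k"]] k by (auto simp: PS)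
    then have "closure_in (P k) \<subseteq> closure_in (P (Suc k))"
      using k by (intro closure_least flat_closure Pg) auto
    then show "f k \<subseteq> f (Suc k)" using k by (simp add: f_def)
  qed (simp add: f_def)
  have dep: "\<not> indep Bs (insert x (P k))" if "x \<in> f k" "x \<notin> P k" "k \<le> r" for x k
    using that rk_insert_indep[of x "P k"] by (auto simp: f_def closure_in_def)
  have lab: "label f k = bs ! k" if k: "k < r" for k
  proof -
    have mem: "bs ! k \<in> f (Suc k) - f k"
    proof
      show "bs ! k \<in> f (Suc k)" using closure_superset[OF Pg[of "Suc k"]] k by (auto simp: f_def PS)
      have "bs ! k \<notin> P k" using bs k by (auto simp: P_def nth_eq_iff_index_eq)
      then show "bs ! k \<notin> f k" using dep[of "bs ! k" k] P(3)[of "Suc k"] k by (auto simp: PS)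
    qed
    have "bs ! k \<le> x" if x: "x \<in> f (Suc k) - f k" for x
    proof (cases "x \<in> B")
      case True
      then obtain j where j: "j < r" "x = bs ! j" using bs by (metis in_set_conv_nth)
      have "\<not> j < k" using closure_superset[OF Pg[of k]] x k j by (auto simp: f_def P_def)
      moreover have "\<not> k < j"
      proof
        assume "k < j"
        then have "x \<notin> P (Suc k)" using bs j by (auto simp: P_def nth_eq_iff_index_eq)
        moreover have "insert x (P (Suc k)) \<subseteq> B" using P(1)[of "Suc k"] k True by simp
        ultimately show False using dep[of x "Suc k"] x k B by (auto simp: indep_def)
      qed
      ultimately show ?thesis using j by auto
    next
      case False
      then have xg: "x \<in> {1..n} - B" using x flag_subset_ground[OF f] by blast
      let ?C = "{y\<in>insert x B. indep Bs (insert x B - {y})}"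
      have xC: "x \<in> ?C" using False B by (auto simp: indep_def)
      have finC: "finite ?C" using fB by simp
      have "x \<noteq> Min ?C" using nbc[of x] ext_active_iff[OF B xg] by simp
      moreover have "Min ?C \<le> x" "Min ?C \<in> ?C" using xC finC Min_le Min_in by blast+
      ultimately obtain y where y: "y \<in> B" "y < x" "indep Bs (insert x B - {y})" by force
      then obtain j where j: "j < r" "y = bs ! j" using bs by (metis in_set_conv_nth)
      have "\<not> k < j"
      proof
        assume "k < j"
        then have "y \<notin> P (Suc k)" using bs j by (auto simp: P_def nth_eq_iff_index_eq)
        then have "insert x (P (Suc k)) \<subseteq> insert x B - {y}" using P(1)[of "Suc k"] k y by auto
        then have "indep Bs (insert x (P (Suc k)))" using y indep_mono by blast
        then show False using dep[of x "Suc k"] x k False P(1)[of "Suc k"] by auto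
      qed
      then have "bs ! k \<le> y" using desc[of j k] j k by (cases "j = k") auto
      then show ?thesis using y by simp
    qed
    then show ?thesis unfolding label_def using mem flag_finite[OF f, of "Suc k"] by (intro Min_eqI) auto
  qed
  have "decreasing f" using f lab desc by (simp add: decreasing_iff)
  moreover have "label f ` {..<r} = B"
    using lab bs by (auto simp: set_conv_nth image_iff)
  ultimately show ?thesis by blast
qed

lemma card_decreasing: "card {f. decreasing f} = card (NBC n Bs)"
proof -
  have "(\<lambda>f. label f ` {..<r}) ` {f. decreasing f} = NBC n Bs"
    using labels_NBC NBC_labels by blast
  then show ?thesis using card_image[OF labels_decreasing_inj] by simp
qed

text \<open>A basis with the least sum of elements has no active element: an active \<open>x\<close>
  lies below the rest of its circuit, and exchanging it for another element of the circuit would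
  lower the sum. Looplessness supplies such an element.\<close>

lemma card_NBC_pos: "card (NBC n Bs) > 0"
proof -
  obtain B0 where "B0 \<in> Bs" using matroid by (auto simp: matroid_def)
  then obtain B where B: "B \<in> Bs" and min: "\<And>B'. B' \<in> Bs \<Longrightarrow> \<Sum>B \<le> \<Sum>B'"
    using arg_min_nat_lemma[of "\<lambda>B. B \<in> Bs" B0 "\<lambda>B. \<Sum>B"] by metis
  have fB: "finite B" by (rule basis_finite[OF B])
  have "\<not> ext_active n Bs B x" for x
  proof
    assume act: "ext_active n Bs B x"
    then have x: "x \<in> {1..n} - B" by (simp add: ext_active_def)
    let ?C = "{y\<in>insert x B. indep Bs (insert x B - {y})}"
    have xMin: "x = Min ?C" using act ext_active_iff[OF B x] by simp
    have "indep Bs {x}" using loopless x by (auto simp: loopless_def)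
    then obtain I where I: "{x} \<subseteq> I" "I \<subseteq> insert x B" "indep Bs I" "card I = rk Bs (insert x B)"
      using indep_extend[of "{x}" "insert x B"] by blast
    have rkx: "rk Bs (insert x B) = card B"
    proof (rule antisym)
      show "rk Bs (insert x B) \<le> card B"
        using rk_mono[of "insert x B" "{1..n}"] rk_basis[OF B] basis_subset[OF B] x by simp
      show "card B \<le> rk Bs (insert x B)" using B by (intro card_le_rk) (auto simp: indep_def)
    qed
    have "I \<in> Bs" using indep_card_basis[OF I(3)] I(4) rkx rk_basis[OF B] by simp
    have "I \<noteq> insert x B" using I(4) rkx fB x by auto
    then obtain y where y: "y \<in> insert x B" "y \<notin> I" using I by blast
    then have yB: "y \<in> B" using I by auto
    have "card (insert x B - {y}) = card B" using fB x y yB by simp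
    then have Ieq: "I = insert x B - {y}" using I y rkx fB by (intro card_subset_eq) auto
    then have "y \<in> ?C" using I y by simp
    moreover have "finite ?C" using fB by simp
    ultimately have "x \<le> y" using xMin Min_le by metis
    then have "x < y" using x yB by (cases "x = y") auto
    have "\<Sum>I = \<Sum>(insert x (B - {y}))" using Ieq x yB by (intro arg_cong[of _ _ "\<lambda>S. \<Sum>S"]) auto
    also have "\<dots> = x + \<Sum>(B - {y})" using fB x by simp
    also have "\<dots> < y + \<Sum>(B - {y})" using \<open>x < y\<close> by simp
    also have "\<dots> = \<Sum>B" using sum.remove[OF fB yB, of "\<lambda>x. x"] by simp
    finally show False using min[OF \<open>I \<in> Bs\<close>] by simp
  qed
  then have "B \<in> NBC n Bs" using B by (auto simp: NBC_def)
  moreover have "finite (NBC n Bs)"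
    by (rule finite_subset[of _ "Pow {1..n}"]) (use basis_subset in \<open>auto simp: NBC_def\<close>)
  ultimately show ?thesis using card_gt_0_iff by blast
qed

end


section \<open>Contraction and exterior multiplication\<close>

text \<open>Contraction with the functional that adds up the coordinates in \<open>F\<close>.
  Infinite index sets carry no form; the value zero there lets the identities below hold for all
  arguments.\<close>

definition contract_set :: "nat set \<Rightarrow> (nat set \<Rightarrow> complex) \<Rightarrow> nat set \<Rightarrow> complex" where
  "contract_set F \<omega> J = (if finite J then \<Sum>i\<in>F. contract i \<omega> J else 0)"

definition wedge_vec :: "(nat \<Rightarrow> complex) \<Rightarrow> (nat set \<Rightarrow> complex) \<Rightarrow> nat set \<Rightarrow> complex" where
  "wedge_vec l \<omega> J = (\<Sum>i\<in>J. (-1) ^ card {k\<in>J. k < i} * l i * \<omega> (J - {i}))"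

definition alt_form :: "nat \<Rightarrow> nat \<Rightarrow> (nat set \<Rightarrow> complex) \<Rightarrow> bool" where
  "alt_form n t \<omega> \<longleftrightarrow> (\<forall>J. \<omega> J \<noteq> 0 \<longrightarrow> J \<subseteq> {1..n} \<and> card J = t)"

lemma wedge_Cons: "wedge (l # ls) = wedge_vec l (wedge ls)"
  by (simp add: wedge_vec_def fun_eq_iff)

lemma alt_form_infinite: "alt_form n t \<omega> \<Longrightarrow> infinite J \<Longrightarrow> \<omega> J = 0"
  unfolding alt_form_def using finite_subset by blast

lemma wedge_vec_infinite: "infinite J \<Longrightarrow> wedge_vec l \<omega> J = 0"
  by (simp add: wedge_vec_def)

lemma wedge_vec_sum: "wedge_vec l (\<lambda>J. \<Sum>x\<in>A. g x J) J = (\<Sum>x\<in>A. wedge_vec l (g x) J)"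
  unfolding wedge_vec_def sum_distrib_left by (rule sum.swap)

lemma wedge_vec_scale: "wedge_vec l (\<lambda>J. c * a J) J = c * wedge_vec l a J"
  by (simp add: wedge_vec_def sum_distrib_left mult_ac)

definition unit_form :: "nat \<Rightarrow> nat \<Rightarrow> complex" where
  "unit_form i k = of_bool (k = i)"

lemma wedge_unit_forms:
  "sorted_wrt (<) js \<Longrightarrow> wedge (map unit_form js) K = of_bool (K = set js)"
proof (induction js arbitrary: K)
  case (Cons j js)
  have IH: "wedge (map unit_form js) L = of_bool (L = set js)" for L using Cons by simp
  have "wedge (map unit_form (j # js)) K =
      (\<Sum>i\<in>K. if i = j then (-1) ^ card {k\<in>K. k < j} * of_bool (K - {j} = set js) else 0)"
    unfolding list.map wedge.simps by (intro sum.cong) (auto simp: unit_form_def IH)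
  also have "\<dots> = of_bool (K = set (j # js))"
  proof (cases "finite K \<and> j \<in> K \<and> K - {j} = set js")
    case True
    then have K: "K = insert j (set js)" by auto
    have empty: "{k\<in>K. k < j} = {}" using K Cons.prems by auto
    have "(\<Sum>i\<in>K. if i = j then (-1) ^ card {k\<in>K. k < j} * of_bool (K - {j} = set js) else 0) =
        ((-1) ^ card {k\<in>K. k < j} * of_bool (K - {j} = set js) :: complex)"
      using True by simp
    also have "\<dots> = 1" unfolding empty using True by simp
    finally show ?thesis using K by simp
  next
    case False
    have "j \<notin> set js" using Cons.prems by auto
    then have "K \<noteq> set (j # js)" using False by auto
    then show ?thesis using False by (cases "finite K") auto
  qed
  finally show ?case .
qed simp

text \<open>Both sides involve only the values of \<open>\<omega>\<close> at subsets of \<open>J \<union> {i}\<close>, and there \<open>\<omega>\<close> is a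
  combination of wedges of coordinate forms.\<close>

lemma contract_wedge_vec:
  assumes "finite J"
  shows "contract i (wedge_vec l \<omega>) J = l i * \<omega> J - wedge_vec l (contract i \<omega>) J"
proof -
  let ?A = "Pow (insert i J)"
  define g where "g K = wedge (map unit_form (sorted_list_of_set K))" for K
  define \<eta> where "\<eta> L = (\<Sum>K\<in>?A. \<omega> K * g K L)" for L
  have \<eta>: "\<eta> L = \<omega> L" if L: "L \<subseteq> insert i J" for L
  proof -
    have "g K L = of_bool (L = K)" if "K \<in> ?A" for K
      using that assms finite_subset[of K "insert i J"] wedge_unit_forms[OF strict_sorted_list_of_set[of K]]
      by (simp add: g_def)
    then have "\<eta> L = (\<Sum>K\<in>?A. if K = L then \<omega> L else 0)" unfolding \<eta>_def by (intro sum.cong) auto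
    then show ?thesis using L assms by simp
  qed
  have l: "wedge_vec l \<omega> L = wedge_vec l \<eta> L" if "L \<subseteq> insert i J" for L
    unfolding wedge_vec_def using that by (intro sum.cong) (auto simp: \<eta> subset_iff)
  have r: "wedge_vec l (contract i \<omega>) J = wedge_vec l (contract i \<eta>) J"
    unfolding wedge_vec_def contract_def by (intro sum.cong) (auto simp: \<eta> subset_iff)
  have "contract i (wedge_vec l \<omega>) J = contract i (wedge_vec l \<eta>) J" by (simp add: contract_def l)
  also have "\<dots> = (\<Sum>K\<in>?A. \<omega> K * contract i (wedge_vec l (g K)) J)"
    by (simp add: contract_def \<eta>_def[abs_def] wedge_vec_sum wedge_vec_scale sum_distrib_left mult.left_commute)
  also have "\<dots> = (\<Sum>K\<in>?A. \<omega> K * (l i * g K J - wedge_vec l (contract i (g K)) J))"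
    unfolding g_def wedge_Cons[symmetric] contract_wedge_Cons[OF assms] by (simp only: wedge_vec_def)
  also have "\<dots> = l i * \<eta> J - wedge_vec l (\<lambda>J. \<Sum>K\<in>?A. \<omega> K * contract i (g K) J) J"
    by (simp add: \<eta>_def wedge_vec_sum wedge_vec_scale right_diff_distrib sum_subtractf sum_distrib_left mult.left_commute)
  also have "(\<lambda>J. \<Sum>K\<in>?A. \<omega> K * contract i (g K) J) = contract i \<eta>"
    by (rule ext) (simp add: contract_def \<eta>_def sum_distrib_left mult.left_commute)
  finally show ?thesis using \<eta>[of J] r by auto
qed

text \<open>Inserting the smaller index shifts the position of the larger one by one, while the
  larger does not affect the smaller. This single sign is the anticommutation.\<close>

lemma contract_contract:
  assumes J: "finite J"
  shows "contract i (contract j \<omega>) J = - contract j (contract i \<omega>) J"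
proof -
  have *: "contract i (contract j \<omega>) J = - contract j (contract i \<omega>) J" if "i < j" for i j
  proof (cases "i \<in> J \<or> j \<in> J")
    case True
    then show ?thesis using that by (auto simp: contract_def)
  next
    case False
    have "{k\<in>insert i J. k < j} = insert i {k\<in>J. k < j}" using that by auto
    then have "card {k\<in>insert i J. k < j} = Suc (card {k\<in>J. k < j})" using False J by simp
    moreover have "{k\<in>insert j J. k < i} = {k\<in>J. k < i}" using that by auto
    ultimately show ?thesis using False that by (simp add: contract_def insert_commute)
  qed
  show ?thesis
  proof (cases i j rule: linorder_cases)
    case less then show ?thesis by (rule *)
  next
    case equal then show ?thesis by (simp add: contract_def)
  next
    case greater then show ?thesis using *[OF greater] by simp
  qed
qed

lemma contract_sum: "contract i (\<lambda>J. \<Sum>x\<in>A. g x J) J = (\<Sum>x\<in>A. contract i (g x) J)"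
  by (simp add: contract_def sum_distrib_left)

lemma contract_set_sum: "contract_set F (\<lambda>J. \<Sum>x\<in>A. g x J) J = (\<Sum>x\<in>A. contract_set F (g x) J)"
  unfolding contract_set_def contract_sum by (auto intro: sum.swap)

lemma contract_set_diff: "contract_set F (\<lambda>J. a J - b J) J = contract_set F a J - contract_set F b J"
  by (auto simp: contract_set_def contract_def right_diff_distrib simp flip: sum_subtractf intro!: sum.cong)

lemma contract_set_add: "contract_set F (\<lambda>J. a J + b J) J = contract_set F a J + contract_set F b J"
  by (auto simp: contract_set_def contract_def distrib_left simp flip: sum.distrib intro!: sum.cong)

lemma contract_set_scale: "contract_set F (\<lambda>J. c * a J) J = c * contract_set F a J"
  by (auto simp: contract_set_def contract_def sum_distrib_left intro!: sum.cong)

lemma contract_set_zero [simp]: "contract_set F (\<lambda>_. 0) = (\<lambda>_. 0)"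
  by (rule ext) (auto simp: contract_set_def contract_def intro!: sum.neutral)

lemma wedge_vec_zero [simp]: "wedge_vec l (\<lambda>_. 0) = (\<lambda>_. 0)"
  by (rule ext) (simp add: wedge_vec_def)

lemma wedge_vec_uminus: "wedge_vec l (\<lambda>J. - g J) J = - wedge_vec l g J"
  by (simp add: wedge_vec_def sum_negf)

lemma contract_set_uminus: "contract_set F (\<lambda>J. - g J) J = - contract_set F g J"
  using contract_set_scale[of F "-1" g J] by simp

lemma contract_set_contract_set:
  "contract_set F (contract_set G \<omega>) J = - contract_set G (contract_set F \<omega>) J"
proof (cases "finite J")
  case True
  have *: "contract i (contract_set G \<omega>) J = (\<Sum>j\<in>G. contract i (contract j \<omega>) J)" for i G
    using True by (simp add: contract_def contract_set_def sum_distrib_left)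
  have "contract_set F (contract_set G \<omega>) J = (\<Sum>i\<in>F. \<Sum>j\<in>G. contract i (contract j \<omega>) J)"
    using True * by (simp add: contract_set_def)
  also have "\<dots> = (\<Sum>j\<in>G. \<Sum>i\<in>F. contract i (contract j \<omega>) J)" by (rule sum.swap)
  also have "\<dots> = (\<Sum>j\<in>G. \<Sum>i\<in>F. - contract j (contract i \<omega>) J)"
    by (intro sum.cong refl contract_contract[OF True])
  also have "\<dots> = - contract_set G (contract_set F \<omega>) J"
    using True * by (simp add: contract_set_def sum_negf)
  finally show ?thesis .
qed (simp add: contract_set_def)

lemma contract_set_self [simp]: "contract_set F (contract_set F \<omega>) = (\<lambda>_. 0)"
proof
  fix J
  have "2 * contract_set F (contract_set F \<omega>) J = 0"
    using contract_set_contract_set[of F F \<omega> J] by simp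
  then show "contract_set F (contract_set F \<omega>) J = 0" by simp
qed

text \<open>Contraction is an antiderivation; the identity is summed over the coordinates in
  \<open>F\<close>. The scalar is the pairing of \<open>l\<close> with the functional of
  \<open>F\<close>, and its values 0 and 1 on dual vectors drive all the homotopies.\<close>

lemma contract_set_wedge_vec:
  assumes "\<And>J. infinite J \<Longrightarrow> \<omega> J = 0"
  shows "contract_set F (wedge_vec l \<omega>) J = (\<Sum>i\<in>F. l i) * \<omega> J - wedge_vec l (contract_set F \<omega>) J"
proof (cases "finite J")
  case True
  have "wedge_vec l (contract_set F \<omega>) J = wedge_vec l (\<lambda>J. \<Sum>i\<in>F. contract i \<omega> J) J"
    using True by (simp add: wedge_vec_def contract_set_def)
  also have "\<dots> = (\<Sum>i\<in>F. wedge_vec l (contract i \<omega>) J)" by (rule wedge_vec_sum)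
  finally show ?thesis
    using True by (simp add: contract_set_def contract_wedge_vec sum_subtractf sum_distrib_right)
qed (simp add: contract_set_def wedge_vec_def assms)

lemma alt_form_contract_set:
  assumes "F \<subseteq> {1..n}" "alt_form n (Suc t) \<omega>"
  shows "alt_form n t (contract_set F \<omega>)"
  unfolding alt_form_def
proof (intro allI impI)
  fix J assume "contract_set F \<omega> J \<noteq> 0"
  then have J: "finite J" and "(\<Sum>i\<in>F. contract i \<omega> J) \<noteq> 0" by (auto simp: contract_set_def split: if_splits)
  then obtain i where "i \<in> F" "contract i \<omega> J \<noteq> 0" by (meson sum.neutral)
  then have "i \<notin> J" "insert i J \<subseteq> {1..n}" "card (insert i J) = Suc t"
    using assms(2) by (auto simp: contract_def alt_form_def split: if_splits)
  then show "J \<subseteq> {1..n} \<and> card J = t" using J by auto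
qed

lemma alt_form_wedge_vec:
  assumes l: "\<And>i. l i \<noteq> 0 \<Longrightarrow> i \<in> {1..n}" and \<omega>: "alt_form n t \<omega>"
  shows "alt_form n (Suc t) (wedge_vec l \<omega>)"
  unfolding alt_form_def
proof (intro allI impI)
  fix J assume nz: "wedge_vec l \<omega> J \<noteq> 0"
  then have fin: "finite J" using wedge_vec_infinite by blast
  obtain i where i: "i \<in> J" "l i * \<omega> (J - {i}) \<noteq> 0"
    using nz unfolding wedge_vec_def by (metis (no_types, lifting) mult.assoc mult_zero_right sum.neutral)
  then have "i \<in> {1..n}" "J - {i} \<subseteq> {1..n}" "card (J - {i}) = t" using l[of i] \<omega> by (auto simp: alt_form_def)
  then show "J \<subseteq> {1..n} \<and> card J = Suc t" using i fin card_Suc_Diff1[of J i] by auto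
qed


section \<open>The Koszul complex in the basis of chain monomials\<close>

type_synonym flat_mono = "nat set \<Rightarrow>\<^sub>0 nat"
text \<open>A tensor is stored as a family of forms indexed by monomials. Contraction and wedging
  act on each form separately, and multiplication by a variable only moves the index.\<close>

type_synonym cochain = "flat_mono \<Rightarrow> nat set \<Rightarrow> complex"

abbreviation "keys \<equiv> Poly_Mapping.keys"
abbreviation "lookup \<equiv> Poly_Mapping.lookup"

definition mdeg :: "flat_mono \<Rightarrow> nat" where
  "mdeg m = (\<Sum>F\<in>keys m. lookup m F)"

definition var_mono :: "nat set \<Rightarrow> flat_mono" where
  "var_mono F = Poly_Mapping.single F 1"

lemma lookup_var_mono: "lookup (var_mono F) G = of_bool (G = F)"
  by (simp add: var_mono_def lookup_single when_def)

lemma keys_add_var: "keys (m + var_mono F) = insert F (keys m)"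
  by (auto simp: in_keys_iff lookup_add lookup_var_mono split: if_splits)

lemma keys_diff_var_subset: "keys (m - var_mono F) \<subseteq> keys m"
  by (auto simp: in_keys_iff lookup_minus)

lemma diff_add_var: "F \<in> keys m \<Longrightarrow> m - var_mono F + var_mono F = m"
  by (rule poly_mapping_eqI) (auto simp: in_keys_iff lookup_add lookup_minus lookup_var_mono)

lemma add_diff_var: "m + var_mono F - var_mono F = m"
  by (rule poly_mapping_eqI) (auto simp: lookup_add lookup_minus lookup_var_mono)

lemma add_diff_var_comm:
  "G \<in> keys m \<Longrightarrow> m + var_mono F - var_mono G = m - var_mono G + var_mono F"
  by (rule poly_mapping_eqI) (auto simp: in_keys_iff lookup_add lookup_minus lookup_var_mono)

lemma mdeg_add_var: "mdeg (m + var_mono F) = Suc (mdeg m)"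
proof -
  have "mdeg (m + var_mono F) = (\<Sum>G\<in>insert F (keys m). lookup m G + of_bool (G = F))"
    by (simp add: mdeg_def keys_add_var lookup_add lookup_var_mono)
  also have "\<dots> = (\<Sum>G\<in>insert F (keys m). lookup m G) + 1"
    by (simp add: sum.distrib of_bool_def)
  also have "(\<Sum>G\<in>insert F (keys m). lookup m G) = mdeg m"
    unfolding mdeg_def by (rule sum.mono_neutral_right) (auto simp: in_keys_iff)
  finally show ?thesis by simp
qed

lemma mdeg_diff_var: "F \<in> keys m \<Longrightarrow> mdeg m = Suc (mdeg (m - var_mono F))"
  using mdeg_add_var[of "m - var_mono F" F] by (simp add: diff_add_var)

context loopless_matroid
begin

definition chain_mono :: "flat_mono \<Rightarrow> bool" where
  "chain_mono m \<longleftrightarrow> is_chain (keys m)"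

text \<open>The negative of the Koszul differential, in the basis of chain monomials: a form at \<open>m\<close>
  is moved to \<open>x\<^sub>F m\<close> after contraction with the functional summing the coordinates in \<open>F\<close>.\<close>

definition kd :: "cochain \<Rightarrow> cochain" where
  "kd w m J = (if chain_mono m then
     \<Sum>F\<in>keys m. contract_set F (w (m - var_mono F)) J else 0)"

text \<open>The exterior power of the sum-zero forms appears as the kernel of contraction with the
  ground set. The degree is an integer so that \<open>s - 1\<close> makes sense at
  \<open>s = 0\<close>, where it admits only the zero cochain.\<close>

definition kterm :: "nat \<Rightarrow> int \<Rightarrow> cochain \<Rightarrow> bool" where
  "kterm t s w \<longleftrightarrow> (\<forall>m. alt_form n t (w m) \<and> contract_set {1..n} (w m) = (\<lambda>_. 0)) \<and>
     (\<forall>m J. w m J \<noteq> 0 \<longrightarrow> chain_mono m \<and> int (mdeg m) = s)"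

definition level :: "flat_mono \<Rightarrow> nat" where
  "level m = weight (least_flag (keys m))"

definition fil :: "nat \<Rightarrow> cochain \<Rightarrow> bool" where
  "fil j w \<longleftrightarrow> (\<forall>m. chain_mono m \<and> level m < j \<longrightarrow> w m = (\<lambda>_. 0))"

definition at_flag :: "(nat \<Rightarrow> nat set) \<Rightarrow> flat_mono \<Rightarrow> bool" where
  "at_flag f m \<longleftrightarrow> descents f \<subseteq> keys m \<and> keys m \<subseteq> flag_sets f"

lemma chain_mono_diff: "chain_mono m \<Longrightarrow> chain_mono (m - var_mono F)"
  unfolding chain_mono_def using is_chain_mono keys_diff_var_subset by blast

lemma at_flag_chain: "is_flag f \<Longrightarrow> at_flag f m \<Longrightarrow> chain_mono m"
  unfolding chain_mono_def at_flag_def using flag_sets_chain is_chain_mono by blast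

lemma at_flag_iff: "is_flag f \<Longrightarrow> at_flag f m \<longleftrightarrow> chain_mono m \<and> least_flag (keys m) = f"
  using at_flag_chain[of f m] least_flag_eq_iff[of f "keys m"] by (auto simp: chain_mono_def at_flag_def)

lemma at_flag_level: "is_flag f \<Longrightarrow> at_flag f m \<longleftrightarrow> chain_mono m \<and> level m = weight f"
  using at_flag_iff[of f m] weight_inj[OF _ least_flag(1), of f] unfolding level_def chain_mono_def by metis

lemma level_mono: "chain_mono m \<Longrightarrow> keys m' \<subseteq> keys m \<Longrightarrow> level m' \<le> level m"
  unfolding level_def chain_mono_def by (rule weight_least_flag_mono)

lemma kterm_infinite: "kterm t s w \<Longrightarrow> infinite J \<Longrightarrow> w m J = 0"
  unfolding kterm_def using alt_form_infinite by blast

lemma proper_flat_subset: "F \<in> proper_flats n Bs \<Longrightarrow> F \<subseteq> {1..n}"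
  by (simp add: proper_flats_def flat_def)

lemma chain_mono_key_subset: "chain_mono m \<Longrightarrow> F \<in> keys m \<Longrightarrow> F \<subseteq> {1..n}"
  unfolding chain_mono_def is_chain_def using proper_flat_subset by blast

text \<open>The ground-set condition survives because contractions anticommute.\<close>

lemma kterm_kd:
  assumes w: "kterm (Suc t) (s - 1) w"
  shows "kterm t s (kd w)"
  unfolding kterm_def
proof (intro conjI allI impI)
  fix m
  show "alt_form n t (kd w m)"
    unfolding alt_form_def
  proof (intro allI impI)
    fix J assume nz: "kd w m J \<noteq> 0"
    then have ch: "chain_mono m" by (auto simp: kd_def split: if_splits)
    then obtain F where F: "F \<in> keys m" "contract_set F (w (m - var_mono F)) J \<noteq> 0"
      using nz unfolding kd_def by (auto intro: ccontr elim: sum.not_neutral_contains_not_neutral)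
    have "alt_form n t (contract_set F (w (m - var_mono F)))"
      using w by (intro alt_form_contract_set chain_mono_key_subset[OF ch F(1)]) (auto simp: kterm_def)
    then show "J \<subseteq> {1..n} \<and> card J = t" using F by (auto simp: alt_form_def)
  qed
  show "contract_set {1..n} (kd w m) = (\<lambda>_. 0)"
  proof
    fix J
    show "contract_set {1..n} (kd w m) J = 0"
    proof (cases "chain_mono m")
      case True
      then have "contract_set {1..n} (kd w m) J =
          (\<Sum>F\<in>keys m. contract_set {1..n} (contract_set F (w (m - var_mono F))) J)"
        unfolding contract_set_sum[symmetric] by (simp add: kd_def[abs_def])
      also have "\<dots> = (\<Sum>F\<in>keys m. - contract_set F (contract_set {1..n} (w (m - var_mono F))) J)"
        by (intro sum.cong refl contract_set_contract_set)
      also have "\<dots> = 0" using w by (simp add: kterm_def)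
      finally show ?thesis .
    next
      case False
      then have "kd w m = (\<lambda>_. 0)" by (auto simp: kd_def)
      then show ?thesis by simp
    qed
  qed
next
  fix m J assume nz: "kd w m J \<noteq> 0"
  then show ch: "chain_mono m" by (auto simp: kd_def split: if_splits)
  then obtain F where F: "F \<in> keys m" "contract_set F (w (m - var_mono F)) J \<noteq> 0"
    using nz unfolding kd_def by (auto intro: ccontr elim: sum.not_neutral_contains_not_neutral)
  then have "w (m - var_mono F) \<noteq> (\<lambda>_. 0)" by auto
  then obtain J' where "w (m - var_mono F) J' \<noteq> 0" by (auto simp: fun_eq_iff)
  then have "int (mdeg (m - var_mono F)) = s - 1" using w by (auto simp: kterm_def)
  then show "int (mdeg m) = s" using mdeg_diff_var[OF F(1)] by simp
qed

lemma lookup_pos_of_keys_diff: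
  "G \<in> keys (m - var_mono F) \<longleftrightarrow>
     (if G = F then lookup m F > 1 else G \<in> keys m)"
  by (auto simp: in_keys_iff lookup_minus lookup_var_mono)

text \<open>The terms are indexed by ordered pairs of flats whose product divides \<open>m\<close>.
  Swapping a pair keeps the remaining monomial and flips the sign, so the sum is its own
  negative.\<close>

lemma kd_kd: "kd (kd w) m J = 0"
proof (cases "chain_mono m")
  case True
  define S where "S = (SIGMA F:keys m. keys (m - var_mono F))"
  let ?g = "\<lambda>(F, G). contract_set F (contract_set G (w (m - var_mono F - var_mono G))) J"
  have "kd (kd w) m J = (\<Sum>F\<in>keys m. \<Sum>G\<in>keys (m - var_mono F).
      contract_set F (contract_set G (w (m - var_mono F - var_mono G))) J)"
    using True chain_mono_diff[OF True] unfolding contract_set_sum[symmetric] by (simp add: kd_def[abs_def])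
  also have "\<dots> = sum ?g S" unfolding S_def by (rule sum.Sigma) auto
  finally have eq: "kd (kd w) m J = sum ?g S" .
  have "(G, F) \<in> S" if "(F, G) \<in> S" for F G
    using that by (auto simp: S_def lookup_pos_of_keys_diff split: if_splits)
  then have swap: "(\<lambda>(F, G). (G, F)) ` S = S" by force
  have "sum ?g S = (\<Sum>p\<in>S. ?g ((\<lambda>(F, G). (G, F)) p))"
    by (subst swap[symmetric], subst sum.reindex) (auto simp: inj_on_def)
  also have "\<dots> = (\<Sum>p\<in>S. - ?g p)"
  proof (rule sum.cong[OF refl], clarify)
    fix F G
    have "m - var_mono G - var_mono F = m - var_mono F - var_mono G" by (simp add: diff_diff_add add.commute)
    then show "contract_set G (contract_set F (w (m - var_mono G - var_mono F))) J =
        - contract_set F (contract_set G (w (m - var_mono F - var_mono G))) J"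
      using contract_set_contract_set by metis
  qed
  finally have "sum ?g S = - sum ?g S" by (simp add: sum_negf)
  then show ?thesis using eq by simp
qed (simp add: kd_def)

lemma kd_add: "kd (\<lambda>m J. a m J + b m J) m J = kd a m J + kd b m J"
  by (simp add: kd_def contract_set_add sum.distrib)

lemma kd_diff: "kd (\<lambda>m J. a m J - b m J) m J = kd a m J - kd b m J"
  by (simp add: kd_def contract_set_diff sum_subtractf)

lemma kd_scale: "kd (\<lambda>m J. c * a m J) m J = c * kd a m J"
  by (simp add: kd_def contract_set_scale sum_distrib_left)

lemma kd_zero: "kd (\<lambda>_ _. 0) = (\<lambda>_ _. 0)"
  by (auto simp: kd_def fun_eq_iff)

lemma kd_sum: "finite A \<Longrightarrow> kd (\<lambda>m J. \<Sum>x\<in>A. g x m J) m J = (\<Sum>x\<in>A. kd (g x) m J)"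
  by (induction A rule: finite_induct) (simp_all add: kd_zero kd_add)

lemma kterm_zero: "kterm t s (\<lambda>_ _. 0)"
  by (simp add: kterm_def alt_form_def)

lemma kterm_add:
  assumes "kterm t s a" "kterm t s b"
  shows "kterm t s (\<lambda>m J. a m J + b m J)"
proof -
  have "contract_set {1..n} (\<lambda>J. a m J + b m J) J = 0" for m J
    using assms by (simp add: contract_set_add kterm_def)
  moreover have "a m J \<noteq> 0 \<or> b m J \<noteq> 0" if "a m J + b m J \<noteq> 0" for m J using that by auto
  moreover have "alt_form n t (\<lambda>J. a m J + b m J)" for m
    using assms unfolding kterm_def alt_form_def by (metis add.right_neutral)
  ultimately show ?thesis using assms unfolding kterm_def by (metis ext)
qed

lemma kterm_scale:
  assumes "kterm t s a"
  shows "kterm t s (\<lambda>m J. c * a m J)"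
  using assms unfolding kterm_def alt_form_def by (simp add: fun_eq_iff contract_set_scale) blast

lemma kterm_diff:
  assumes "kterm t s a" "kterm t s b"
  shows "kterm t s (\<lambda>m J. a m J - b m J)"
  using kterm_add[OF assms(1) kterm_scale[OF assms(2), of "-1"]] by simp

lemma kterm_sum:
  "finite A \<Longrightarrow> (\<And>x. x \<in> A \<Longrightarrow> kterm t s (g x)) \<Longrightarrow> kterm t s (\<lambda>m J. \<Sum>x\<in>A. g x m J)"
  by (induction A rule: finite_induct) (simp_all add: kterm_zero kterm_add)

lemma fil_add: "fil j a \<Longrightarrow> fil j b \<Longrightarrow> fil j (\<lambda>m J. a m J + b m J)"
  by (auto simp: fil_def)

lemma fil_diff: "fil j a \<Longrightarrow> fil j b \<Longrightarrow> fil j (\<lambda>m J. a m J - b m J)"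
  by (auto simp: fil_def)

text \<open>Dividing by a variable can only shrink the support, and a smaller chain has a least flag
  of no larger weight. So the values that \<open>kd\<close> reads at a low level lie at levels at
  least as low.\<close>

lemma fil_kd:
  assumes "fil j w"
  shows "fil j (kd w)"
  unfolding fil_def
proof (intro allI impI ext)
  fix m J assume m: "chain_mono m \<and> level m < j"
  have "w (m - var_mono F) = (\<lambda>_. 0)" for F
    using assms chain_mono_diff[of m F] level_mono[OF _ keys_diff_var_subset, of m F] m by (force simp: fil_def)
  then show "kd w m J = 0" by (simp add: kd_def)
qed

lemma fil_Suc:
  assumes "fil j w" "kterm t s w"
    and "\<And>f m. is_flag f \<Longrightarrow> weight f = j \<Longrightarrow> at_flag f m \<Longrightarrow> w m = (\<lambda>_. 0)"
  shows "fil (Suc j) w"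
  unfolding fil_def
proof (intro allI impI)
  fix m assume m: "chain_mono m \<and> level m < Suc j"
  show "w m = (\<lambda>_. 0)"
  proof (cases "level m = j")
    case True
    have "is_flag (least_flag (keys m))" using m least_flag(1) by (auto simp: chain_mono_def)
    then show ?thesis using assms(3) True m at_flag_iff by (simp add: level_def)
  next
    case False
    then show ?thesis using assms(1) m by (simp add: fil_def)
  qed
qed

lemma fil_top:
  assumes "fil (Suc n ^ r) w" "kterm t s w"
  shows "w = (\<lambda>_ _. 0)"
proof (intro ext)
  fix m J
  show "w m J = 0"
  proof (cases "chain_mono m")
    case True
    then have "level m < Suc n ^ r" unfolding level_def
      using weight_bound[OF least_flag(1)] by (simp add: chain_mono_def)
    then show ?thesis using assms(1) True by (simp add: fil_def)
  next
    case False then show ?thesis using assms(2) by (auto simp: kterm_def)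
  qed
qed

end


section \<open>Contracting the graded pieces of the flag filtration\<close>

context loopless_matroid
begin

abbreviation residual :: "cochain \<Rightarrow> cochain \<Rightarrow> cochain" where
  "residual w v \<equiv> \<lambda>m J. w m J - kd v m J"

text \<open>For a monomial belonging to \<open>f\<close>, this says that one factor of the variable
  of \<open>F\<close> can be divided out without leaving the flag: a descent has to retain one
  factor.\<close>

definition excess :: "(nat \<Rightarrow> nat set) \<Rightarrow> nat set \<Rightarrow> flat_mono \<Rightarrow> bool" where
  "excess f F m \<longleftrightarrow> lookup m F > of_bool (F \<in> descents f)"

lemma excess_key: "excess f F m \<Longrightarrow> F \<in> keys m"
  by (auto simp: excess_def in_keys_iff)

lemma at_flag_add: "at_flag f m \<Longrightarrow> F \<in> flag_sets f \<Longrightarrow> at_flag f (m + var_mono F)"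
  by (auto simp: at_flag_def keys_add_var)

lemma at_flag_diff:
  assumes "at_flag f m" "G \<in> keys m"
  shows "at_flag f (m - var_mono G) \<longleftrightarrow> excess f G m"
proof -
  have "at_flag f (m - var_mono G) \<longleftrightarrow> descents f \<subseteq> keys (m - var_mono G)"
    using assms keys_diff_var_subset[of m G] by (auto simp: at_flag_def)
  also have "\<dots> \<longleftrightarrow> (G \<in> descents f \<longrightarrow> lookup m G > 1)"
    using assms(1) unfolding at_flag_def subset_iff lookup_pos_of_keys_diff by auto
  also have "\<dots> \<longleftrightarrow> excess f G m"
    using assms(2) by (auto simp: excess_def in_keys_iff)
  finally show ?thesis .
qed

text \<open>Such a \<open>G\<close> is a descent with exponent one. Removing it takes the monomial
  from the flag to a strictly lower level, where \<open>w\<close> vanishes.\<close>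

lemma fil_add_diff_var:
  assumes f: "is_flag f" and w: "fil (weight f) w" and m: "at_flag f m" and F: "F \<in> flag_sets f"
    and G: "G \<in> keys m" "\<not> excess f G m" "G \<noteq> F"
  shows "w (m + var_mono F - var_mono G) = (\<lambda>_. 0)"
proof -
  let ?m = "m + var_mono F - var_mono G"
  have mF: "at_flag f (m + var_mono F)" by (rule at_flag_add[OF m F])
  have "\<not> excess f G (m + var_mono F)"
    using G by (simp add: excess_def lookup_add lookup_var_mono)
  then have not: "\<not> at_flag f ?m"
    using at_flag_diff[OF mF, of G] G by (simp add: keys_add_var)
  have ch: "chain_mono (m + var_mono F)" by (rule at_flag_chain[OF f mF])
  have "level ?m \<le> weight f"
    using level_mono[OF ch keys_diff_var_subset] at_flag_level[OF f] mF by metis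
  moreover have "level ?m \<noteq> weight f"
    using at_flag_level[OF f, of ?m] not chain_mono_diff[OF ch] by blast
  ultimately show ?thesis using w chain_mono_diff[OF ch] by (simp add: fil_def)
qed

text \<open>Divides by the variable of \<open>f k\<close> and wedges with its dual vector, like the
  standard contraction of a Koszul complex along one variable. The cutoff to monomials at
  \<open>f\<close> keeps the result in the filtration step \<open>weight f\<close>.\<close>

definition homotopy :: "(nat \<Rightarrow> nat set) \<Rightarrow> nat \<Rightarrow> cochain \<Rightarrow> cochain" where
  "homotopy f k w m = (if at_flag f m then wedge_vec (dual_vector f k) (w (m + var_mono (f k))) else (\<lambda>_. 0))"

lemma sum_dual_vector_ground: "is_flag f \<Longrightarrow> 1 \<le> k \<Longrightarrow> k < r \<Longrightarrow> (\<Sum>i\<in>{1..n}. dual_vector f k i) = 0"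
  using sum_dual_vector[of f k r] flag_top[of f r] by simp

text \<open>Here \<open>k < r\<close> matters: the dual vector then pairs to zero with the ground
  set, so wedging with it preserves the kernel of that contraction.\<close>

lemma kterm_homotopy:
  assumes f: "is_flag f" and k: "1 \<le> k" "k < r" and w: "kterm t s w"
  shows "kterm (Suc t) (s - 1) (homotopy f k w)"
  unfolding kterm_def
proof (intro conjI allI impI)
  fix m
  have alt: "alt_form n t (w m')" for m' using w by (simp add: kterm_def)
  have inf: "\<And>J. infinite J \<Longrightarrow> w m' J = 0" for m' using w kterm_infinite by blast
  show "alt_form n (Suc t) (homotopy f k w m)"
    using alt_form_wedge_vec[OF dual_vector_support[OF f] alt] k
    by (auto simp: homotopy_def) (simp add: alt_form_def)
  have "contract_set {1..n} (wedge_vec (dual_vector f k) (w m')) = (\<lambda>_. 0)" for m'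
  proof
    fix J
    have "contract_set {1..n} (w m') = (\<lambda>_. 0)" using w by (simp add: kterm_def)
    then show "contract_set {1..n} (wedge_vec (dual_vector f k) (w m')) J = 0"
      using contract_set_wedge_vec[of "w m'" "{1..n}" "dual_vector f k" J, OF inf]
        sum_dual_vector_ground[OF f k] by simp
  qed
  then show "contract_set {1..n} (homotopy f k w m) = (\<lambda>_. 0)"
    by (simp add: homotopy_def)
next
  fix m J assume nz: "homotopy f k w m J \<noteq> 0"
  then have m: "at_flag f m" by (auto simp: homotopy_def split: if_splits)
  then show "chain_mono m" by (rule at_flag_chain[OF f])
  have "w (m + var_mono (f k)) \<noteq> (\<lambda>_. 0)" using nz m by (auto simp: homotopy_def)
  then obtain J' where "w (m + var_mono (f k)) J' \<noteq> 0" by (auto simp: fun_eq_iff)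
  then have "int (mdeg (m + var_mono (f k))) = s" using w by (auto simp: kterm_def)
  then show "int (mdeg m) = s - 1" by (simp add: mdeg_add_var)
qed

lemma fil_homotopy: "is_flag f \<Longrightarrow> fil (weight f) (homotopy f k w)"
  by (auto simp: fil_def homotopy_def at_flag_level)

text \<open>On the part of the complex lying over one flag the homotopy divides by \<open>x\<^sub>F\<close>, so that
  \<open>kd\<close> composed with it is the identity wherever \<open>x\<^sub>F\<close> can be split off.\<close>

lemma kd_homotopy:
  assumes f: "is_flag f" and k: "1 \<le> k" "k < r" and w: "kterm t s w" and fil: "fil (weight f) w"
    and cyc: "\<And>m J. at_flag f m \<Longrightarrow> kd w m J = 0" and m: "at_flag f m"
  shows "kd (homotopy f k w) m J =
    (if excess f (f k) m then w m J else wedge_vec (dual_vector f k) (contract_set (f k) (w m)) J)"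
proof -
  let ?F = "f k" and ?v = "dual_vector f k"
  define E where "E = {G\<in>keys m. excess f G m}"
  define u where "u = (\<lambda>G. w (m + var_mono ?F - var_mono G))"
  have F: "?F \<in> flag_sets f" using k by (auto simp: flag_sets_def)
  have inf: "\<And>J. infinite J \<Longrightarrow> w m' J = 0" for m' using w kterm_infinite by blast
  have finE: "finite E" by (simp add: E_def)
  \<comment> \<open>The support of \<open>m\<close> consists of members of \<open>f\<close>, and
    only \<open>?F\<close> pairs nontrivially with its dual vector.\<close>
  have pair: "(\<Sum>i\<in>G. ?v i) = of_bool (G = ?F)" if G: "G \<in> keys m" for G
  proof -
    have "G \<in> flag_sets f" using G m by (auto simp: at_flag_def)
    then obtain j where j: "j < r" "G = f j" by (auto simp: flag_sets_def)
    then show ?thesis using sum_dual_vector[OF f, of k j] k flag_inj[OF f, of j k] by auto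
  qed
  have "kd (homotopy f k w) m J = (\<Sum>G\<in>keys m. contract_set G (homotopy f k w (m - var_mono G)) J)"
    using at_flag_chain[OF f m] by (simp add: kd_def)
  also have "\<dots> = (\<Sum>G\<in>E. contract_set G (wedge_vec ?v (u G)) J)"
    unfolding E_def by (rule sum.mono_neutral_cong_right)
      (use at_flag_diff[OF m] in \<open>auto simp: homotopy_def u_def add_diff_var_comm\<close>)
  also have "\<dots> = (\<Sum>G\<in>E. of_bool (G = ?F) * u G J - wedge_vec ?v (contract_set G (u G)) J)"
    by (intro sum.cong refl) (simp add: E_def u_def pair contract_set_wedge_vec[OF inf])
  also have "\<dots> = (\<Sum>G\<in>E. of_bool (G = ?F) * u G J) - wedge_vec ?v (\<lambda>J. \<Sum>G\<in>E. contract_set G (u G) J) J"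
    by (simp add: sum_subtractf wedge_vec_sum)
  finally have eq: "kd (homotopy f k w) m J =
      (\<Sum>G\<in>E. of_bool (G = ?F) * u G J) - wedge_vec ?v (\<lambda>J. \<Sum>G\<in>E. contract_set G (u G) J) J" .
  have mF: "at_flag f (m + var_mono ?F)" by (rule at_flag_add[OF m F])
  \<comment> \<open>The cycle condition is used one degree higher, at \<open>m\<close> times the
    variable of \<open>?F\<close>, because that is where the homotopy reads \<open>w\<close>. Keys
    other than \<open>?F\<close> that are not in excess drop out, since removing them leads to a
    lower level.\<close>
  have cycle: "(\<Sum>G\<in>insert ?F E. contract_set G (u G) J) = 0" for J
  proof -
    have "0 = kd w (m + var_mono ?F) J" using cyc[OF mF] by simp
    also have "\<dots> = (\<Sum>G\<in>insert ?F (keys m). contract_set G (u G) J)"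
      using at_flag_chain[OF f mF] by (simp add: kd_def keys_add_var u_def)
    also have "\<dots> = (\<Sum>G\<in>insert ?F E. contract_set G (u G) J)"
      unfolding E_def by (rule sum.mono_neutral_right)
        (use fil_add_diff_var[OF f fil m F] in \<open>auto simp: u_def\<close>)
    finally show ?thesis by simp
  qed
  have uF: "u ?F = w m" by (simp add: u_def add_diff_var)
  show ?thesis
  proof (cases "excess f ?F m")
    case True
    then have FE: "?F \<in> E" by (simp add: E_def excess_key)
    have "(\<Sum>G\<in>E. of_bool (G = ?F) * u G J) = (\<Sum>G\<in>E. if G = ?F then u G J else 0)"
      by (intro sum.cong) auto
    also have "\<dots> = w m J" using FE finE uF by simp
    finally show ?thesis using True eq cycle FE by (simp add: insert_absorb)
  next
    case False
    then have FE: "?F \<notin> E" by (simp add: E_def)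
    have "(\<Sum>G\<in>E. contract_set G (u G) J) = - contract_set ?F (w m) J" for J
      using cycle[of J] FE finE uF by (simp add: eq_neg_iff_add_eq_0 add.commute)
    moreover have "(\<Sum>G\<in>E. of_bool (G = ?F) * u G J) = 0" using FE by (intro sum.neutral) auto
    ultimately show ?thesis using False eq by (simp add: wedge_vec_uminus)
  qed
qed

text \<open>Imposed for all proper members, the first condition leaves only the monomial
  \<open>descent_mono f\<close>, and the second only forms in the common kernel of their
  contractions.\<close>

definition reduced_at :: "(nat \<Rightarrow> nat set) \<Rightarrow> nat \<Rightarrow> cochain \<Rightarrow> flat_mono \<Rightarrow> bool" where
  "reduced_at f k w m \<longleftrightarrow> (excess f (f k) m \<longrightarrow> w m = (\<lambda>_. 0)) \<and> contract_set (f k) (w m) = (\<lambda>_. 0)"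

text \<open>Away from excess, subtracting the boundary replaces \<open>w m\<close> by the
  contraction with \<open>f k\<close> of \<open>wedge_vec (dual_vector f k) (w m)\<close>, a
  projection onto the kernel of that contraction. The dual vector pairs to zero with the other
  members, so the conditions already obtained for them persist.\<close>

lemma reduce_one:
  assumes f: "is_flag f" and k: "1 \<le> k" "k < r" and w: "kterm t s w" and fil: "fil (weight f) w"
    and cyc: "\<And>m J. at_flag f m \<Longrightarrow> kd w m J = 0"
    and w'_def: "w' = (\<lambda>m J. w m J - kd (homotopy f k w) m J)" and m: "at_flag f m"
  shows "reduced_at f k w' m" "\<And>j. reduced_at f j w m \<Longrightarrow> reduced_at f j w' m"
proof -
  have inf: "\<And>J. infinite J \<Longrightarrow> w m' J = 0" for m' using w kterm_infinite by blast
  have inf': "\<And>J. infinite J \<Longrightarrow> contract_set G (w m') J = 0" for m' G by (simp add: contract_set_def)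
  have eq: "w' m J = (if excess f (f k) m then 0 else w m J - wedge_vec (dual_vector f k) (contract_set (f k) (w m)) J)" for J
    using kd_homotopy[OF f k w fil cyc m, of J] by (simp add: w'_def)
  have one: "(\<Sum>i\<in>f k. dual_vector f k i) = 1" using sum_dual_vector[OF f, of k k] k by simp
  show "reduced_at f k w' m"
  proof (cases "excess f (f k) m")
    case True
    then have "w' m = (\<lambda>_. 0)" using eq by auto
    then show ?thesis by (simp add: reduced_at_def)
  next
    case False
    then have w': "w' m = (\<lambda>J. w m J - wedge_vec (dual_vector f k) (contract_set (f k) (w m)) J)" using eq by auto
    have "contract_set (f k) (w' m) = (\<lambda>_. 0)"
      unfolding w' by (simp add: fun_eq_iff contract_set_diff contract_set_wedge_vec[OF inf'] one)
    then show ?thesis using False by (simp add: reduced_at_def)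
  qed
  fix j assume j: "reduced_at f j w m"
  have comm: "contract_set (f j) (contract_set (f k) (w m)) = (\<lambda>_. 0)"
  proof
    fix J
    have "contract_set (f j) (w m) = (\<lambda>_. 0)" using j by (simp add: reduced_at_def)
    then show "contract_set (f j) (contract_set (f k) (w m)) J = 0"
      using contract_set_contract_set[of "f j" "f k" "w m" J] by simp
  qed
  show "reduced_at f j w' m"
  proof (cases "excess f (f k) m")
    case True
    then have "w' m = (\<lambda>_. 0)" using eq by auto
    then show ?thesis by (simp add: reduced_at_def)
  next
    case False
    then have w': "w' m = (\<lambda>J. w m J - wedge_vec (dual_vector f k) (contract_set (f k) (w m)) J)" using eq by auto
    show ?thesis
    proof (cases "j = k")
      case True then show ?thesis using \<open>reduced_at f k w' m\<close> by simp
    next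
      case jk: False
      have "contract_set (f j) (wedge_vec (dual_vector f k) (contract_set (f k) (w m))) J
          = (\<Sum>i\<in>f j. dual_vector f k i) * contract_set (f k) (w m) J" for J
        by (simp add: contract_set_wedge_vec[OF inf'] comm)
      \<comment> \<open>The index \<open>j\<close> is arbitrary; beyond \<open>r\<close> the member
        equals \<open>f r\<close>, which also pairs to zero with the dual vector since
        \<open>k < r\<close>.\<close>
      also have "\<dots> J = 0" for J
      proof (cases "j \<le> r")
        case True then show ?thesis using sum_dual_vector[OF f, of k j] k jk by simp
      next
        case False
        then have "f j = f r" using flag_top[OF f] by simp
        then show ?thesis using sum_dual_vector[OF f, of k r] k by simp
      qed
      finally have "contract_set (f j) (w' m) = (\<lambda>_. 0)"
        using j unfolding w' by (simp add: fun_eq_iff contract_set_diff reduced_at_def)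
      moreover have "w' m = (\<lambda>_. 0)" if "excess f (f j) m"
        using that j unfolding w' by (simp add: reduced_at_def)
      ultimately show ?thesis by (simp add: reduced_at_def)
    qed
  qed
qed

text \<open>The members are treated one after another. Residuals remain cycles at the flag because
  \<open>kd\<close> squares to zero, and indices already treated stay reduced.\<close>

lemma reduce_set:
  assumes f: "is_flag f" and w: "kterm t s w" and fil: "fil (weight f) w"
    and cyc: "\<And>m J. at_flag f m \<Longrightarrow> kd w m J = 0" and K: "K \<subseteq> {1..<r}"
  shows "\<exists>v. kterm (Suc t) (s - 1) v \<and> fil (weight f) v \<and>
    (\<forall>m. at_flag f m \<longrightarrow> (\<forall>k\<in>K. reduced_at f k (residual w v) m))"
proof -
  have "finite K" using K finite_subset by blast
  then show ?thesis using K
  proof (induction K rule: finite_induct)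
    case empty
    show ?case by (intro exI[of _ "\<lambda>_ _. 0"]) (simp add: kterm_zero fil_def)
  next
    case (insert k K)
    then obtain v where v: "kterm (Suc t) (s - 1) v" "fil (weight f) v"
      and red: "\<And>m k. at_flag f m \<Longrightarrow> k \<in> K \<Longrightarrow> reduced_at f k (residual w v) m" by auto
    define w1 where "w1 = residual w v"
    have w1: "kterm t s w1" "fil (weight f) w1"
      unfolding w1_def using w fil v by (auto intro: kterm_diff kterm_kd fil_diff fil_kd)
    have cyc1: "kd w1 m J = 0" if "at_flag f m" for m J
      unfolding w1_def using that cyc by (simp add: kd_diff kd_kd)
    have k: "1 \<le> k" "k < r" using insert.prems by auto
    define v' where "v' = (\<lambda>m J. v m J + homotopy f k w1 m J)"
    have v': "kterm (Suc t) (s - 1) v'" "fil (weight f) v'"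
      unfolding v'_def using v fil_homotopy[OF f] kterm_homotopy[OF f k w1(1)] by (auto intro: kterm_add fil_add)
    have eq: "residual w v' = (\<lambda>m J. w1 m J - kd (homotopy f k w1) m J)"
      unfolding v'_def kd_add by (simp add: w1_def diff_diff_eq)
    show ?case
      using v' reduce_one[OF f k w1 cyc1 eq] red by (intro exI[of _ v']) (auto simp: w1_def)
  qed
qed

definition descent_mono :: "(nat \<Rightarrow> nat set) \<Rightarrow> flat_mono" where
  "descent_mono f = (\<Sum>F\<in>descents f. var_mono F)"

lemma finite_descents: "finite (descents f)"
  by (simp add: descents_def)

lemma lookup_descent_mono: "lookup (descent_mono f) F = of_bool (F \<in> descents f)"
proof -
  have "lookup (\<Sum>F\<in>A. var_mono F) G = of_bool (G \<in> A)" if "finite A" for A G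
    using that by (induction A rule: finite_induct) (auto simp: lookup_add lookup_var_mono)
  then show ?thesis using finite_descents by (simp add: descent_mono_def)
qed

lemma keys_descent_mono: "keys (descent_mono f) = descents f"
  by (auto simp: in_keys_iff lookup_descent_mono)

lemma mdeg_descent_mono: "mdeg (descent_mono f) = card (descents f)"
  by (simp add: mdeg_def keys_descent_mono lookup_descent_mono)

lemma at_flag_descent_mono: "at_flag f (descent_mono f)"
  by (simp add: at_flag_def keys_descent_mono descents_subset)

lemma not_excess_eq:
  assumes m: "at_flag f m" and ne: "\<And>k. k \<in> {1..<r} \<Longrightarrow> \<not> excess f (f k) m"
  shows "m = descent_mono f"
proof (rule poly_mapping_eqI)
  fix F
  show "lookup m F = lookup (descent_mono f) F"
  proof (cases "F \<in> flag_sets f")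
    case True
    then have "\<not> excess f F m" using ne by (auto simp: flag_sets_def)
    moreover have "F \<in> descents f \<Longrightarrow> lookup m F > 0"
      using m by (auto simp: at_flag_def in_keys_iff)
    ultimately show ?thesis by (auto simp: lookup_descent_mono excess_def)
  next
    case False
    then have "F \<notin> keys m" "F \<notin> descents f"
      using m descents_subset[of f] by (auto simp: at_flag_def)
    then show ?thesis by (simp add: lookup_descent_mono in_keys_iff)
  qed
qed

text \<open>The homotopies take care of the proper members; contraction with \<open>f r\<close>
  vanishes by the ground-set condition in \<open>kterm\<close>.\<close>

lemma reduce_flag:
  assumes f: "is_flag f" and w: "kterm t s w" and fil: "fil (weight f) w"
    and cyc: "\<And>m J. at_flag f m \<Longrightarrow> kd w m J = 0"
  obtains v where "kterm (Suc t) (s - 1) v" "fil (weight f) v"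
    "\<And>m. at_flag f m \<Longrightarrow> m \<noteq> descent_mono f \<Longrightarrow> residual w v m = (\<lambda>_. 0)"
    "\<And>m k. at_flag f m \<Longrightarrow> k \<in> {1..r} \<Longrightarrow> contract_set (f k) (residual w v m) = (\<lambda>_. 0)"
proof -
  obtain v where v: "kterm (Suc t) (s - 1) v" "fil (weight f) v"
    and red: "\<And>m k. at_flag f m \<Longrightarrow> k \<in> {1..<r} \<Longrightarrow> reduced_at f k (residual w v) m"
    using reduce_set[OF f w fil cyc order_refl] by blast
  have "contract_set (f k) (residual w v m) = (\<lambda>_. 0)" if "at_flag f m" "k \<in> {1..r}" for m k
  proof (cases "k = r")
    case True
    have "kterm t s (residual w v)" using w v by (auto intro: kterm_diff kterm_kd)
    then show ?thesis using True flag_top[OF f order_refl] by (simp add: kterm_def)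
  next
    case False
    then show ?thesis using red[OF that(1), of k] that(2) by (simp add: reduced_at_def)
  qed
  moreover have "residual w v m = (\<lambda>_. 0)" if "at_flag f m" "m \<noteq> descent_mono f" for m
  proof -
    have "\<exists>k\<in>{1..<r}. excess f (f k) m" using not_excess_eq[OF that(1)] that(2) by blast
    then obtain k where "k \<in> {1..<r}" "excess f (f k) m" by blast
    then show ?thesis using red[OF that(1), of k] by (simp add: reduced_at_def)
  qed
  ultimately show ?thesis using that v by blast
qed

end


section \<open>Vanishing and the top class\<close>

context loopless_matroid
begin

section \<open>The common kernel of the contractions with the members of a flag\<close>

fun contract_flag :: "(nat \<Rightarrow> nat set) \<Rightarrow> nat \<Rightarrow> (nat set \<Rightarrow> complex) \<Rightarrow> nat set \<Rightarrow> complex" where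
  "contract_flag f 0 \<omega> = \<omega>"
| "contract_flag f (Suc k) \<omega> = contract_flag f k (contract_set (f (Suc k)) \<omega>)"

text \<open>The factors are wedged on in the order opposite to that in which
  \<open>contract_flag\<close> takes them off: the last one added is the first one
  contracted.\<close>

fun wedge_flag :: "(nat \<Rightarrow> nat set) \<Rightarrow> nat \<Rightarrow> (nat set \<Rightarrow> complex) \<Rightarrow> nat set \<Rightarrow> complex" where
  "wedge_flag f 0 \<omega> = \<omega>"
| "wedge_flag f (Suc k) \<omega> = wedge_vec (dual_vector f (Suc k)) (wedge_flag f k \<omega>)"

definition top_form :: "nat set \<Rightarrow> complex" where
  "top_form J = of_bool (J = {1..n})"

text \<open>The volume form contracted with all \<open>r\<close> functionals of the flag; it
  generates the line of forms of degree \<open>n - r\<close> killed by all of them.\<close>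

definition flag_form :: "(nat \<Rightarrow> nat set) \<Rightarrow> nat set \<Rightarrow> complex" where
  "flag_form f = contract_flag f r top_form"

lemma rank_le: "r \<le> n"
proof -
  obtain B where "B \<in> Bs" using matroid by (auto simp: matroid_def)
  then show ?thesis using rk_basis[of B] basis_subset[of B] rank card_mono[of "{1..n}" B] by simp
qed

lemma contract_set_wedge_dual:
  assumes f: "is_flag f" and jk: "1 \<le> k" "k \<le> r" "j \<le> r" and \<omega>: "\<And>J. infinite J \<Longrightarrow> \<omega> J = 0"
  shows "contract_set (f j) (wedge_vec (dual_vector f k) \<omega>) J =
    of_bool (j = k) * \<omega> J - wedge_vec (dual_vector f k) (contract_set (f j) \<omega>) J"
  using contract_set_wedge_vec[of \<omega> "f j", OF \<omega>] sum_dual_vector[OF f jk] by simp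

lemma alt_form_wedge_flag:
  assumes f: "is_flag f" and \<omega>: "alt_form n t \<omega>" and "k \<le> r"
  shows "alt_form n (t + k) (wedge_flag f k \<omega>)"
  using assms(3)
proof (induction k)
  case (Suc k)
  then show ?case using alt_form_wedge_vec[OF dual_vector_support[OF f, of "Suc k"]] by simp
qed (simp add: \<omega>)

lemma contract_wedge_flag:
  assumes f: "is_flag f" and \<omega>: "alt_form n t \<omega>"
    and ker: "\<And>k. k \<in> {1..r} \<Longrightarrow> contract_set (f k) \<omega> = (\<lambda>_. 0)"
  shows "k < j \<Longrightarrow> j \<le> r \<Longrightarrow> contract_set (f j) (wedge_flag f k \<omega>) = (\<lambda>_. 0)"
proof (induction k)
  case (Suc k)
  have inf: "\<And>J. infinite J \<Longrightarrow> wedge_flag f k \<omega> J = 0"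
    using alt_form_infinite[OF alt_form_wedge_flag[OF f \<omega>]] Suc.prems by simp
  show ?case
    using Suc by (intro ext) (simp add: contract_set_wedge_dual[OF f _ _ _ inf])
qed (use ker in auto)

text \<open>By duality each contraction removes its own dual vector and annihilates the form beneath
  it.\<close>

lemma contract_flag_wedge_flag:
  assumes f: "is_flag f" and \<omega>: "alt_form n t \<omega>"
    and ker: "\<And>k. k \<in> {1..r} \<Longrightarrow> contract_set (f k) \<omega> = (\<lambda>_. 0)"
  shows "k \<le> r \<Longrightarrow> contract_flag f k (wedge_flag f k \<omega>) = \<omega>"
proof (induction k)
  case (Suc k)
  have inf: "\<And>J. infinite J \<Longrightarrow> wedge_flag f k \<omega> J = 0"
    using alt_form_infinite[OF alt_form_wedge_flag[OF f \<omega>]] Suc.prems by simp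
  have "contract_set (f (Suc k)) (wedge_flag f (Suc k) \<omega>) = wedge_flag f k \<omega>"
    using Suc.prems contract_wedge_flag[OF f \<omega> ker, of k "Suc k"]
    by (intro ext) (simp add: contract_set_wedge_dual[OF f _ _ _ inf])
  then show ?case using Suc by simp
qed simp

lemma contract_flag_zero [simp]: "contract_flag f k (\<lambda>_. 0) = (\<lambda>_. 0)"
  by (induction k) simp_all

lemma contract_flag_scale: "contract_flag f k (\<lambda>J. c * \<omega> J) = (\<lambda>J. c * contract_flag f k \<omega> J)"
proof (induction k arbitrary: \<omega>)
  case (Suc k)
  have "contract_set (f (Suc k)) (\<lambda>J. c * \<omega> J) = (\<lambda>J. c * contract_set (f (Suc k)) \<omega> J)"
    by (rule ext) (rule contract_set_scale)
  then show ?case using Suc by simp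
qed simp

text \<open>Wedging on the \<open>r\<close> dual vectors gives a form of degree above
  \<open>n\<close>, which is zero, and contraction recovers \<open>\<omega>\<close> from it.\<close>

lemma form_kernel_zero:
  assumes f: "is_flag f" and \<omega>: "alt_form n t \<omega>"
    and ker: "\<And>k. k \<in> {1..r} \<Longrightarrow> contract_set (f k) \<omega> = (\<lambda>_. 0)" and "n - r < t"
  shows "\<omega> = (\<lambda>_. 0)"
proof -
  have "alt_form n (t + r) (wedge_flag f r \<omega>)" using alt_form_wedge_flag[OF f \<omega>] by simp
  moreover have "\<not> (J \<subseteq> {1..n} \<and> card J = t + r)" for J
    using card_mono[of "{1..n}" J] assms(4) by auto
  ultimately have "wedge_flag f r \<omega> = (\<lambda>_. 0)" by (auto simp: alt_form_def fun_eq_iff)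
  then show ?thesis using contract_flag_wedge_flag[OF f \<omega> ker order_refl] by simp
qed

text \<open>The same wedge now lands in degree \<open>n\<close>, where every form is a multiple of
  the volume form; contracting back turns the volume form into \<open>flag_form f\<close>.\<close>

lemma form_kernel_top:
  assumes f: "is_flag f" and \<omega>: "alt_form n (n - r) \<omega>"
    and ker: "\<And>k. k \<in> {1..r} \<Longrightarrow> contract_set (f k) \<omega> = (\<lambda>_. 0)"
  obtains c where "\<omega> = (\<lambda>J. c * flag_form f J)"
proof -
  let ?u = "wedge_flag f r \<omega>"
  have "alt_form n n ?u" using alt_form_wedge_flag[OF f \<omega> order_refl] rank_le by simp
  then have "J = {1..n}" if "?u J \<noteq> 0" for J
    using that card_subset_eq[of "{1..n}" J] by (auto simp: alt_form_def simp del: One_nat_def)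
  then have "?u J = ?u {1..n} * top_form J" for J
    by (cases "J = {1..n}") (auto simp: top_form_def simp del: One_nat_def)
  then have "?u = (\<lambda>J. ?u {1..n} * top_form J)" by (rule ext)
  then have "\<omega> = (\<lambda>J. ?u {1..n} * flag_form f J)"
    using contract_flag_wedge_flag[OF f \<omega> ker order_refl] contract_flag_scale[of f r "?u {1..n}" top_form]
    unfolding flag_form_def by metis
  then show ?thesis by (rule that)
qed

lemma alt_form_contract_flag:
  assumes f: "is_flag f"
  shows "alt_form n (t + k) \<omega> \<Longrightarrow> alt_form n t (contract_flag f k \<omega>)"
proof (induction k arbitrary: \<omega>)
  case (Suc k)
  then show ?case using alt_form_contract_set[OF flag_subset_ground[OF f]] by simp
qed simp

lemma alt_form_top: "alt_form n n top_form"
  by (auto simp: alt_form_def top_form_def split: if_splits)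

lemma alt_form_flag_form: "is_flag f \<Longrightarrow> alt_form n (n - r) (flag_form f)"
  unfolding flag_form_def using alt_form_contract_flag[of f "n - r" r top_form] alt_form_top rank_le by simp

lemma contract_set_contract_flag:
  "contract_set G (contract_flag f k \<omega>) = (\<lambda>J. (-1) ^ k * contract_flag f k (contract_set G \<omega>) J)"
proof (induction k arbitrary: \<omega>)
  case (Suc k)
  have "contract_set G (contract_set (f (Suc k)) \<omega>) = (\<lambda>J. (-1) * contract_set (f (Suc k)) (contract_set G \<omega>) J)"
  proof
    fix J
    show "contract_set G (contract_set (f (Suc k)) \<omega>) J = (-1) * contract_set (f (Suc k)) (contract_set G \<omega>) J"
      using contract_set_contract_set[of G "f (Suc k)" \<omega> J] by simp
  qed
  then show ?case using Suc[of "contract_set (f (Suc k)) \<omega>"]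
    by (simp only: contract_flag.simps contract_flag_scale) simp
qed simp

lemma contract_set_flag_form:
  assumes "k \<in> {1..r}"
  shows "contract_set (f k) (flag_form f) = (\<lambda>_. 0)"
proof -
  have "1 \<le> k \<Longrightarrow> k \<le> l \<Longrightarrow> contract_set (f k) (contract_flag f l \<omega>) = (\<lambda>_. 0)" for l \<omega>
  proof (induction l arbitrary: \<omega>)
    case (Suc l)
    show ?case
    proof (cases "k = Suc l")
      case True
      then show ?thesis by (simp add: contract_set_contract_flag)
    next
      case False then show ?thesis using Suc by simp
    qed
  qed simp
  then show ?thesis using assms by (simp add: flag_form_def)
qed

text \<open>Contract the vanishing wedges with \<open>f (Suc k)\<close>. For
  \<open>i \<le> k\<close> this shows that the contracted form is again killed by the dual vectors,
  so it is zero by induction; for \<open>i = Suc k\<close> it then gives back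
  \<open>\<omega> = 0\<close>. The intended \<open>\<omega>\<close> is the volume form, which every
  wedge kills by degree.\<close>

lemma contract_flag_eq_zero:
  assumes f: "is_flag f"
  shows "k \<le> r \<Longrightarrow> contract_flag f k \<omega> = (\<lambda>_. 0) \<Longrightarrow> (\<And>J. infinite J \<Longrightarrow> \<omega> J = 0) \<Longrightarrow>
    (\<And>i. 1 \<le> i \<Longrightarrow> i \<le> k \<Longrightarrow> wedge_vec (dual_vector f i) \<omega> = (\<lambda>_. 0)) \<Longrightarrow> \<omega> = (\<lambda>_. 0)"
proof (induction k arbitrary: \<omega>)
  case (Suc k)
  note inf = Suc.prems(3)
  have rel: "wedge_vec (dual_vector f i) (contract_set (f (Suc k)) \<omega>) J = of_bool (i = Suc k) * \<omega> J"
    if "1 \<le> i" "i \<le> Suc k" for i J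
    using contract_set_wedge_dual[where j = "Suc k" and J = J and \<omega> = \<omega>, OF f that(1) _ _ inf] Suc.prems(1) Suc.prems(4)[OF that] that
    by (auto simp: algebra_simps)
  have "contract_set (f (Suc k)) \<omega> = (\<lambda>_. 0)"
  proof (rule Suc.IH)
    show "contract_set (f (Suc k)) \<omega> J = 0" if "infinite J" for J using that by (simp add: contract_set_def)
    show "wedge_vec (dual_vector f i) (contract_set (f (Suc k)) \<omega>) = (\<lambda>_. 0)" if "1 \<le> i" "i \<le> k" for i
      using rel[of i] that by auto
  qed (use Suc.prems in auto)
  then show ?case using rel[of "Suc k"] by (intro ext) simp
qed simp

lemma flag_form_nonzero:
  assumes f: "is_flag f"
  shows "flag_form f \<noteq> (\<lambda>_. 0)"
proof
  assume z: "flag_form f = (\<lambda>_. 0)"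
  have "top_form = (\<lambda>_. 0)"
  proof (rule contract_flag_eq_zero[OF f order_refl])
    show "contract_flag f r top_form = (\<lambda>_. 0)" using z by (simp add: flag_form_def)
    show "top_form J = 0" if "infinite J" for J using that by (auto simp: top_form_def)
    fix i assume i: "1 \<le> i" "i \<le> r"
    have "alt_form n (Suc n) (wedge_vec (dual_vector f i) top_form)"
      by (rule alt_form_wedge_vec[OF dual_vector_support[OF f i] alt_form_top])
    moreover have "\<not> (J \<subseteq> {1..n} \<and> card J = Suc n)" for J using card_mono[of "{1..n}" J] by auto
    ultimately show "wedge_vec (dual_vector f i) top_form = (\<lambda>_. 0)" by (auto simp: alt_form_def fun_eq_iff)
  qed
  then have "top_form {1..n} = 0" by simp
  then show False by (simp add: top_form_def)
qed

definition flag_cycle :: "(nat \<Rightarrow> nat set) \<Rightarrow> cochain" where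
  "flag_cycle f m = (if m = descent_mono f then flag_form f else (\<lambda>_. 0))"

lemma card_descents_le: "is_flag f \<Longrightarrow> card (descents f) \<le> r - 1"
  using card_mono[OF _ descents_subset[of f]] card_flag_sets[of f] by (simp add: flag_sets_def)

lemma decreasing_iff_card: "is_flag f \<Longrightarrow> decreasing f \<longleftrightarrow> card (descents f) = r - 1"
  unfolding decreasing_def using card_subset_eq[OF _ descents_subset[of f]] card_flag_sets[of f]
  by (auto simp: flag_sets_def)

lemma kterm_flag_cycle:
  assumes "decreasing f"
  shows "kterm (n - r) (int r - 1) (flag_cycle f)"
proof -
  have f: "is_flag f" using assms by (simp add: decreasing_def)
  have "contract_set {1..n} (flag_form f) = (\<lambda>_. 0)"
    using contract_set_flag_form[of r f] flag_top[OF f order_refl] rank_pos by simp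
  moreover have "int (mdeg (descent_mono f)) = int r - 1"
    using assms decreasing_iff_card[OF f] rank_pos by (simp add: mdeg_descent_mono)
  ultimately show ?thesis
    using alt_form_flag_form[OF f] at_flag_chain[OF f at_flag_descent_mono]
    unfolding kterm_def flag_cycle_def by (auto simp: alt_form_def)
qed

text \<open>For a decreasing flag the support of \<open>descent_mono f\<close> is a maximal chain.
  If its product with the variable of \<open>F\<close> is still a chain monomial, then
  \<open>F\<close> is a member of the flag, and contraction with \<open>F\<close> kills
  \<open>flag_form f\<close>.\<close>

lemma kd_flag_cycle:
  assumes dec: "decreasing f"
  shows "kd (flag_cycle f) m J = 0"
proof (cases "chain_mono m")
  case True
  have f: "is_flag f" using dec by (simp add: decreasing_def)
  have "contract_set F (flag_cycle f (m - var_mono F)) = (\<lambda>_. 0)" if F: "F \<in> keys m" for F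
  proof (cases "m - var_mono F = descent_mono f")
    case eq: True
    then have sub: "flag_sets f \<subseteq> keys m"
      using keys_diff_var_subset[of m F] dec by (simp add: keys_descent_mono decreasing_def)
    have ch: "is_chain (keys m)" using True by (simp add: chain_mono_def)
    note g = least_flag(1,2)[OF ch]
    have "card (keys m) \<le> card (flag_sets f)"
      using card_mono[OF _ g(2)] card_flag_sets[OF g(1)] card_flag_sets[OF f] by (simp add: flag_sets_def)
    then have "flag_sets f = keys m" using sub by (intro card_seteq) auto
    then have "F \<in> flag_sets f" using F by simp
    then obtain k where "k \<in> {1..<r}" "F = f k" by (auto simp: flag_sets_def)
    then show ?thesis using contract_set_flag_form[of k f] eq by (simp add: flag_cycle_def)
  qed (simp add: flag_cycle_def)
  then show ?thesis by (simp add: kd_def)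
qed (simp add: kd_def)

lemma finite_decreasing: "finite {f. decreasing f}"
  by (rule finite_subset[OF _ finite_flags]) (auto simp: decreasing_def)

text \<open>At most one flag sits at level \<open>j\<close>. After reduction only its generator
  could still carry a form, which is excluded by exterior degree or by the bound
  \<open>r - 1\<close> on the number of descents. The cycle condition is asked at level
  \<open>j\<close> alone, so that the independence argument can apply this to cochains that are not
  cycles.\<close>

lemma reduce_level:
  assumes w: "kterm t s w" and fil: "fil j w"
    and cyc: "\<And>f m J. is_flag f \<Longrightarrow> weight f = j \<Longrightarrow> at_flag f m \<Longrightarrow> kd w m J = 0"
    and van: "n - r < t \<or> int r - 1 < s"
  obtains v where "kterm (Suc t) (s - 1) v" "fil (Suc j) (residual w v)"
proof (cases "\<exists>f. is_flag f \<and> weight f = j")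
  case False
  then have "fil (Suc j) w" using fil_Suc[OF fil w] by blast
  then show ?thesis using that[of "\<lambda>_ _. 0"] by (simp add: kterm_zero kd_zero)
next
  case True
  then obtain f where f: "is_flag f" "weight f = j" by blast
  have cyc': "kd w m J = 0" if "at_flag f m" for m J using cyc f that by blast
  have fil': "fil (weight f) w" using fil f by simp
  obtain v where v: "kterm (Suc t) (s - 1) v" "fil (weight f) v"
    "\<And>m. at_flag f m \<Longrightarrow> m \<noteq> descent_mono f \<Longrightarrow> residual w v m = (\<lambda>_. 0)"
    "\<And>m k. at_flag f m \<Longrightarrow> k \<in> {1..r} \<Longrightarrow> contract_set (f k) (residual w v m) = (\<lambda>_. 0)"
    by (rule reduce_flag[OF f(1) w fil' cyc']) blast+
  let ?w = "residual w v"
  have k: "kterm t s ?w" using w v by (auto intro: kterm_diff kterm_kd)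
  have "?w (descent_mono f) = (\<lambda>_. 0)"
    using van
  proof
    assume "n - r < t"
    then show ?thesis
      using form_kernel_zero[OF f(1) _ v(4)[OF at_flag_descent_mono]] k unfolding kterm_def by blast
  next
    assume "int r - 1 < s"
    then have "int (mdeg (descent_mono f)) \<noteq> s"
      using card_descents_le[OF f(1)] rank_pos by (simp add: mdeg_descent_mono)
    then show ?thesis using k unfolding kterm_def by blast
  qed
  then have "?w m = (\<lambda>_. 0)" if "at_flag f m" for m using v(3)[OF that] by blast
  moreover have "fil j ?w" using fil v f by (auto intro: fil_diff fil_kd)
  ultimately have "fil (Suc j) ?w" using fil_Suc[OF _ k, of j] weight_inj[OF f(1)] f(2) by metis
  then show ?thesis using that v by blast
qed

text \<open>Each level is cleared by one more correction, and \<open>Suc n ^ r\<close> exceeds every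
  weight, so the climb ends with a zero residual.\<close>

lemma kterm_boundary:
  assumes w: "kterm t s w" and cyc: "kd w = (\<lambda>_ _. 0)" and van: "n - r < t \<or> int r - 1 < s"
  obtains v where "kterm (Suc t) (s - 1) v" "w = kd v"
proof -
  have "\<exists>v. kterm (Suc t) (s - 1) v \<and> fil j (residual w v)" for j
  proof (induction j)
    case 0
    show ?case using kterm_zero by (intro exI[of _ "\<lambda>_ _. 0"]) (simp add: fil_def)
  next
    case (Suc j)
    then obtain v where v: "kterm (Suc t) (s - 1) v" "fil j (residual w v)" by blast
    let ?w = "residual w v"
    have k: "kterm t s ?w" using w v by (auto intro: kterm_diff kterm_kd)
    have c: "kd ?w m J = 0" for m J using cyc by (simp add: kd_diff kd_kd)
    obtain u where u: "kterm (Suc t) (s - 1) u" "fil (Suc j) (residual ?w u)"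
      by (rule reduce_level[OF k v(2) c van])
    have "residual ?w u = (\<lambda>m J. w m J - kd (\<lambda>m J. v m J + u m J) m J)"
      by (simp add: kd_add diff_diff_eq)
    then show ?case using u kterm_add[OF v(1) u(1)] by (intro exI[of _ "\<lambda>m J. v m J + u m J"]) simp
  qed
  then obtain v where v: "kterm (Suc t) (s - 1) v" "fil (Suc n ^ r) (residual w v)" by blast
  have "residual w v = (\<lambda>_ _. 0)"
    by (rule fil_top[OF v(2)]) (use w v in \<open>auto intro: kterm_diff kterm_kd\<close>)
  then have "w = kd v" by (simp add: fun_eq_iff)
  then show ?thesis using that v by blast
qed

text \<open>The same climb, except that at a decreasing flag the form left on the generator is a
  multiple of \<open>flag_form f\<close>, and this multiple is moved into the coefficient of the
  flag. At every other flag the generator has the wrong degree.\<close>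

lemma flag_cycles_span:
  assumes w: "kterm (n - r) (int r - 1) w" and cyc: "kd w = (\<lambda>_ _. 0)"
  obtains v c where "kterm (Suc (n - r)) (int r - 2) v"
    "w = (\<lambda>m J. kd v m J + (\<Sum>f | decreasing f. c f * flag_cycle f m J))"
proof -
  let ?z = "\<lambda>c m J. \<Sum>f | decreasing f. c f * flag_cycle f m J"
  have kz: "kterm (n - r) (int r - 1) (?z c)" for c
    by (intro kterm_sum finite_decreasing kterm_scale kterm_flag_cycle) simp
  have cz: "kd (?z c) m J = 0" for c m J
    by (simp add: kd_sum[OF finite_decreasing] kd_scale kd_flag_cycle)
  have "\<exists>v c. kterm (Suc (n - r)) (int r - 2) v \<and> fil j (\<lambda>m J. w m J - kd v m J - ?z c m J)" for j
  proof (induction j)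
    case 0
    show ?case using kterm_zero by (intro exI[of _ "\<lambda>_ _. 0"] exI) (simp add: fil_def)
  next
    case (Suc j)
    then obtain v c where v: "kterm (Suc (n - r)) (int r - 2) v"
      and fil: "fil j (\<lambda>m J. w m J - kd v m J - ?z c m J)" by blast
    let ?w = "\<lambda>m J. w m J - kd v m J - ?z c m J"
    have k: "kterm (n - r) (int r - 1) ?w"
      by (rule kterm_diff[OF kterm_diff[OF w kterm_kd] kz]) (use v in simp)
    have cy: "kd ?w m J = 0" for m J using cyc by (simp add: kd_diff kd_kd cz)
    show ?case
    proof (cases "\<exists>f. is_flag f \<and> weight f = j")
      case False
      then have "fil (Suc j) ?w" using fil_Suc[OF fil k] by blast
      then show ?thesis using v by blast
    next
      case True
      then obtain f where f: "is_flag f" "weight f = j" by blast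
      have fil': "fil (weight f) ?w" using fil f by simp
      obtain u where u: "kterm (Suc (n - r)) (int r - 1 - 1) u" "fil (weight f) u"
        "\<And>m. at_flag f m \<Longrightarrow> m \<noteq> descent_mono f \<Longrightarrow> residual ?w u m = (\<lambda>_. 0)"
        "\<And>m k. at_flag f m \<Longrightarrow> k \<in> {1..r} \<Longrightarrow> contract_set (f k) (residual ?w u m) = (\<lambda>_. 0)"
        by (rule reduce_flag[OF f(1) k fil' cy]) blast+
      let ?w' = "residual ?w u"
      have k': "kterm (n - r) (int r - 1) ?w'" by (rule kterm_diff[OF k kterm_kd[OF u(1)]])
      obtain b where b: "?w' (descent_mono f) = (\<lambda>J. b * flag_form f J)" "\<not> decreasing f \<Longrightarrow> b = 0"
      proof (cases "decreasing f")
        case True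
        have "alt_form n (n - r) (?w' (descent_mono f))" using k' unfolding kterm_def by blast
        then obtain b where "?w' (descent_mono f) = (\<lambda>J. b * flag_form f J)"
          by (rule form_kernel_top[OF f(1) _ u(4)[OF at_flag_descent_mono]])
        then show ?thesis using that True by blast
      next
        case False
        then have "int (mdeg (descent_mono f)) \<noteq> int r - 1"
          using decreasing_iff_card[OF f(1)] rank_pos by (simp add: mdeg_descent_mono)
        then have "?w' (descent_mono f) = (\<lambda>_. 0)" using k' unfolding kterm_def by blast
        then show ?thesis using that[of 0] by simp
      qed
      \<comment> \<open>At a flag that is not decreasing \<open>b\<close> is zero, so the formula
        for the new sum holds in both cases.\<close>
      define c' where "c' = (\<lambda>g. c g + (if g = f then b else 0))"
      have "?z c' m J = ?z c m J + (\<Sum>g | decreasing g. if g = f then b * flag_cycle f m J else 0)" for m J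
        unfolding sum.distrib[symmetric] c'_def by (intro sum.cong) (auto simp: algebra_simps)
      then have zc: "?z c' m J = ?z c m J + b * flag_cycle f m J" for m J
        using b(2) finite_decreasing by (cases "decreasing f") simp_all
      have eq: "(\<lambda>m J. w m J - kd (\<lambda>m J. v m J + u m J) m J - ?z c' m J) = (\<lambda>m J. ?w' m J - b * flag_cycle f m J)"
        unfolding zc kd_add by (simp add: algebra_simps)
      have k2: "kterm (n - r) (int r - 1) (\<lambda>m J. ?w' m J - b * flag_cycle f m J)"
        using k' b(2) kterm_diff[OF k' kterm_scale[OF kterm_flag_cycle]] by (cases "decreasing f") auto
      have zero: "(\<lambda>J. ?w' m J - b * flag_cycle f m J) = (\<lambda>_. 0)" if m: "at_flag f m" for m
      proof (cases "m = descent_mono f")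
        case True
        then show ?thesis using b(1) by (simp add: flag_cycle_def fun_eq_iff)
      next
        case False
        then show ?thesis using u(3)[OF m False] by (simp add: flag_cycle_def fun_eq_iff)
      qed
      have fil2: "fil j (\<lambda>m J. ?w' m J - b * flag_cycle f m J)"
      proof (rule fil_diff)
        show "fil j ?w'" using fil u f by (auto intro: fil_diff fil_kd)
        \<comment> \<open>The flag cycle is supported at level \<open>j\<close> exactly, so
          subtracting it does not disturb the levels already cleared.\<close>
        have "flag_cycle f m = (\<lambda>_. 0)" if "level m < j" for m
          using that at_flag_level[OF f(1), of m] at_flag_descent_mono[of f] f(2) by (auto simp: flag_cycle_def)
        then show "fil j (\<lambda>m J. b * flag_cycle f m J)" by (auto simp: fil_def)
      qed
      have "fil (Suc j) (\<lambda>m J. ?w' m J - b * flag_cycle f m J)"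
      proof (rule fil_Suc[OF fil2 k2])
        fix g m assume "is_flag g" "weight g = j" "at_flag g m"
        moreover from this have "g = f" using weight_inj[OF _ f(1)] f(2) by simp
        ultimately show "(\<lambda>J. ?w' m J - b * flag_cycle f m J) = (\<lambda>_. 0)" using zero by simp
      qed
      then show ?thesis using u(1) kterm_add[OF v, of u] eq
        by (intro exI[of _ "\<lambda>m J. v m J + u m J"] exI[of _ c']) simp
    qed
  qed
  then obtain v c where v: "kterm (Suc (n - r)) (int r - 2) v"
    "fil (Suc n ^ r) (\<lambda>m J. w m J - kd v m J - ?z c m J)" by blast
  have "(\<lambda>m J. w m J - kd v m J - ?z c m J) = (\<lambda>_ _. 0)"
    by (rule fil_top[OF v(2)], rule kterm_diff[OF kterm_diff[OF w kterm_kd] kz]) (use v in simp)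
  then have "w = (\<lambda>m J. kd v m J + ?z c m J)" by (simp add: fun_eq_iff algebra_simps)
  then show ?thesis using that v by blast
qed

text \<open>The preimage \<open>w\<close> is pushed to higher and higher levels without changing
  \<open>kd w\<close>. When it has passed the level of a decreasing flag \<open>f\<close>, the
  differential vanishes at \<open>descent_mono f\<close>, where the right-hand side is
  \<open>c f\<close> times the nonzero form \<open>flag_form f\<close>.\<close>

lemma flag_cycles_independent:
  assumes w: "kterm (Suc (n - r)) (int r - 2) w"
    and eq: "kd w = (\<lambda>m J. \<Sum>f | decreasing f. c f * flag_cycle f m J)" and g: "decreasing g"
  shows "c g = 0"
proof -
  have "\<exists>w. kterm (Suc (n - r)) (int r - 2) w \<and> fil j w \<and>
      kd w = (\<lambda>m J. \<Sum>f | decreasing f. c f * flag_cycle f m J) \<and> (\<forall>f. decreasing f \<and> weight f < j \<longrightarrow> c f = 0)" for j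
  proof (induction j)
    case 0
    show ?case using w eq by (intro exI[of _ w]) (simp add: fil_def)
  next
    case (Suc j)
    then obtain w where w: "kterm (Suc (n - r)) (int r - 2) w" "fil j w"
      and eq: "kd w = (\<lambda>m J. \<Sum>f | decreasing f. c f * flag_cycle f m J)"
      and c: "\<And>f. decreasing f \<Longrightarrow> weight f < j \<Longrightarrow> c f = 0" by blast
    have other: "flag_cycle h m J = 0" if "is_flag f" "is_flag h" "at_flag f m" "h \<noteq> f" for f h m J
      using that at_flag_iff[of f m] at_flag_iff[of h m] at_flag_descent_mono[of h] by (auto simp: flag_cycle_def)
    show ?case
    proof (cases "\<exists>f. decreasing f \<and> weight f = j")
      case False
      have cyc: "kd w m J = 0" if f: "is_flag f" "weight f = j" and m: "at_flag f m" for f m J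
        unfolding eq
      proof (rule sum.neutral, clarify)
        fix h assume h: "decreasing h"
        then have "h \<noteq> f" "is_flag h" using False f by (auto simp: decreasing_def)
        then show "c h * flag_cycle h m J = 0" using other[OF f(1) _ m] by simp
      qed
      \<comment> \<open>The exterior degree \<open>Suc (n - r)\<close> lies in the vanishing range,
        and subtracting a boundary leaves \<open>kd w\<close> unchanged.\<close>
      obtain v where v: "kterm (Suc (Suc (n - r))) (int r - 2 - 1) v" "fil (Suc j) (residual w v)"
        by (rule reduce_level[OF w cyc]) auto
      have "kd (residual w v) = kd w" by (intro ext) (simp add: kd_diff kd_kd)
      moreover have "c f = 0" if "decreasing f" "weight f < Suc j" for f
        using c[of f] False that less_Suc_eq by blast
      ultimately show ?thesis
        using kterm_diff[OF w(1) kterm_kd[OF v(1)]] v(2) eq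
        by (intro exI[of _ "residual w v"]) auto
    next
      case True
      then obtain f where dec: "decreasing f" and wt: "weight f = j" by blast
      have f: "is_flag f" using dec by (simp add: decreasing_def)
      \<comment> \<open>Monomials at \<open>f\<close> are divisible by all \<open>r - 1\<close>
        descents, whereas \<open>w\<close> lives in degree \<open>r - 2\<close>.\<close>
      have w0: "w m = (\<lambda>_. 0)" if m: "at_flag f m" for m
      proof -
        have "descents f \<subseteq> keys m" using m by (simp add: at_flag_def)
        then have "card (descents f) \<le> card (keys m)" by (intro card_mono) auto
        also have "\<dots> = (\<Sum>F\<in>keys m. 1)" by simp
        also have "\<dots> \<le> mdeg m" unfolding mdeg_def by (intro sum_mono) (simp add: in_keys_iff)
        finally have "int (mdeg m) \<noteq> int r - 2" using decreasing_iff_card[OF f] dec rank_pos by simp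
        then show ?thesis using w(1) unfolding kterm_def by blast
      qed
      have fil: "fil (Suc j) w" using fil_Suc[OF w(2,1)] w0 weight_inj[OF f] wt by metis
      have "c f * flag_form f J = 0" for J
      proof -
        let ?m = "descent_mono f"
        have ch: "chain_mono ?m" by (rule at_flag_chain[OF f at_flag_descent_mono])
        have "level ?m = j" using at_flag_level[OF f, of ?m] at_flag_descent_mono wt by blast
        then have "w (?m - var_mono F) = (\<lambda>_. 0)" for F
          using fil chain_mono_diff[OF ch] level_mono[OF ch keys_diff_var_subset, of F] by (simp add: fil_def less_Suc_eq_le)
        then have "0 = kd w ?m J" by (simp add: kd_def)
        also have "\<dots> = (\<Sum>h | decreasing h. if h = f then c f * flag_cycle f ?m J else 0)"
          unfolding eq using other[OF f _ at_flag_descent_mono] by (intro sum.cong) (auto simp: decreasing_def)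
        also have "\<dots> = c f * flag_form f J" using finite_decreasing dec by (simp add: flag_cycle_def)
        finally show ?thesis by simp
      qed
      then have "c f = 0" using flag_form_nonzero[OF f] by (auto simp: fun_eq_iff)
      then have "c h = 0" if "decreasing h" "weight h < Suc j" for h
      proof (cases "h = f")
        case False
        then have "weight h \<noteq> j" using weight_inj[OF f, of h] that wt by (auto simp: decreasing_def)
        then show ?thesis using c[of h] that by simp
      qed (simp add: \<open>c f = 0\<close>)
      then show ?thesis using w(1) fil eq by blast
    qed
  qed
  from this[of "Suc (weight g)"] show ?thesis using g by blast
qed

end


section \<open>The Stanley--Reisner ring\<close>

lemma poly_mapping_eq_sum: "p = (\<Sum>k\<in>keys p. Poly_Mapping.single k (lookup p k))"
  by (rule poly_mapping_eqI) (simp add: lookup_sum lookup_single when_def in_keys_iff)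

lemma lookup_single_mult:
  fixes p :: "flat_mono \<Rightarrow>\<^sub>0 complex"
  shows "lookup (Poly_Mapping.single a c * p) m =
    (\<Sum>k\<in>keys p. if a + k = m then c * lookup p k else 0)"
proof -
  have "Poly_Mapping.single a c * p =
      (\<Sum>k\<in>keys p. Poly_Mapping.single (a + k) (c * lookup p k))"
    by (subst (1) poly_mapping_eq_sum[of p]) (simp add: sum_distrib_left mult_single)
  then show ?thesis by (simp add: lookup_sum lookup_single when_def)
qed

lemma lookup_Const_mult: "lookup (Const c * p) m = c * lookup (p :: flat_mono \<Rightarrow>\<^sub>0 complex) m"
  by (simp add: Const_def lookup_single_mult in_keys_iff)

lemma Var_eq: "Var F = Poly_Mapping.single (var_mono F) 1"
  by (simp add: Var_def var_mono_def)

lemma lookup_Var_mult: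
  "lookup (Var F * p) m =
    (if F \<in> keys m then lookup p (m - var_mono F) else 0)"
proof -
  have iff: "var_mono F + k = m \<longleftrightarrow> F \<in> keys m \<and> k = m - var_mono F" for k
    using keys_add_var[of k F] add_diff_var[of k F] diff_add_var[of F m] by (auto simp: add.commute)
  show ?thesis
    unfolding Var_eq lookup_single_mult iff
    by (cases "F \<in> keys m") (simp_all add: in_keys_iff)
qed

context loopless_matroid
begin

section \<open>Polynomials in the variables of the proper flats\<close>

abbreviation (input) PR :: "nat set mpoly \<Rightarrow> bool" where "PR p \<equiv> p \<in> carrier (mpoly_ring (proper_flats n Bs))"

lemma PR_iff: "PR p \<longleftrightarrow> (\<forall>m\<in>keys p. keys m \<subseteq> proper_flats n Bs)"
  by (simp add: mpoly_ring_def)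

lemma mpoly_ring_ops:
  "a \<oplus>\<^bsub>mpoly_ring E\<^esub> b = a + b" "a \<otimes>\<^bsub>mpoly_ring E\<^esub> b = a * b" "\<zero>\<^bsub>mpoly_ring E\<^esub> = 0"
  by (simp_all add: mpoly_ring_def ring_of_type_algebra_def)

lemma PR_add: "PR a \<Longrightarrow> PR b \<Longrightarrow> PR (a + b)"
  and PR_mult: "PR a \<Longrightarrow> PR b \<Longrightarrow> PR (a * b)"
  and PR_zero: "PR 0"
proof -
  interpret P: cring "mpoly_ring (proper_flats n Bs)" by (rule mpoly_ring_cring)
  show "PR a \<Longrightarrow> PR b \<Longrightarrow> PR (a + b)" "PR a \<Longrightarrow> PR b \<Longrightarrow> PR (a * b)" "PR 0"
    using P.a_closed[of a b] P.m_closed[of a b] P.zero_closed by (simp_all add: mpoly_ring_ops)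
qed

lemma PR_uminus: "PR a \<Longrightarrow> PR (- a)"
  by (simp add: PR_iff)

lemma PR_single: "keys m \<subseteq> proper_flats n Bs \<Longrightarrow> PR (Poly_Mapping.single m c)"
  by (simp add: PR_iff)

lemma PR_sum: "finite A \<Longrightarrow> (\<And>x. x \<in> A \<Longrightarrow> PR (g x)) \<Longrightarrow> PR (sum g A)"
  by (induction A rule: finite_induct) (simp_all add: PR_zero PR_add)

lemma keys_var_mono: "keys (var_mono F) = {F}"
  by (simp add: var_mono_def)

lemma PR_Var: "F \<in> proper_flats n Bs \<Longrightarrow> PR (Var F)"
  unfolding Var_eq by (rule PR_single) (simp add: keys_var_mono)

lemma PR_Const: "PR (Const c)"
  unfolding Const_def by (rule PR_single) simp

lemma ideal_sr_ideal: "ideal (sr_ideal n Bs) (mpoly_ring (proper_flats n Bs))"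
proof -
  interpret P: cring "mpoly_ring (proper_flats n Bs)" by (rule mpoly_ring_cring)
  show ?thesis unfolding sr_ideal_def
    by (rule P.genideal_ideal) (auto intro: PR_mult PR_Var)
qed

lemma keys_add_mono: "keys (m + k) = keys m \<union> keys (k :: flat_mono)"
  by (auto simp: in_keys_iff lookup_add)

text \<open>Divisors of chain monomials are chain monomials, so the right-hand side is an ideal
  containing the generators. Conversely, a monomial in proper flats that is not a chain monomial is
  divisible by the product of two incomparable flats.\<close>

lemma sr_ideal_eq: "sr_ideal n Bs = {p. PR p \<and> (\<forall>m\<in>keys p. \<not> chain_mono m)}"
proof
  interpret P: cring "mpoly_ring (proper_flats n Bs)" by (rule mpoly_ring_cring)
  interpret I: ideal "sr_ideal n Bs" "mpoly_ring (proper_flats n Bs)" by (rule ideal_sr_ideal)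
  let ?N = "{p. PR p \<and> (\<forall>m\<in>keys p. \<not> chain_mono m)}"
  have chain: "chain_mono k" if "chain_mono (l + k)" for l k
    using that is_chain_mono unfolding chain_mono_def keys_add_mono by blast
  have mult: "x * a \<in> ?N" if "a \<in> ?N" "PR x" for a x
  proof -
    have "\<not> chain_mono m" if m: "m \<in> keys (x * a)" for m
    proof -
      obtain u v where "v \<in> keys a" "m = u + v" using subsetD[OF keys_mult m] by blast
      then show ?thesis using \<open>a \<in> ?N\<close> chain by blast
    qed
    then show ?thesis using PR_mult that by simp
  qed
  have "ideal ?N (mpoly_ring (proper_flats n Bs))"
  proof (rule idealI)
    show "ring (mpoly_ring (proper_flats n Bs))" by (rule P.ring_axioms)
    show "subgroup ?N (add_monoid (mpoly_ring (proper_flats n Bs)))"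
    proof (rule P.add.subgroupI)
      show "?N \<noteq> {}" using PR_zero by force
      fix a assume a: "a \<in> ?N"
      have "\<ominus>\<^bsub>mpoly_ring (proper_flats n Bs)\<^esub> a = - a"
        using a PR_uminus by (intro P.minus_equality) (simp_all add: mpoly_ring_ops)
      then show "\<ominus>\<^bsub>mpoly_ring (proper_flats n Bs)\<^esub> a \<in> ?N" using a PR_uminus by simp
      fix b assume b: "b \<in> ?N"
      show "a \<oplus>\<^bsub>mpoly_ring (proper_flats n Bs)\<^esub> b \<in> ?N"
        using a b PR_add Poly_Mapping.keys_add[of a b] by (auto simp: mpoly_ring_ops)
    qed auto
  qed (use mult in \<open>simp_all add: mpoly_ring_ops mult.commute\<close>)
  moreover have "{Var F * Var G | F G. F \<in> proper_flats n Bs \<and> G \<in> proper_flats n Bs \<and> \<not> F \<subseteq> G \<and> \<not> G \<subseteq> F} \<subseteq> ?N"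
  proof
    fix p assume "p \<in> {Var F * Var G | F G. F \<in> proper_flats n Bs \<and> G \<in> proper_flats n Bs \<and> \<not> F \<subseteq> G \<and> \<not> G \<subseteq> F}"
    then obtain F G where p: "p = Var F * Var G" and
      "F \<in> proper_flats n Bs" "G \<in> proper_flats n Bs" "\<not> F \<subseteq> G" "\<not> G \<subseteq> F" by blast
    moreover from this have "\<not> chain_mono (var_mono F + var_mono G)"
      by (auto simp: chain_mono_def keys_add_mono keys_var_mono is_chain_def)
    ultimately show "p \<in> ?N" unfolding p
      using PR_mult[OF PR_Var[of F] PR_Var[of G]] by (simp add: Var_eq mult_single)
  qed
  ultimately show "sr_ideal n Bs \<subseteq> ?N" unfolding sr_ideal_def by (rule P.genideal_minimal)
  show "?N \<subseteq> sr_ideal n Bs"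
  proof
    fix p assume p: "p \<in> ?N"
    have "Poly_Mapping.single m c \<in> sr_ideal n Bs" if "m \<in> keys p" for m c
    proof -
      have m: "keys m \<subseteq> proper_flats n Bs" "\<not> chain_mono m" using p that by (auto simp: PR_iff)
      then obtain F G where FG: "F \<in> keys m" "G \<in> keys m" "\<not> F \<subseteq> G" "\<not> G \<subseteq> F"
        by (auto simp: chain_mono_def is_chain_def)
      let ?k = "m - var_mono F - var_mono G"
      have "G \<in> keys (m - var_mono F)"
        using FG by (auto simp: lookup_pos_of_keys_diff)
      then have "?k + (var_mono G + var_mono F) = m"
        using diff_add_var[of G "m - var_mono F"] diff_add_var[OF FG(1)] by (simp add: add.assoc[symmetric])
      then have eq: "Poly_Mapping.single m c = Poly_Mapping.single ?k c * (Var F * Var G)"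
        by (simp add: Var_eq mult_single add.commute)
      have "Var F * Var G \<in> sr_ideal n Bs"
        unfolding sr_ideal_def
        by (rule subsetD[OF P.genideal_self]) (use FG m in \<open>auto intro: PR_mult PR_Var\<close>)
      moreover have "PR (Poly_Mapping.single ?k c)"
        using m keys_diff_var_subset by (intro PR_single) blast
      ultimately show ?thesis unfolding eq using I.I_l_closed by (simp add: mpoly_ring_ops)
    qed
    moreover have "(\<Sum>m\<in>A. g m) \<in> sr_ideal n Bs" if "finite A" "\<And>m. m \<in> A \<Longrightarrow> g m \<in> sr_ideal n Bs"
      for A and g :: "flat_mono \<Rightarrow> nat set mpoly"
      using that
    proof (induction A rule: finite_induct)
      case empty then show ?case using additive_subgroup.zero_closed[OF I.is_additive_subgroup] by (simp add: mpoly_ring_ops)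
    next
      case (insert m A) then show ?case using additive_subgroup.a_closed[OF I.is_additive_subgroup, of "g m" "sum g A"] by (simp add: mpoly_ring_ops)
    qed
    ultimately show "p \<in> sr_ideal n Bs" by (subst poly_mapping_eq_sum) simp
  qed
qed

section \<open>Coordinates with respect to chain monomials\<close>

abbreviation (input) cls :: "nat set mpoly \<Rightarrow> nat set mpoly set" where "cls \<equiv> sr_class n Bs"

lemma sr_class_iff: "q \<in> cls p \<longleftrightarrow> (\<exists>i\<in>sr_ideal n Bs. q = i + p)"
  unfolding sr_class_def a_r_coset_def' by (auto simp: mpoly_ring_ops)

text \<open>Representatives of a class differ by elements of the ideal, which contain no chain
  monomials; the choice made by \<open>SOME\<close> therefore does not affect the value.\<close>

definition coef :: "nat set mpoly set \<Rightarrow> flat_mono \<Rightarrow> complex" where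
  "coef Q m = (if chain_mono m then lookup (SOME p. p \<in> Q) m else 0)"

lemma coef_class: "coef (cls p) m = (if chain_mono m then lookup p m else 0)"
proof -
  have "0 \<in> sr_ideal n Bs" using PR_zero by (simp add: sr_ideal_eq)
  then have "p \<in> cls p" by (auto simp: sr_class_iff)
  then have "(SOME q. q \<in> cls p) \<in> cls p" by (rule someI)
  then obtain i where i: "i \<in> sr_ideal n Bs" "(SOME q. q \<in> cls p) = i + p" by (auto simp: sr_class_iff)
  show ?thesis
    using i by (auto simp: coef_def lookup_add sr_ideal_eq in_keys_iff)
qed

lemma sr_class_eqI:
  assumes p: "PR p" "PR q" and eq: "\<And>m. chain_mono m \<Longrightarrow> lookup p m = lookup q m"
  shows "cls p = cls q"
proof -
  interpret I: ideal "sr_ideal n Bs" "mpoly_ring (proper_flats n Bs)" by (rule ideal_sr_ideal)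
  have sub: "cls p \<subseteq> cls q" if PR: "PR p" "PR q"
    and look: "\<And>m. chain_mono m \<Longrightarrow> lookup p m = lookup q m" for p q
  proof
    fix a assume "a \<in> cls p"
    then obtain i where i: "i \<in> sr_ideal n Bs" "a = i + p" by (auto simp: sr_class_iff)
    have "PR (p - q)" unfolding diff_conv_add_uminus by (rule PR_add[OF PR(1) PR_uminus[OF PR(2)]])
    moreover have "\<not> chain_mono m" if m: "m \<in> keys (p - q)" for m
    proof
      assume "chain_mono m"
      from look[OF this] have "lookup (p - q) m = 0" by (simp add: lookup_minus)
      with m show False by (simp add: in_keys_iff)
    qed
    ultimately have "p - q \<in> sr_ideal n Bs" unfolding sr_ideal_eq by blast
    then have "i + (p - q) \<in> sr_ideal n Bs" using additive_subgroup.a_closed[OF I.is_additive_subgroup i(1)] by (simp add: mpoly_ring_ops)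
    then show "a \<in> cls q" using i by (auto simp: sr_class_iff intro!: bexI[of _ "i + (p - q)"])
  qed
  show ?thesis by (rule antisym) (rule sub[OF p eq] sub[OF p(2,1) eq[symmetric]]; assumption)+
qed

abbreviation (input) SA :: "(complex, nat set mpoly set) module" where "SA \<equiv> sr_algebra n Bs"

lemma SA_carrier: "Q \<in> carrier SA \<longleftrightarrow> (\<exists>p. PR p \<and> Q = cls p)"
  by (auto simp: sr_algebra_def ring.defs module.defs sr_ring_def FactRing_def A_RCOSETS_def' sr_class_def)

lemma SA_ops:
  shows "PR p \<Longrightarrow> PR q \<Longrightarrow> cls p \<oplus>\<^bsub>SA\<^esub> cls q = cls (p + q)"
    and "PR p \<Longrightarrow> PR q \<Longrightarrow> cls p \<otimes>\<^bsub>SA\<^esub> cls q = cls (p * q)"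
    and "PR p \<Longrightarrow> c \<odot>\<^bsub>SA\<^esub> cls p = cls (Const c * p)"
    and "\<zero>\<^bsub>SA\<^esub> = cls 0"
proof -
  interpret P: cring "mpoly_ring (proper_flats n Bs)" by (rule mpoly_ring_cring)
  interpret I: ideal "sr_ideal n Bs" "mpoly_ring (proper_flats n Bs)" by (rule ideal_sr_ideal)
  note h = I.rcos_ring_hom
  show "PR p \<Longrightarrow> PR q \<Longrightarrow> cls p \<oplus>\<^bsub>SA\<^esub> cls q = cls (p + q)"
    using ring_hom_add[OF h, of p q] by (simp add: sr_algebra_def ring.defs module.defs sr_ring_def sr_class_def mpoly_ring_ops)
  have mult: "cls p \<otimes>\<^bsub>sr_ring n Bs\<^esub> cls q = cls (p * q)" if "PR p" "PR q" for p q
    using ring_hom_mult[OF h, of p q] that by (simp add: sr_ring_def sr_class_def mpoly_ring_ops)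
  show "PR p \<Longrightarrow> PR q \<Longrightarrow> cls p \<otimes>\<^bsub>SA\<^esub> cls q = cls (p * q)"
    using mult by (simp add: sr_algebra_def ring.defs module.defs)
  show "PR p \<Longrightarrow> c \<odot>\<^bsub>SA\<^esub> cls p = cls (Const c * p)"
    using mult[OF PR_Const] by (simp add: sr_algebra_def ring.defs module.defs)
  have "cls 0 = sr_ideal n Bs" by (auto simp: sr_class_iff)
  then show "\<zero>\<^bsub>SA\<^esub> = cls 0" by (simp add: sr_algebra_def ring.defs module.defs sr_ring_def FactRing_def)
qed

lemma coef_add: "Q \<in> carrier SA \<Longrightarrow> Q' \<in> carrier SA \<Longrightarrow> coef (Q \<oplus>\<^bsub>SA\<^esub> Q') m = coef Q m + coef Q' m"
  by (auto simp: SA_carrier SA_ops coef_class lookup_add)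

lemma coef_smult: "Q \<in> carrier SA \<Longrightarrow> coef (c \<odot>\<^bsub>SA\<^esub> Q) m = c * coef Q m"
  by (auto simp: SA_carrier SA_ops coef_class lookup_Const_mult)

lemma coef_zero: "coef \<zero>\<^bsub>SA\<^esub> m = 0"
  by (simp add: SA_ops coef_class)

lemma coef_inj:
  assumes "Q \<in> carrier SA" "Q' \<in> carrier SA" and eq: "coef Q = coef Q'"
  shows "Q = Q'"
proof -
  obtain p q where pq: "PR p" "Q = cls p" "PR q" "Q' = cls q" using assms by (auto simp: SA_carrier)
  have "lookup p m = lookup q m" if "chain_mono m" for m
    using fun_cong[OF eq, of m] that pq by (simp add: coef_class)
  then show ?thesis using sr_class_eqI[OF pq(1,3)] pq(2,4) by simp
qed

lemma sr_var_eq: "sr_var n Bs i = cls (\<Sum>F | F \<in> proper_flats n Bs \<and> i \<in> F. Var F)"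
  by (simp add: sr_var_def)

lemma finite_flats_containing: "finite {F. F \<in> proper_flats n Bs \<and> i \<in> F}"
  using finite_proper_flats by simp

lemma PR_sum_Var: "PR (\<Sum>F | F \<in> proper_flats n Bs \<and> i \<in> F. Var F)"
  by (intro PR_sum finite_flats_containing) (auto intro: PR_Var)

lemma sr_var_closed: "sr_var n Bs i \<in> carrier SA"
  unfolding sr_var_eq SA_carrier using PR_sum_Var by blast

lemma coef_sr_var_mult:
  assumes "Q \<in> carrier SA"
  shows "coef (sr_var n Bs i \<otimes>\<^bsub>SA\<^esub> Q) m = (if chain_mono m then
    \<Sum>F\<in>keys m. if i \<in> F then coef Q (m - var_mono F) else 0 else 0)"
proof (cases "chain_mono m")
  case True
  obtain p where p: "PR p" "Q = cls p" using assms by (auto simp: SA_carrier)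
  have sub: "keys m \<subseteq> proper_flats n Bs" using True by (simp add: chain_mono_def is_chain_def)
  have "coef (sr_var n Bs i \<otimes>\<^bsub>SA\<^esub> Q) m = lookup ((\<Sum>F | F \<in> proper_flats n Bs \<and> i \<in> F. Var F) * p) m"
    using True p by (simp add: sr_var_eq SA_ops PR_sum_Var coef_class)
  also have "\<dots> = (\<Sum>F | F \<in> proper_flats n Bs \<and> i \<in> F.
      if F \<in> keys m then lookup p (m - var_mono F) else 0)"
    by (simp add: sum_distrib_right lookup_sum lookup_Var_mult)
  also have "\<dots> = (\<Sum>F\<in>keys m. if i \<in> F then lookup p (m - var_mono F) else 0)"
    by (rule sum.mono_neutral_cong) (use sub finite_flats_containing in auto)
  also have "\<dots> = (\<Sum>F\<in>keys m. if i \<in> F then coef Q (m - var_mono F) else 0)"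
    using chain_mono_diff[OF True] p by (intro sum.cong) (simp_all add: coef_class)
  finally show ?thesis using True by simp
qed (simp add: coef_def)

lemma coef_nonchain: "\<not> chain_mono m \<Longrightarrow> coef Q m = 0"
  by (simp add: coef_def)

lemma finite_chain_monos: "finite {m. chain_mono m \<and> mdeg m = s}"
proof (induction s)
  case 0
  have "m = 0" if "mdeg m = 0" for m
    using that by (intro poly_mapping_eqI) (auto simp: mdeg_def in_keys_iff)
  then have "{m. chain_mono m \<and> mdeg m = 0} \<subseteq> {0}" by auto
  then show ?case by (rule finite_subset) simp
next
  case (Suc s)
  have "{m. chain_mono m \<and> mdeg m = Suc s} \<subseteq>
      (\<lambda>(m, F). m + var_mono F) ` ({m. chain_mono m \<and> mdeg m = s} \<times> proper_flats n Bs)"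
  proof
    fix m assume "m \<in> {m. chain_mono m \<and> mdeg m = Suc s}"
    then have m: "chain_mono m" "mdeg m = Suc s" by auto
    then have "keys m \<noteq> {}" by (auto simp: mdeg_def)
    then obtain F where F: "F \<in> keys m" by blast
    then have "F \<in> proper_flats n Bs" using m by (auto simp: chain_mono_def is_chain_def)
    then show "m \<in> (\<lambda>(m, F). m + var_mono F) ` ({m. chain_mono m \<and> mdeg m = s} \<times> proper_flats n Bs)"
      using m mdeg_diff_var[OF F] diff_add_var[OF F] chain_mono_diff
      by (intro image_eqI[of _ _ "(m - var_mono F, F)"]) auto
  qed
  then show ?case using finite_subset Suc finite_proper_flats by blast
qed

text \<open>There are finitely many chain monomials of each degree, so the family \<open>g\<close>
  is the coefficient family of a polynomial.\<close>

lemma coef_surj: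
  assumes g: "\<And>m. g m \<noteq> 0 \<Longrightarrow> chain_mono m \<and> mdeg m = s"
  obtains Q where "Q \<in> sr_grade n Bs s" "Q \<in> carrier SA" "coef Q = g"
proof -
  let ?A = "{m. chain_mono m \<and> mdeg m = s}"
  define p where "p = (\<Sum>m\<in>?A. Poly_Mapping.single m (g m))"
  have look: "lookup p m = g m" for m
    using finite_chain_monos[of s] g[of m] by (auto simp: p_def lookup_sum lookup_single when_def)
  have "keys m \<subseteq> proper_flats n Bs" if "chain_mono m" for m
    using that by (simp add: chain_mono_def is_chain_def)
  then have p: "PR p" using g by (auto simp: PR_iff in_keys_iff look)
  have "homogeneous s p" using g by (auto simp: homogeneous_def in_keys_iff look mdeg_def)
  then have "cls p \<in> sr_grade n Bs s" using p by (auto simp: sr_grade_def)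
  moreover have "coef (cls p) m = g m" for m using g[of m] by (auto simp: coef_class look)
  moreover have "cls p \<in> carrier SA" using p SA_carrier by blast
  ultimately show ?thesis using that[of "cls p"] by blast
qed

lemma sr_grade_iff: "Q \<in> sr_grade n Bs s \<longleftrightarrow> Q \<in> carrier SA \<and> (\<forall>m. coef Q m \<noteq> 0 \<longrightarrow> mdeg m = s)"
proof
  assume "Q \<in> sr_grade n Bs s"
  then obtain p where "PR p" "homogeneous s p" "Q = cls p" by (auto simp: sr_grade_def)
  then show "Q \<in> carrier SA \<and> (\<forall>m. coef Q m \<noteq> 0 \<longrightarrow> mdeg m = s)"
    by (auto simp: SA_carrier coef_class homogeneous_def mdeg_def in_keys_iff)
next
  assume Q: "Q \<in> carrier SA \<and> (\<forall>m. coef Q m \<noteq> 0 \<longrightarrow> mdeg m = s)"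
  then have "coef Q m \<noteq> 0 \<Longrightarrow> chain_mono m \<and> mdeg m = s" for m using coef_nonchain by blast
  then obtain Q' where "Q' \<in> sr_grade n Bs s" "Q' \<in> carrier SA" "coef Q' = coef Q" using coef_surj by blast
  then show "Q \<in> sr_grade n Bs s" using coef_inj Q by metis
qed

end


section \<open>Transfer of the Koszul complex\<close>

lemma complex_ring_simps:
  "carrier complex_ring = UNIV" "a \<oplus>\<^bsub>complex_ring\<^esub> b = a + b" "a \<otimes>\<^bsub>complex_ring\<^esub> b = a * b"
  "\<zero>\<^bsub>complex_ring\<^esub> = 0" "\<one>\<^bsub>complex_ring\<^esub> = 1"
  by (simp_all add: ring_of_type_algebra_def)

lemma module_chains:
  assumes "module complex_ring A"
  shows "module complex_ring (chains A)"
proof -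
  interpret module complex_ring A by fact
  note sm = smult_l_distr smult_r_distr smult_assoc1 smult_one smult_closed
  show ?thesis
  proof (rule moduleI)
    show "cring complex_ring" by (rule R.is_cring)
    show "abelian_group (chains A)"
    proof (rule abelian_groupI)
      fix u assume u: "u \<in> carrier (chains A)"
      then have "(\<lambda>J. \<ominus>\<^bsub>A\<^esub> u J) \<in> carrier (chains A)" by (auto simp: chains_def)
      moreover have "(\<lambda>J. \<ominus>\<^bsub>A\<^esub> u J) \<oplus>\<^bsub>chains A\<^esub> u = \<zero>\<^bsub>chains A\<^esub>"
        using u by (auto simp: chains_def fun_eq_iff M.l_neg Pi_iff)
      ultimately show "\<exists>v\<in>carrier (chains A). v \<oplus>\<^bsub>chains A\<^esub> u = \<zero>\<^bsub>chains A\<^esub>" by blast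
    qed (auto simp: chains_def fun_eq_iff M.a_ac Pi_iff)
  qed (use sm in \<open>auto simp: chains_def fun_eq_iff Pi_iff complex_ring_simps\<close>)
qed

text \<open>Removing two indices in either order differs by one sign: only the position of the
  larger index is affected by removing the other.\<close>

lemma wedge_vec_wedge_vec:
  "wedge_vec a (wedge_vec b \<omega>) J = - wedge_vec b (wedge_vec a \<omega>) J"
proof (cases "finite J")
  case True
  define sgn where "sgn = (\<lambda>J (i::nat). (-1 :: complex) ^ card {k\<in>J. k < i})"
  have *: "sgn J i * sgn (J - {i}) j = - (sgn J j * sgn (J - {j}) i)" if "i \<in> J" "j \<in> J" "i < j" for i j
  proof -
    have "{k\<in>J. k < j} = insert i {k\<in>J - {i}. k < j}" using that by auto
    then have "card {k\<in>J. k < j} = Suc (card {k\<in>J - {i}. k < j})" using True by simp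
    moreover have "{k\<in>J - {j}. k < i} = {k\<in>J. k < i}" using that by auto
    ultimately show ?thesis by (simp add: sgn_def)
  qed
  have anti: "sgn J i * sgn (J - {i}) j = - (sgn J j * sgn (J - {j}) i)" if "i \<in> J" "j \<in> J" "i \<noteq> j" for i j
    using *[OF that(1,2)] *[OF that(2,1)] that(3) by (cases "i < j") auto
  define g where "g = (\<lambda>a b (i, j). sgn J i * a i * (sgn (J - {i}) j * b j * \<omega> (J - {i} - {j})) :: complex)"
  define S where "S = {(i, j). i \<in> J \<and> j \<in> J \<and> i \<noteq> j}"
  have eq: "wedge_vec a (wedge_vec b \<omega>) J = sum (g a b) S" for a b
  proof -
    have "S = (SIGMA i:J. J - {i})" by (auto simp: S_def)
    then have "sum (g a b) S = (\<Sum>i\<in>J. \<Sum>j\<in>J - {i}. g a b (i, j))"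
      using True by (simp add: sum.Sigma)
    then show ?thesis by (simp add: wedge_vec_def g_def sgn_def sum_distrib_left)
  qed
  have "sum (g a b) S = (\<Sum>p\<in>S. - g b a (prod.swap p))"
  proof (rule sum.cong[OF refl])
    fix p assume "p \<in> S"
    then obtain i j where p: "p = (i, j)" "i \<in> J" "j \<in> J" "i \<noteq> j" by (auto simp: S_def)
    have "J - {i} - {j} = J - {j} - {i}" by auto
    then have "g a b p = (sgn J i * sgn (J - {i}) j) * (a i * b j * \<omega> (J - {j} - {i}))"
      by (simp add: g_def p(1))
    also have "\<dots> = - g b a (prod.swap p)"
      unfolding anti[OF p(2-4)] by (simp add: g_def p(1))
    finally show "g a b p = - g b a (prod.swap p)" .
  qed
  also have "\<dots> = - (\<Sum>p\<in>prod.swap ` S. g b a p)"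
    by (simp add: sum.reindex sum_negf)
  also have "prod.swap ` S = S" by (force simp: S_def)
  finally show ?thesis by (simp add: eq)
qed (simp add: wedge_vec_infinite)

text \<open>Images of the coordinate forms under the projection to the sum-zero forms along the
  first coordinate form. The form for index 1 is zero; the family serves only to span.\<close>

definition diff_form :: "nat \<Rightarrow> nat \<Rightarrow> complex" where
  "diff_form i k = unit_form i k - unit_form 1 k"

lemma contract_set_wedge_Nil: "contract_set F (wedge []) = (\<lambda>_. 0)"
  by (rule ext) (auto simp: contract_set_def contract_def intro!: sum.neutral)

lemma sum_unit_form: "i \<in> {1..n} \<Longrightarrow> (\<Sum>k\<in>{1..n}. unit_form i k) = 1"
  by (simp add: unit_form_def of_bool_def)

lemma sum_zero_diff_form: "i \<in> {1..n} \<Longrightarrow> diff_form i \<in> sum_zero_forms n"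
  using sum_unit_form[of i n] sum_unit_form[of 1 n]
  by (auto simp: sum_zero_forms_def diff_form_def sum_subtractf) (auto simp: unit_form_def)

lemma contract_wedge_zero_forms:
  assumes "set ls \<subseteq> sum_zero_forms n"
  shows "contract_set {1..n} (wedge ls) = (\<lambda>_. 0)"
  using assms
proof (induction ls)
  case (Cons l ls)
  then have "(\<Sum>i\<in>{1..n}. l i) = 0" by (simp add: sum_zero_forms_def)
  then show ?case
    using Cons contract_set_wedge_vec[where \<omega> = "wedge ls" and F = "{1..n}" and l = l, OF wedge_infinite]
    unfolding wedge_Cons by (intro ext) simp
qed (rule contract_set_wedge_Nil)

lemma alt_form_wedge:
  assumes "set ls \<subseteq> sum_zero_forms n"
  shows "alt_form n (length ls) (wedge ls)"
  using assms
proof (induction ls)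
  case Nil then show ?case by (auto simp: alt_form_def split: if_splits)
next
  case (Cons l ls)
  then have l: "\<And>i. l i \<noteq> 0 \<Longrightarrow> i \<in> {1..n}" and "alt_form n (length ls) (wedge ls)"
    by (auto simp: sum_zero_forms_def simp del: One_nat_def)
  from alt_form_wedge_vec[OF this] show ?case unfolding wedge_Cons by simp
qed

text \<open>On the exterior power the projection \<open>e\<^sub>i \<mapsto> e\<^sub>i - e\<^sub>1\<close> is wedging with \<open>e\<^sub>1\<close> followed by
  contraction with the sum of the coordinates.\<close>

lemma wedge_diff_forms:
  assumes one: "1 \<in> {1..n}" and "set js \<subseteq> {1..n}"
  shows "wedge (map diff_form js) = contract_set {1..n} (wedge_vec (unit_form 1) (wedge (map unit_form js)))"
  using assms(2)
proof (induction js)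
  case Nil
  show ?case
    using contract_set_wedge_vec[where \<omega> = "wedge []" and F = "{1..n}" and l = "unit_form 1", OF wedge_infinite]
        sum_unit_form[OF one] contract_set_wedge_Nil[of "{1..n}"]
    by (intro ext) (simp del: wedge.simps add: list.map)
next
  case (Cons j js)
  let ?W = "wedge (map unit_form js)" and ?e = "wedge_vec (unit_form 1)"
  have j: "j \<in> {1..n}" using Cons.prems by simp
  have 0: "(\<Sum>i\<in>{1..n}. diff_form j i) = 0" using sum_zero_diff_form[OF j] by (simp add: sum_zero_forms_def)
  show ?case
  proof
    fix J
    have ee: "wedge_vec (unit_form 1) (?e ?W) K = 0" for K
      using wedge_vec_wedge_vec[of "unit_form 1" "unit_form 1" ?W K] by simp
    have anti: "wedge_vec (diff_form j) (?e ?W) K = - ?e (wedge_vec (unit_form j) ?W) K" for K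
    proof -
      have "wedge_vec (diff_form j) (?e ?W) K = wedge_vec (unit_form j) (?e ?W) K - wedge_vec (unit_form 1) (?e ?W) K"
        by (simp add: wedge_vec_def diff_form_def algebra_simps sum_subtractf)
      then show ?thesis using ee wedge_vec_wedge_vec[of "unit_form j" "unit_form 1" ?W K] by simp
    qed
    have "wedge (map diff_form (j # js)) J = wedge_vec (diff_form j) (contract_set {1..n} (?e ?W)) J"
      using Cons by (simp only: list.map wedge_Cons set_simps insert_subset simp_thms)
    also have "\<dots> = - contract_set {1..n} (wedge_vec (diff_form j) (?e ?W)) J"
      using contract_set_wedge_vec[where \<omega> = "?e ?W" and F = "{1..n}" and l = "diff_form j" and J = J, OF wedge_vec_infinite] 0 by simp
    also have "\<dots> = contract_set {1..n} (?e (wedge_vec (unit_form j) ?W)) J"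
      unfolding anti[abs_def] by (simp add: contract_set_uminus)
    finally show "wedge (map diff_form (j # js)) J = contract_set {1..n} (?e (wedge (map unit_form (j # js)))) J"
      by (simp only: list.map wedge_Cons)
  qed
qed

context loopless_matroid
begin

section \<open>Coordinates of Koszul chains\<close>

abbreviation (input) UA :: "(nat set \<Rightarrow> nat set mpoly set) set" where "UA \<equiv> UNIV \<rightarrow> carrier (sr_algebra n Bs)"

definition coefs :: "(nat set \<Rightarrow> nat set mpoly set) \<Rightarrow> cochain" where
  "coefs u m J = coef (u J) m"

lemma coefs_add: "u \<in> UA \<Longrightarrow> v \<in> UA \<Longrightarrow> coefs (u \<oplus>\<^bsub>chains SA\<^esub> v) = (\<lambda>m J. coefs u m J + coefs v m J)"
  by (auto simp: coefs_def chains_def coef_add Pi_iff fun_eq_iff)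

lemma coefs_smult: "u \<in> UA \<Longrightarrow> coefs (c \<odot>\<^bsub>chains SA\<^esub> u) = (\<lambda>m J. c * coefs u m J)"
  by (auto simp: coefs_def chains_def coef_smult Pi_iff fun_eq_iff)

lemma coefs_zero: "coefs \<zero>\<^bsub>chains SA\<^esub> = (\<lambda>_ _. 0)"
  by (auto simp: coefs_def chains_def coef_zero fun_eq_iff)

lemma coefs_inj: "u \<in> UA \<Longrightarrow> v \<in> UA \<Longrightarrow> coefs u = coefs v \<Longrightarrow> u = v"
  by (rule ext, rule coef_inj) (auto simp: coefs_def fun_eq_iff)

lemma coefs_surj:
  assumes "kterm t (int s) w"
  obtains u where "u \<in> UA" "coefs u = w"
proof -
  have "\<exists>Q. Q \<in> carrier SA \<and> coef Q = (\<lambda>m. w m J)" for J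
    using coef_surj[of "\<lambda>m. w m J" s] assms unfolding kterm_def by (metis of_nat_eq_iff)
  then obtain u where "\<And>J. u J \<in> carrier SA \<and> coef (u J) = (\<lambda>m. w m J)" by metis
  then show ?thesis using that[of u] by (auto simp: coefs_def fun_eq_iff)
qed

lemma carrier_chains: "carrier (chains SA) = UA"
  by (simp add: chains_def)

lemma module_SA: "module complex_ring SA"
  using sr_algebra algebra.axioms(3)[of complex_ring SA] by (simp add: algebra_def module_def)

lemma coef_finsum:
  "finite A \<Longrightarrow> g \<in> A \<rightarrow> carrier SA \<Longrightarrow> coef (\<Oplus>\<^bsub>SA\<^esub>i\<in>A. g i) m = (\<Sum>i\<in>A. coef (g i) m)"
proof (induction A rule: finite_induct)
  case empty
  interpret A: module complex_ring SA by (rule module_SA)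
  show ?case by (simp add: coef_zero)
next
  case (insert x A)
  interpret A: module complex_ring SA by (rule module_SA)
  show ?case using insert by (simp add: coef_add Pi_iff A.M.finsum_closed)
qed

abbreviation (input) kosz :: "(nat set \<Rightarrow> nat set mpoly set) \<Rightarrow> nat set \<Rightarrow> nat set mpoly set" where
  "kosz \<equiv> koszul_d n (sr_algebra n Bs) (sr_var n Bs)"

lemma koszul_d_closed:
  assumes u: "u \<in> UA"
  shows "kosz u \<in> UA"
proof
  interpret A: algebra complex_ring SA by (rule sr_algebra)
  fix J
  show "kosz u J \<in> carrier SA" unfolding koszul_d_def
    using u sr_var_closed by (intro A.finsum_closed) (auto intro!: A.smult_closed A.m_closed simp: complex_ring_simps)
qed

text \<open>The image of the variable with index \<open>i\<close> is the sum over the flats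
  containing \<open>i\<close>. Exchanging the sums over indices and flats collects the contractions
  with \<open>i \<in> F\<close> into \<open>contract_set F\<close>. The \<open>+ 1\<close> in the
  exponent of \<open>koszul_d\<close> is the overall sign, and the hypothesis \<open>kterm\<close>
  makes the coefficients vanish at infinite \<open>J\<close>.\<close>

lemma coefs_koszul_d:
  assumes u: "u \<in> UA" and k: "kterm t s (coefs u)"
  shows "coefs (kosz u) = (\<lambda>m J. - kd (coefs u) m J)"
proof (intro ext)
  fix m J
  interpret A: algebra complex_ring SA by (rule sr_algebra)
  have cl: "sr_var n Bs i \<otimes>\<^bsub>SA\<^esub> u J' \<in> carrier SA" for i J' using u sr_var_closed by auto
  have sm: "c \<odot>\<^bsub>SA\<^esub> v \<in> carrier SA" if "v \<in> carrier SA" for c v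
    using A.smult_closed that by (simp add: complex_ring_simps)
  have eq: "coefs (kosz u) m J = (\<Sum>i\<in>{1..n} - J. (-1) ^ (card {k\<in>J. k < i} + 1) *
      coef (sr_var n Bs i \<otimes>\<^bsub>SA\<^esub> u (insert i J)) m)"
    unfolding coefs_def koszul_d_def using cl sm by (simp add: coef_finsum coef_smult)
  show "coefs (kosz u) m J = - kd (coefs u) m J"
  proof (cases "chain_mono m \<and> finite J")
    case False
    have "coef (sr_var n Bs i \<otimes>\<^bsub>SA\<^esub> u (insert i J)) m = 0" for i
    proof (cases "chain_mono m")
      case True
      then have "infinite (insert i J)" using False by simp
      then have "coefs u m' (insert i J) = 0" for m' by (rule kterm_infinite[OF k])
      moreover have "u (insert i J) \<in> carrier SA" using u by auto
      ultimately show ?thesis by (auto simp: coef_sr_var_mult coefs_def intro!: sum.neutral)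
    qed (simp add: coef_nonchain)
    moreover have "kd (coefs u) m J = 0" using False by (auto simp: kd_def contract_set_def)
    ultimately show ?thesis using eq by simp
  next
    case True
    have "coefs (kosz u) m J = (\<Sum>i\<in>{1..n}. \<Sum>F\<in>keys m.
        if i \<in> F then - contract i (coefs u (m - var_mono F)) J else 0)"
      unfolding eq
    proof (rule sum.mono_neutral_cong_left)
      show "\<forall>i\<in>{1..n} - ({1..n} - J). (\<Sum>F\<in>keys m.
          if i \<in> F then - contract i (coefs u (m - var_mono F)) J else 0) = 0"
        by (auto simp: contract_def intro!: sum.neutral split: if_splits)
      fix i assume i: "i \<in> {1..n} - J"
      have "u (insert i J) \<in> carrier SA" using u by auto
      then show "(-1) ^ (card {k\<in>J. k < i} + 1) * coef (sr_var n Bs i \<otimes>\<^bsub>SA\<^esub> u (insert i J)) m =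
          (\<Sum>F\<in>keys m. if i \<in> F then - contract i (coefs u (m - var_mono F)) J else 0)"
        using True i by (auto simp: coef_sr_var_mult sum_distrib_left contract_def coefs_def intro!: sum.cong)
    qed auto
    also have "\<dots> = (\<Sum>F\<in>keys m. \<Sum>i\<in>{1..n}.
        if i \<in> F then - contract i (coefs u (m - var_mono F)) J else 0)" by (rule sum.swap)
    also have "\<dots> = (\<Sum>F\<in>keys m. - contract_set F (coefs u (m - var_mono F)) J)"
    proof (rule sum.cong[OF refl])
      fix F assume "F \<in> keys m"
      then have F: "F \<subseteq> {1..n}" using chain_mono_key_subset True by blast
      have "(\<Sum>i\<in>{1..n}. if i \<in> F then - contract i (coefs u (m - var_mono F)) J else 0) =
          (\<Sum>i\<in>F. - contract i (coefs u (m - var_mono F)) J)"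
        using F by (intro sum.mono_neutral_cong_right) auto
      then show "(\<Sum>i\<in>{1..n}. if i \<in> F then - contract i (coefs u (m - var_mono F)) J else 0) =
          - contract_set F (coefs u (m - var_mono F)) J"
        using True by (simp add: contract_set_def sum_negf)
    qed
    also have "\<dots> = - kd (coefs u) m J" using True by (simp add: kd_def sum_negf)
    finally show ?thesis .
  qed
qed

lemma coefs_tensor: "a \<in> carrier SA \<Longrightarrow> coefs (tensor SA a ls) m J = wedge ls J * coef a m"
  by (simp add: coefs_def tensor_def coef_smult)

lemma tensor_closed: "a \<in> carrier SA \<Longrightarrow> tensor SA a ls \<in> UA"
  using module.smult_closed[OF module_SA] by (auto simp: tensor_def complex_ring_simps)

lemma a_inv_chains:
  assumes "u \<in> UA"
  shows "\<ominus>\<^bsub>chains SA\<^esub> u \<in> UA" "coefs (\<ominus>\<^bsub>chains SA\<^esub> u) = (\<lambda>m J. - coefs u m J)"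
proof -
  interpret C: module complex_ring "chains SA" by (rule module_chains[OF module_SA])
  show cl: "\<ominus>\<^bsub>chains SA\<^esub> u \<in> UA" using C.M.a_inv_closed[of u] assms by (simp add: carrier_chains)
  have "\<ominus>\<^bsub>chains SA\<^esub> u \<oplus>\<^bsub>chains SA\<^esub> u = \<zero>\<^bsub>chains SA\<^esub>"
    using C.M.l_neg[of u] assms by (simp add: carrier_chains)
  then have "(\<lambda>m J. coefs (\<ominus>\<^bsub>chains SA\<^esub> u) m J + coefs u m J) = (\<lambda>_ _. 0)"
    using coefs_add[OF cl assms] coefs_zero by simp
  then show "coefs (\<ominus>\<^bsub>chains SA\<^esub> u) = (\<lambda>m J. - coefs u m J)"
    by (simp add: fun_eq_iff eq_neg_iff_add_eq_0)
qed

abbreviation (input) kosz_term :: "nat \<Rightarrow> nat \<Rightarrow> (nat set \<Rightarrow> nat set mpoly set) set" where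
  "kosz_term t s \<equiv> koszul_term (sum_zero_forms n) (sr_algebra n Bs) (sr_grade n Bs) t s"

lemma koszul_term_kterm:
  assumes "u \<in> kosz_term t s"
  shows "u \<in> UA \<and> kterm t (int s) (coefs u)"
proof -
  have gen: "tensor SA a ls \<in> UA \<and> kterm t (int s) (coefs (tensor SA a ls))"
    if a: "a \<in> sr_grade n Bs s" and ls: "set ls \<subseteq> sum_zero_forms n" "length ls = t" for a ls
  proof -
    have A: "a \<in> carrier SA" "\<And>m. coef a m \<noteq> 0 \<Longrightarrow> mdeg m = s" using a by (auto simp: sr_grade_iff)
    have eq: "coefs (tensor SA a ls) m = (\<lambda>J. coef a m * wedge ls J)" for m
      using coefs_tensor[OF A(1)] by (auto simp: mult.commute)
    have "contract_set {1..n} (\<lambda>J. coef a m * wedge ls J) J = 0" for m J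
      by (simp only: contract_set_scale contract_wedge_zero_forms[OF ls(1)]) simp
    moreover have "alt_form n t (\<lambda>J. coef a m * wedge ls J)" for m
      using alt_form_wedge[OF ls(1)] ls(2) by (simp add: alt_form_def)
    moreover have "chain_mono m \<and> int (mdeg m) = int s" if "coef a m * wedge ls J \<noteq> 0" for m J
      using that A(2)[of m] coef_nonchain[of m a] by auto
    ultimately have "kterm t (int s) (coefs (tensor SA a ls))"
      unfolding kterm_def eq by (auto simp: fun_eq_iff simp del: One_nat_def)
    then show ?thesis using tensor_closed[OF A(1)] by simp
  qed
  show ?thesis
    using assms unfolding koszul_term_def
  proof (induction rule: generate.induct)
    case one
    show ?case using coefs_zero kterm_zero module.axioms(2)[OF module_chains[OF module_SA]]
      by (simp add: carrier_chains[symmetric] abelian_group_def abelian_monoid.zero_closed)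
  next
    case (incl h)
    then show ?case using gen by blast
  next
    case (inv h)
    then have h: "h \<in> UA" "kterm t (int s) (coefs h)" using gen by blast+
    then show ?case
      using a_inv_chains[OF h(1)] kterm_scale[OF h(2), of "-1"] by (simp add: a_inv_def)
  next
    case (eng u v)
    then show ?case
      using coefs_add[of u v] kterm_add module.axioms(2)[OF module_chains[OF module_SA]]
      by (simp add: carrier_chains[symmetric] abelian_group_def abelian_monoid.a_closed)
  qed
qed

text \<open>Expand \<open>u\<close> in wedges of coordinate forms and replace each coordinate form
  by its \<open>diff_form\<close>. This applies to every coefficient form the operator that wedges
  with the first coordinate form and contracts with \<open>{1..n}\<close>; forms killed by that
  contraction are fixed by it, so the sum of tensors is \<open>u\<close> again.\<close>

lemma kterm_koszul_term:
  assumes u: "u \<in> UA" and k: "kterm t (int s) (coefs u)"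
  shows "u \<in> kosz_term t s"
proof -
  interpret C: module complex_ring "chains SA" by (rule module_chains[OF module_SA])
  define Js where "Js = {J. J \<subseteq> {1..n} \<and> card J = t}"
  define ls where "ls = (\<lambda>J. map diff_form (sorted_list_of_set J))"
  have finJs: "finite Js" unfolding Js_def by (rule finite_subset[of _ "Pow {1..n}"]) auto
  have fin: "finite J" if "J \<in> Js" for J using that finite_subset by (auto simp: Js_def)
  have uJ: "u J \<in> sr_grade n Bs s" for J
  proof -
    have "mdeg m = s" if "coef (u J) m \<noteq> 0" for m
      using k that unfolding kterm_def coefs_def by (metis of_nat_eq_iff)
    then show ?thesis using u by (auto simp: sr_grade_iff)
  qed
  have ls: "set (ls J) \<subseteq> sum_zero_forms n" "length (ls J) = t" if "J \<in> Js" for J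
    using that fin[OF that] sum_zero_diff_form by (auto simp: ls_def Js_def)
  have "\<exists>v\<in>kosz_term t s. coefs v = (\<lambda>m K. \<Sum>J\<in>Ks. wedge (ls J) K * coef (u J) m)" if "finite Ks" "Ks \<subseteq> Js" for Ks
    using that
  proof (induction Ks rule: finite_induct)
    case empty
    have "\<zero>\<^bsub>chains SA\<^esub> \<in> kosz_term t s" unfolding koszul_term_def using generate.one[of "add_monoid (chains SA)"] by simp
    then show ?case using coefs_zero by (intro bexI[of _ "\<zero>\<^bsub>chains SA\<^esub>"]) auto
  next
    case (insert J Ks)
    then obtain v where v: "v \<in> kosz_term t s" "coefs v = (\<lambda>m K. \<Sum>J\<in>Ks. wedge (ls J) K * coef (u J) m)" by auto
    let ?t = "tensor SA (u J) (ls J)"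
    have "?t \<in> kosz_term t s" unfolding koszul_term_def
      using uJ ls insert.prems by (intro generate.incl) blast
    then have "?t \<oplus>\<^bsub>chains SA\<^esub> v \<in> kosz_term t s"
      using v(1) generate.eng[of ?t "add_monoid (chains SA)" _ v] unfolding koszul_term_def by simp
    moreover have "coefs (?t \<oplus>\<^bsub>chains SA\<^esub> v) = (\<lambda>m K. \<Sum>J\<in>insert J Ks. wedge (ls J) K * coef (u J) m)"
    proof -
      have "u J \<in> carrier SA" using u by auto
      moreover have "v \<in> UA" using koszul_term_kterm[OF v(1)] by simp
      ultimately show ?thesis
        using insert.hyps coefs_add[OF tensor_closed] v(2) by (simp add: coefs_tensor)
    qed
    ultimately show ?case by blast
  qed
  from this[OF finJs order_refl] obtain v where v: "v \<in> kosz_term t s"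
    "coefs v = (\<lambda>m K. \<Sum>J\<in>Js. wedge (ls J) K * coef (u J) m)" by blast
  \<comment> \<open>Positive rank makes the ground set nonempty, so the index 1 used by
    \<open>diff_form\<close> is available.\<close>
  have n1: "1 \<in> {1..n}" using rank_le rank_pos by simp
  have "coefs v m K = coefs u m K" for m K
  proof -
    let ?w = "coefs u m"
    have W: "wedge (ls J) = contract_set {1..n} (wedge_vec (unit_form 1) (\<lambda>K. of_bool (K = J)))" if J: "J \<in> Js" for J
    proof -
      have "wedge (map unit_form (sorted_list_of_set J)) = (\<lambda>K. of_bool (K = J))"
        using wedge_unit_forms[OF strict_sorted_list_of_set[of J]] fin[OF J] by auto
      then show ?thesis unfolding ls_def
        using wedge_diff_forms[OF n1, of "sorted_list_of_set J"] J fin[OF J] by (simp add: Js_def)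
    qed
    have "coefs v m K = (\<Sum>J\<in>Js. ?w J * contract_set {1..n} (wedge_vec (unit_form 1) (\<lambda>K. of_bool (K = J))) K)"
      unfolding v(2) using W by (intro sum.cong) (auto simp: coefs_def mult.commute)
    also have "\<dots> = contract_set {1..n} (wedge_vec (unit_form 1) (\<lambda>K. \<Sum>J\<in>Js. ?w J * of_bool (K = J))) K"
    proof -
      have "wedge_vec (unit_form 1) (\<lambda>K. \<Sum>J\<in>Js. ?w J * of_bool (K = J)) =
          (\<lambda>L. \<Sum>J\<in>Js. ?w J * wedge_vec (unit_form 1) (\<lambda>K. of_bool (K = J)) L)"
        by (intro ext) (simp only: wedge_vec_sum wedge_vec_scale)
      then show ?thesis by (simp only: contract_set_sum contract_set_scale)
    qed
    also have "(\<lambda>K. \<Sum>J\<in>Js. ?w J * of_bool (K = J)) = ?w"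
    proof
      fix K
      have "(\<Sum>J\<in>Js. ?w J * of_bool (K = J)) = (\<Sum>J\<in>Js. if J = K then ?w K else 0)"
        by (intro sum.cong) auto
      also have "\<dots> = ?w K"
      proof -
        have "?w K = 0" if "K \<notin> Js" using k that unfolding kterm_def alt_form_def Js_def by blast
        then show ?thesis using finJs by auto
      qed
      finally show "(\<Sum>J\<in>Js. ?w J * of_bool (K = J)) = ?w K" .
    qed
    also have "contract_set {1..n} (wedge_vec (unit_form 1) ?w) K =
        (\<Sum>i\<in>{1..n}. unit_form 1 i) * ?w K - wedge_vec (unit_form 1) (contract_set {1..n} ?w) K"
      by (rule contract_set_wedge_vec) (rule kterm_infinite[OF k])
    also have "\<dots> = ?w K" using k sum_unit_form[OF n1] by (simp add: kterm_def del: One_nat_def)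
    finally show ?thesis .
  qed
  then have "v = u" using koszul_term_kterm[OF v(1)] u by (intro coefs_inj) (auto simp: fun_eq_iff)
  then show ?thesis using v(1) by simp
qed

lemma koszul_term_iff: "u \<in> kosz_term t s \<longleftrightarrow> u \<in> UA \<and> kterm t (int s) (coefs u)"
  using koszul_term_kterm kterm_koszul_term by blast

lemma koszul_cycles_iff:
  "u \<in> koszul_cycles n (sum_zero_forms n) SA (sr_grade n Bs) (sr_var n Bs) t s \<longleftrightarrow>
    u \<in> UA \<and> kterm t (int s) (coefs u) \<and> kd (coefs u) = (\<lambda>_ _. 0)"
proof -
  have "kosz u = \<zero>\<^bsub>chains SA\<^esub> \<longleftrightarrow> kd (coefs u) = (\<lambda>_ _. 0)" if u: "u \<in> UA" "kterm t (int s) (coefs u)"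
  proof -
    interpret C: module complex_ring "chains SA" by (rule module_chains[OF module_SA])
    have "\<zero>\<^bsub>chains SA\<^esub> \<in> UA" using C.M.zero_closed by (simp add: carrier_chains)
    then have "kosz u = \<zero>\<^bsub>chains SA\<^esub> \<longleftrightarrow> coefs (kosz u) = coefs \<zero>\<^bsub>chains SA\<^esub>"
      using coefs_inj[OF koszul_d_closed[OF u(1)]] by (metis (no_types))
    also have "\<dots> \<longleftrightarrow> kd (coefs u) = (\<lambda>_ _. 0)"
      unfolding coefs_koszul_d[OF u] coefs_zero by (simp add: fun_eq_iff)
    finally show ?thesis .
  qed
  then show ?thesis unfolding koszul_cycles_def by (auto simp: koszul_term_iff)
qed

text \<open>For \<open>s = 0\<close> the integer degree -1 leaves only the zero cochain, in
  agreement with the separate case of the definition. In positive degree the sign between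
  \<open>kd\<close> and the Koszul differential is absorbed into the preimage.\<close>

lemma koszul_boundaries_iff:
  "u \<in> koszul_boundaries n (sum_zero_forms n) SA (sr_grade n Bs) (sr_var n Bs) t s \<longleftrightarrow>
    u \<in> UA \<and> (\<exists>v. kterm (Suc t) (int s - 1) v \<and> coefs u = kd v)"
proof (cases s)
  case 0
  interpret C: module complex_ring "chains SA" by (rule module_chains[OF module_SA])
  have z: "\<zero>\<^bsub>chains SA\<^esub> \<in> UA" using C.M.zero_closed by (simp add: carrier_chains)
  have v: "v = (\<lambda>_ _. 0)" if "kterm (Suc t) (int s - 1) v" for v
    using that 0 by (intro ext) (force simp: kterm_def)
  have "u \<in> UA \<and> (\<exists>v. kterm (Suc t) (int s - 1) v \<and> coefs u = kd v) \<longleftrightarrow> u \<in> UA \<and> coefs u = (\<lambda>_ _. 0)"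
    using v kd_zero kterm_zero by metis
  also have "\<dots> \<longleftrightarrow> u = \<zero>\<^bsub>chains SA\<^esub>" using coefs_inj[OF _ z] coefs_zero z by metis
  finally show ?thesis using 0 by (simp add: koszul_boundaries_def)
next
  case (Suc s')
  have neg: "kd (\<lambda>m J. - w m J) = (\<lambda>m J. - kd w m J)" for w
    using kd_scale[of "-1" w] by (auto simp: fun_eq_iff)
  have "u \<in> kosz ` kosz_term (Suc t) s' \<longleftrightarrow> u \<in> UA \<and> (\<exists>v. kterm (Suc t) (int s') v \<and> coefs u = kd v)"
  proof
    assume "u \<in> kosz ` kosz_term (Suc t) s'"
    then obtain x where x: "x \<in> UA" "kterm (Suc t) (int s') (coefs x)" "u = kosz x"
      by (auto simp: koszul_term_iff)
    then have "coefs u = kd (\<lambda>m J. - coefs x m J)" using coefs_koszul_d[OF x(1,2)] neg by simp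
    then show "u \<in> UA \<and> (\<exists>v. kterm (Suc t) (int s') v \<and> coefs u = kd v)"
      using kterm_scale[OF x(2), of "-1"] koszul_d_closed[OF x(1)] x(3) by auto
  next
    assume "u \<in> UA \<and> (\<exists>v. kterm (Suc t) (int s') v \<and> coefs u = kd v)"
    then obtain v where v: "u \<in> UA" "kterm (Suc t) (int s') v" "coefs u = kd v" by blast
    have "kterm (Suc t) (int s') (\<lambda>m J. - v m J)" using kterm_scale[OF v(2), of "-1"] by simp
    then obtain x where x: "x \<in> UA" "coefs x = (\<lambda>m J. - v m J)" "kterm (Suc t) (int s') (coefs x)"
      using coefs_surj by metis
    have "coefs (kosz x) = coefs u" using coefs_koszul_d[OF x(1,3)] x(2) neg[of v] v(3) by simp
    then have "u = kosz x" using coefs_inj[OF v(1) koszul_d_closed[OF x(1)]] by simp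
    then show "u \<in> kosz ` kosz_term (Suc t) s'" using x by (auto simp: koszul_term_iff)
  qed
  then show ?thesis using Suc by (simp add: koszul_boundaries_def)
qed

end


section \<open>Dimension of the quotient\<close>

lemma quot_module_abelian_group:
  fixes M (structure)
  assumes M: "module K M" and N: "submodule N K M"
  shows "abelian_group (quot_module M N)" "abelian_subgroup N M"
proof -
  interpret M: module K M by fact
  have "additive_subgroup N M"
    using submodule.axioms(1)[OF N] by (rule additive_subgroup.intro)
  then show *: "abelian_subgroup N M" by (rule abelian_subgroupI3) (rule M.abelian_group_axioms)
  interpret N: abelian_subgroup N M by fact
  interpret C: comm_group "M A_Mod N" by (rule N.a_factorgroup_is_comm_group)
  have eq: "carrier (M A_Mod N) = carrier (quot_module M N)"
    "a \<otimes>\<^bsub>M A_Mod N\<^esub> b = a \<oplus>\<^bsub>quot_module M N\<^esub> b" "\<one>\<^bsub>M A_Mod N\<^esub> = \<zero>\<^bsub>quot_module M N\<^esub>" for a b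
    by (simp_all add: quot_module_def A_FactGroup_def')
  show "abelian_group (quot_module M N)"
    by (rule abelian_groupI; (rule C.m_closed[unfolded eq] C.one_closed[unfolded eq] C.m_assoc[unfolded eq]
          C.m_comm[unfolded eq] C.l_one[unfolded eq] C.l_inv_ex[unfolded eq]; assumption))
qed

lemma quot_module_smult:
  fixes M (structure)
  assumes M: "module K M" and N: "submodule N K M" and c: "c \<in> carrier K" and x: "x \<in> carrier M"
  shows "c \<odot>\<^bsub>quot_module M N\<^esub> (N +> x) = N +> (c \<odot> x)"
proof -
  interpret M: module K M by fact
  interpret N: abelian_subgroup N M by (rule quot_module_abelian_group(2)[OF M N])
  have "N +> (c \<odot> y) = N +> (c \<odot> x)" if y: "y \<in> N +> x" for y
  proof -
    obtain h where h: "h \<in> N" "y = h \<oplus> x" using y by (auto simp: a_r_coset_def')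
    have "h \<in> carrier M" using h N.a_subset by auto
    then have "c \<odot> y = c \<odot> h \<oplus> c \<odot> x" using h c x M.smult_r_distr by simp
    then have "c \<odot> y \<in> N +> (c \<odot> x)"
      using submodule.smult_closed[OF N c h(1)] by (auto simp: a_r_coset_def')
    then show ?thesis using M.a_repr_independence[OF _ _ N.a_subgroup, of "c \<odot> y" "c \<odot> x"] c x by simp
  qed
  then have "(\<Union>y\<in>N +> x. N +> (c \<odot> y)) = (\<Union>y\<in>N +> x. N +> (c \<odot> x))"
    by (intro SUP_cong refl)
  also have "\<dots> = N +> (c \<odot> x)" using N.a_rcos_self[OF x] by auto
  finally show ?thesis by (simp add: quot_module_def)
qed

text \<open>The cosets of the \<open>z i\<close> form the basis. Independence modulo
  \<open>N\<close> compares two coefficient families, which is directly the uniqueness demanded by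
  \<open>finite_basis\<close>.\<close>

lemma quot_module_has_dim:
  fixes K :: "('a, 'c) ring_scheme" and M :: "('a, 'b) module" (structure) and z :: "'i \<Rightarrow> 'b"
  assumes M: "module K M" and N: "submodule N K M" and D: "finite D" and z: "z \<in> D \<rightarrow> carrier M"
    and span: "\<And>w. w \<in> carrier M \<Longrightarrow> \<exists>c\<in>D \<rightarrow> carrier K. \<exists>h\<in>N. w = h \<oplus> (\<Oplus>i\<in>D. c i \<odot> z i)"
    and indep: "\<And>c c' h i. c \<in> D \<rightarrow> carrier K \<Longrightarrow> c' \<in> D \<rightarrow> carrier K \<Longrightarrow> h \<in> N \<Longrightarrow>
      (\<Oplus>i\<in>D. c i \<odot> z i) = h \<oplus> (\<Oplus>i\<in>D. c' i \<odot> z i) \<Longrightarrow> i \<in> D \<Longrightarrow> c i = c' i"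
    and nontriv: "\<zero>\<^bsub>K\<^esub> \<noteq> \<one>\<^bsub>K\<^esub>"
  shows "has_dim K (quot_module M N) (card D)"
proof -
  interpret M: module K M by fact
  interpret N: abelian_subgroup N M by (rule quot_module_abelian_group(2)[OF M N])
  interpret Q: abelian_group "quot_module M N" by (rule quot_module_abelian_group(1)[OF M N])
  let ?Q = "quot_module M N"
  define q where "q = (\<lambda>x. N +> x)"
  have Qc: "carrier ?Q = q ` carrier M"
    by (auto simp: quot_module_def q_def A_RCOSETS_defs a_r_coset_def)
  have q_closed: "q x \<in> carrier ?Q" if "x \<in> carrier M" for x using that Qc by blast
  have q_add: "q (x \<oplus> y) = q x \<oplus>\<^bsub>?Q\<^esub> q y" if "x \<in> carrier M" "y \<in> carrier M" for x y
    using N.a_rcos_sum[OF that] by (simp add: quot_module_def q_def)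
  have q_smult: "c \<odot>\<^bsub>?Q\<^esub> q x = q (c \<odot> x)" if "c \<in> carrier K" "x \<in> carrier M" for c x
    using quot_module_smult[OF M N that] by (simp add: q_def)
  have q_zero: "q \<zero> = \<zero>\<^bsub>?Q\<^esub>" using N.a_subset by (simp add: quot_module_def q_def)
  have q_eqD: "\<exists>h\<in>N. x = h \<oplus> y" if "q x = q y" "x \<in> carrier M" for x y
    using N.a_rcos_self[OF that(2)] that(1) by (auto simp: q_def a_r_coset_def')
  have q_eqI: "q (h \<oplus> y) = q y" if "h \<in> N" "y \<in> carrier M" for h y
  proof -
    have "h \<oplus> y \<in> N +> y" using that by (auto simp: a_r_coset_def')
    then show ?thesis using M.a_repr_independence[OF _ _ N.a_subgroup, of "h \<oplus> y" y] that by (simp add: q_def)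
  qed
  define L where "L = (\<lambda>c. \<Oplus>i\<in>D. c i \<odot> z i)"
  have L_closed: "L c \<in> carrier M" if "c \<in> D \<rightarrow> carrier K" for c
    unfolding L_def using that z by (intro M.finsum_closed) (auto intro: M.smult_closed)
  have q_sum: "q (\<Oplus>i\<in>X'. c i \<odot> z i) = (\<Oplus>\<^bsub>?Q\<^esub>i\<in>X'. c i \<odot>\<^bsub>?Q\<^esub> q (z i))"
    if "finite X'" "X' \<subseteq> D" "c \<in> D \<rightarrow> carrier K" for c X'
    using that
  proof (induction X' rule: finite_induct)
    case empty then show ?case by (simp add: q_zero)
  next
    case (insert i X')
    then have i: "i \<in> D" "X' \<subseteq> D" by auto
    have cl: "c j \<odot> z j \<in> carrier M" if "j \<in> D" for j
      using that insert.prems(2) z by (auto intro: M.smult_closed)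
    have qcl: "c j \<odot>\<^bsub>?Q\<^esub> q (z j) \<in> carrier ?Q" if "j \<in> D" for j
    proof -
      have "c j \<odot>\<^bsub>?Q\<^esub> q (z j) = q (c j \<odot> z j)" using that insert.prems(2) z by (intro q_smult) auto
      then show ?thesis using q_closed cl that by simp
    qed
    have "q (\<Oplus>i\<in>insert i X'. c i \<odot> z i) = q (c i \<odot> z i) \<oplus>\<^bsub>?Q\<^esub> q (\<Oplus>i\<in>X'. c i \<odot> z i)"
      using insert.hyps i cl by (subst M.finsum_insert) (auto intro!: q_add M.finsum_closed)
    also have "\<dots> = c i \<odot>\<^bsub>?Q\<^esub> q (z i) \<oplus>\<^bsub>?Q\<^esub> (\<Oplus>\<^bsub>?Q\<^esub>i\<in>X'. c i \<odot>\<^bsub>?Q\<^esub> q (z i))"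
    proof -
      have "c i \<odot>\<^bsub>?Q\<^esub> q (z i) = q (c i \<odot> z i)" using insert.prems(2) i z by (intro q_smult) auto
      then show ?thesis using insert.IH[OF i(2) insert.prems(2)] by simp
    qed
    also have "\<dots> = (\<Oplus>\<^bsub>?Q\<^esub>i\<in>insert i X'. c i \<odot>\<^bsub>?Q\<^esub> q (z i))"
      using insert.hyps i qcl by (subst Q.finsum_insert) auto
    finally show ?case .
  qed
  have qL: "q (L c) = (\<Oplus>\<^bsub>?Q\<^esub>i\<in>D. c i \<odot>\<^bsub>?Q\<^esub> q (z i))" if "c \<in> D \<rightarrow> carrier K" for c
    unfolding L_def using q_sum[OF D order_refl that] .
  have L_inj: "c i = c' i" if "c \<in> D \<rightarrow> carrier K" "c' \<in> D \<rightarrow> carrier K" "q (L c) = q (L c')" "i \<in> D" for c c' i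
    using q_eqD[OF that(3) L_closed[OF that(1)]] indep[OF that(1,2) _ _ that(4)] unfolding L_def by blast
  \<comment> \<open>The indicator family recovers \<open>z i\<close> itself. Comparing two of them
    shows that distinct indices give distinct cosets, which is where zero and one must
    differ.\<close>
  define \<delta> :: "'i \<Rightarrow> 'i \<Rightarrow> 'a" where "\<delta> = (\<lambda>i j. if i = j then \<one>\<^bsub>K\<^esub> else \<zero>\<^bsub>K\<^esub>)"
  have \<delta>: "\<delta> i \<in> D \<rightarrow> carrier K" for i by (simp add: \<delta>_def)
  have L\<delta>: "L (\<delta> i) = z i" if i: "i \<in> D" for i
  proof -
    have "L (\<delta> i) = (\<Oplus>j\<in>D. if i = j then z j else \<zero>)"
      unfolding L_def using z by (intro M.finsum_cong') (auto simp: \<delta>_def M.smult_l_null M.smult_one Pi_iff)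
    also have "\<dots> = z i" using i D z by (intro M.add.finprod_singleton) auto
    finally show ?thesis .
  qed
  define b where "b = (\<lambda>i. q (z i))"
  have inj: "inj_on b D"
  proof (rule inj_onI)
    fix i j assume ij: "i \<in> D" "j \<in> D" "b i = b j"
    then have "\<delta> i i = \<delta> j i" using L_inj[OF \<delta> \<delta>, of i j i] L\<delta> by (simp add: b_def)
    then show "i = j" using nontriv by (auto simp: \<delta>_def split: if_splits)
  qed
  have reindex: "(\<Oplus>\<^bsub>?Q\<^esub>s\<in>b ` D. c s \<odot>\<^bsub>?Q\<^esub> s) = q (L (\<lambda>i. c (b i)))" if c: "c \<in> b ` D \<rightarrow> carrier K" for c
  proof -
    have "c s \<odot>\<^bsub>?Q\<^esub> s \<in> carrier ?Q" if s: "s \<in> b ` D" for s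
    proof -
      obtain i where i: "i \<in> D" "s = q (z i)" using s by (auto simp: b_def)
      have "c s \<odot>\<^bsub>?Q\<^esub> q (z i) = q (c s \<odot> z i)" using c s z i by (intro q_smult) auto
      then have "c s \<odot>\<^bsub>?Q\<^esub> s = q (c s \<odot> z i)" unfolding i(2)[symmetric] .
      also have "\<dots> \<in> carrier ?Q" using c s i z by (intro q_closed M.smult_closed) auto
      finally show ?thesis .
    qed
    then have "(\<Oplus>\<^bsub>?Q\<^esub>s\<in>b ` D. c s \<odot>\<^bsub>?Q\<^esub> s) = (\<Oplus>\<^bsub>?Q\<^esub>i\<in>D. c (b i) \<odot>\<^bsub>?Q\<^esub> b i)"
      using inj by (intro Q.add.finprod_reindex) auto
    also have "\<dots> = q (L (\<lambda>i. c (b i)))" using c by (subst qL) (auto simp: b_def)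
    finally show ?thesis .
  qed
  have "finite_basis K ?Q (b ` D)"
    unfolding finite_basis_def
  proof (intro conjI ballI)
    show "finite (b ` D)" using D by simp
    show "b ` D \<subseteq> carrier ?Q" using z q_closed by (auto simp: b_def)
    fix v assume "v \<in> carrier ?Q"
    then obtain w where w: "w \<in> carrier M" "v = q w" using Qc by blast
    obtain c h where c: "c \<in> D \<rightarrow> carrier K" "h \<in> N" "w = h \<oplus> L c" using span[OF w(1)] by (auto simp: L_def)
    have v: "v = q (L c)" using w c q_eqI[OF c(2) L_closed[OF c(1)]] by simp
    show "\<exists>!e. e \<in> b ` D \<rightarrow>\<^sub>E carrier K \<and> v = (\<Oplus>\<^bsub>?Q\<^esub>s\<in>b ` D. e s \<odot>\<^bsub>?Q\<^esub> s)"
    proof (rule ex1I)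
      \<comment> \<open>The coefficients are carried to cosets along the inverse of
        \<open>b\<close>, and restricted to its image because \<open>finite_basis\<close> compares
        extensional functions.\<close>
      let ?e = "\<lambda>s\<in>b ` D. c (inv_into D b s)"
      have e: "?e \<in> b ` D \<rightarrow>\<^sub>E carrier K" using c inj by auto
      have "L (\<lambda>i. ?e (b i)) = L c"
        unfolding L_def using c z inj by (intro M.finsum_cong') (auto intro: M.smult_closed)
      then show "?e \<in> b ` D \<rightarrow>\<^sub>E carrier K \<and> v = (\<Oplus>\<^bsub>?Q\<^esub>s\<in>b ` D. ?e s \<odot>\<^bsub>?Q\<^esub> s)"
        using e reindex[of ?e] v by (auto simp: PiE_def)
      fix e' assume e': "e' \<in> b ` D \<rightarrow>\<^sub>E carrier K \<and> v = (\<Oplus>\<^bsub>?Q\<^esub>s\<in>b ` D. e' s \<odot>\<^bsub>?Q\<^esub> s)"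
      then have "q (L (\<lambda>i. e' (b i))) = q (L c)" using reindex[of e'] v by (auto simp: PiE_def)
      then have "e' (b i) = c i" if "i \<in> D" for i
        using L_inj[of "\<lambda>i. e' (b i)" c i] e' c that by (auto simp: PiE_def)
      then show "e' = ?e" using e' e inj by (intro PiE_ext[of _ "b ` D" "\<lambda>_. carrier K"]) auto
    qed
  qed
  moreover have "card (b ` D) = card D" by (rule card_image[OF inj])
  ultimately show ?thesis unfolding has_dim_def by blast
qed

context loopless_matroid
begin

section \<open>Cycles and boundaries as modules\<close>

abbreviation (input) cycles :: "nat \<Rightarrow> nat \<Rightarrow> (nat set \<Rightarrow> nat set mpoly set) set" where
  "cycles t s \<equiv> koszul_cycles n (sum_zero_forms n) (sr_algebra n Bs) (sr_grade n Bs) (sr_var n Bs) t s"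

abbreviation (input) boundaries :: "nat \<Rightarrow> nat \<Rightarrow> (nat set \<Rightarrow> nat set mpoly set) set" where
  "boundaries t s \<equiv> koszul_boundaries n (sum_zero_forms n) (sr_algebra n Bs) (sr_grade n Bs) (sr_var n Bs) t s"

abbreviation (input) cycle_module :: "nat \<Rightarrow> nat \<Rightarrow> (complex, nat set \<Rightarrow> nat set mpoly set) module" where
  "cycle_module t s \<equiv> chains (sr_algebra n Bs)\<lparr>carrier := cycles t s\<rparr>"

lemma submodule_of_smult_closed:
  assumes M: "module complex_ring M" and "H \<subseteq> carrier M" "\<zero>\<^bsub>M\<^esub> \<in> H"
    "\<And>a b. a \<in> H \<Longrightarrow> b \<in> H \<Longrightarrow> a \<oplus>\<^bsub>M\<^esub> b \<in> H" "\<And>c a. a \<in> H \<Longrightarrow> c \<odot>\<^bsub>M\<^esub> a \<in> H"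
  shows "submodule H complex_ring M"
proof -
  interpret M: module complex_ring M by fact
  have "\<ominus>\<^bsub>M\<^esub> a \<in> H" if "a \<in> H" for a
  proof -
    have "\<ominus>\<^bsub>M\<^esub> a = (\<ominus>\<^bsub>complex_ring\<^esub> \<one>\<^bsub>complex_ring\<^esub>) \<odot>\<^bsub>M\<^esub> a"
      using M.smult_l_minus[of "\<one>\<^bsub>complex_ring\<^esub>" a] that assms(2) by (auto simp: M.smult_one)
    then show ?thesis using assms(5) that by simp
  qed
  then show ?thesis using assms by (intro M.submoduleI) auto
qed

lemma chains_closed:
  "\<zero>\<^bsub>chains SA\<^esub> \<in> UA" "u \<in> UA \<Longrightarrow> v \<in> UA \<Longrightarrow> u \<oplus>\<^bsub>chains SA\<^esub> v \<in> UA" "u \<in> UA \<Longrightarrow> c \<odot>\<^bsub>chains SA\<^esub> u \<in> UA"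
proof -
  interpret C: module complex_ring "chains SA" by (rule module_chains[OF module_SA])
  show "\<zero>\<^bsub>chains SA\<^esub> \<in> UA" "u \<in> UA \<Longrightarrow> v \<in> UA \<Longrightarrow> u \<oplus>\<^bsub>chains SA\<^esub> v \<in> UA" "u \<in> UA \<Longrightarrow> c \<odot>\<^bsub>chains SA\<^esub> u \<in> UA"
    using C.M.zero_closed C.M.a_closed[of u v] C.smult_closed[of c u]
    by (simp_all add: carrier_chains complex_ring_simps)
qed

lemma submodule_cycles: "submodule (cycles t s) complex_ring (chains SA)"
proof (rule submodule_of_smult_closed[OF module_chains[OF module_SA]])
  show "cycles t s \<subseteq> carrier (chains SA)" by (simp add: subset_iff koszul_cycles_iff carrier_chains)
  show "\<zero>\<^bsub>chains SA\<^esub> \<in> cycles t s"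
    by (simp add: koszul_cycles_iff chains_closed coefs_zero kterm_zero kd_zero)
  fix a b assume ab: "a \<in> cycles t s" "b \<in> cycles t s"
  then show "a \<oplus>\<^bsub>chains SA\<^esub> b \<in> cycles t s"
    using kterm_add[of t "int s" "coefs a" "coefs b"]
    by (simp add: koszul_cycles_iff chains_closed coefs_add kd_add fun_eq_iff)
next
  fix c a assume a: "a \<in> cycles t s"
  then show "c \<odot>\<^bsub>chains SA\<^esub> a \<in> cycles t s"
    using kterm_scale[of t "int s" "coefs a" c]
    by (simp add: koszul_cycles_iff chains_closed coefs_smult kd_scale fun_eq_iff)
qed

lemma module_cycles: "module complex_ring (cycle_module t s)"
  by (rule submodule.submodule_is_module[OF submodule_cycles module_chains[OF module_SA]])

lemma boundaries_subset: "boundaries t s \<subseteq> cycles t s"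
  unfolding koszul_cycles_iff koszul_boundaries_iff subset_iff
  by (metis kterm_kd kd_kd ext)

lemma submodule_boundaries: "submodule (boundaries t s) complex_ring (cycle_module t s)"
proof (rule submodule_of_smult_closed[OF module_cycles])
  show "boundaries t s \<subseteq> carrier (cycle_module t s)" using boundaries_subset by simp
  show "\<zero>\<^bsub>cycle_module t s\<^esub> \<in> boundaries t s"
    by (auto simp: koszul_boundaries_iff chains_closed coefs_zero kterm_zero kd_zero intro!: exI[of _ "\<lambda>_ _. 0"])
next
  fix a b assume "a \<in> boundaries t s" "b \<in> boundaries t s"
  then obtain v w where v: "a \<in> UA" "kterm (Suc t) (int s - 1) v" "coefs a = kd v"
    and w: "b \<in> UA" "kterm (Suc t) (int s - 1) w" "coefs b = kd w" by (auto simp: koszul_boundaries_iff)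
  have "coefs (a \<oplus>\<^bsub>chains SA\<^esub> b) = kd (\<lambda>m J. v m J + w m J)"
    using v w by (auto simp: coefs_add kd_add fun_eq_iff)
  then show "a \<oplus>\<^bsub>cycle_module t s\<^esub> b \<in> boundaries t s"
    using kterm_add[OF v(2) w(2)] chains_closed(2)[OF v(1) w(1)] by (auto simp: koszul_boundaries_iff)
next
  fix c a assume "a \<in> boundaries t s"
  then obtain v where v: "a \<in> UA" "kterm (Suc t) (int s - 1) v" "coefs a = kd v"
    by (auto simp: koszul_boundaries_iff)
  have "coefs (c \<odot>\<^bsub>chains SA\<^esub> a) = kd (\<lambda>m J. c * v m J)"
    using v by (auto simp: coefs_smult kd_scale fun_eq_iff)
  then show "c \<odot>\<^bsub>cycle_module t s\<^esub> a \<in> boundaries t s"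
    using kterm_scale[OF v(2)] chains_closed(3)[OF v(1)] by (auto simp: koszul_boundaries_iff)
qed

lemma sr_Tor_eq: "sr_Tor n Bs t s = quot_module (cycle_module t s) (boundaries t s)"
  by (simp add: sr_Tor_def koszul_Tor_def)

lemma sr_Tor_trivial:
  assumes "n - r < t \<or> r - 1 < s"
  shows "carrier (sr_Tor n Bs t s) = {\<zero>\<^bsub>sr_Tor n Bs t s\<^esub>}"
proof -
  interpret M: module complex_ring "cycle_module t s" by (rule module_cycles)
  interpret N: abelian_subgroup "boundaries t s" "cycle_module t s"
    by (rule quot_module_abelian_group(2)[OF module_cycles submodule_boundaries])
  \<comment> \<open>As \<open>r > 0\<close>, the truncated difference \<open>r - 1\<close> agrees
    with the integer one.\<close>
  have van: "n - r < t \<or> int r - 1 < int s" using assms rank_pos by auto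
  have "cycles t s \<subseteq> boundaries t s"
  proof
    fix u assume u: "u \<in> cycles t s"
    then obtain v where "kterm (Suc t) (int s - 1) v" "coefs u = kd v"
      using kterm_boundary[OF _ _ van, of "coefs u"] by (auto simp: koszul_cycles_iff)
    then show "u \<in> boundaries t s" using u by (auto simp: koszul_boundaries_iff koszul_cycles_iff)
  qed
  then have coset: "boundaries t s +>\<^bsub>cycle_module t s\<^esub> u = boundaries t s" if "u \<in> cycles t s" for u
    using that M.a_coset_join2[of u "boundaries t s"] N.a_subgroup by auto
  have "carrier (sr_Tor n Bs t s) = (\<lambda>u. boundaries t s +>\<^bsub>cycle_module t s\<^esub> u) ` cycles t s"
    by (auto simp: sr_Tor_eq quot_module_def A_RCOSETS_defs a_r_coset_def)
  also have "\<dots> = {boundaries t s}"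
    using coset M.zero_closed by (auto simp: image_iff)
  finally show ?thesis by (simp add: sr_Tor_eq quot_module_def)
qed

lemma coefs_finsum_cycles:
  assumes "finite D" "c \<in> D \<rightarrow> UNIV" "z \<in> D \<rightarrow> cycles t s"
  shows "(\<Oplus>\<^bsub>cycle_module t s\<^esub>i\<in>D. c i \<odot>\<^bsub>cycle_module t s\<^esub> z i) \<in> cycles t s \<and>
    coefs (\<Oplus>\<^bsub>cycle_module t s\<^esub>i\<in>D. c i \<odot>\<^bsub>cycle_module t s\<^esub> z i) = (\<lambda>m J. \<Sum>i\<in>D. c i * coefs (z i) m J)"
  using assms(1,3)
proof (induction D rule: finite_induct)
  case empty
  interpret M: module complex_ring "cycle_module t s" by (rule module_cycles)
  show ?case using M.zero_closed by (simp add: coefs_zero)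
next
  case (insert i D)
  interpret M: module complex_ring "cycle_module t s" by (rule module_cycles)
  have cl: "c j \<odot>\<^bsub>chains SA\<^esub> z j \<in> cycles t s" if "j \<in> insert i D" for j
    using M.smult_closed[of "c j" "z j"] that insert.prems by (auto simp: complex_ring_simps)
  define S where "S = (\<Oplus>\<^bsub>cycle_module t s\<^esub>i\<in>D. c i \<odot>\<^bsub>cycle_module t s\<^esub> z i)"
  have S: "S \<in> cycles t s" "coefs S = (\<lambda>m J. \<Sum>i\<in>D. c i * coefs (z i) m J)"
    using insert by (auto simp: S_def)
  have eq: "(\<Oplus>\<^bsub>cycle_module t s\<^esub>i\<in>insert i D. c i \<odot>\<^bsub>cycle_module t s\<^esub> z i) = c i \<odot>\<^bsub>chains SA\<^esub> z i \<oplus>\<^bsub>chains SA\<^esub> S"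
    unfolding S_def using insert.hyps cl by (subst M.finsum_insert) auto
  have "c i \<odot>\<^bsub>chains SA\<^esub> z i \<oplus>\<^bsub>chains SA\<^esub> S \<in> cycles t s"
    using M.a_closed[of "c i \<odot>\<^bsub>chains SA\<^esub> z i" S] cl S(1) by simp
  moreover have "coefs (c i \<odot>\<^bsub>chains SA\<^esub> z i \<oplus>\<^bsub>chains SA\<^esub> S) = (\<lambda>m J. c i * coefs (z i) m J + coefs S m J)"
  proof -
    have "z i \<in> UA" "S \<in> UA" using insert.prems S(1) by (auto simp: koszul_cycles_iff)
    then show ?thesis by (simp add: coefs_add coefs_smult chains_closed)
  qed
  ultimately show ?case unfolding eq using insert.hyps S(2) by simp
qed

text \<open>The flag cycles are lifted to Koszul cycles; that they span and are independent modulo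
  boundaries has been shown for cochains, and the index set of decreasing flags is equinumerous with
  the NBC bases.\<close>

lemma sr_Tor_has_dim: "has_dim complex_ring (sr_Tor n Bs (n - r) (r - 1)) (card (NBC n Bs))"
proof -
  let ?t = "n - r" and ?s = "r - 1" and ?D = "{f. decreasing f}" and ?M = "cycle_module (n - r) (r - 1)"
  have s: "int ?s = int r - 1" "int ?s - 1 = int r - 2" using rank_pos by auto
  have "\<exists>u. u \<in> UA \<and> coefs u = flag_cycle f" if "f \<in> ?D" for f
    using coefs_surj[of ?t ?s "flag_cycle f"] kterm_flag_cycle[of f] s that by (metis mem_Collect_eq)
  then obtain z where z: "\<And>f. f \<in> ?D \<Longrightarrow> z f \<in> UA \<and> coefs (z f) = flag_cycle f" by metis
  have zc: "z \<in> ?D \<rightarrow> cycles ?t ?s"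
  proof
    fix f assume f: "f \<in> ?D"
    then have "kd (flag_cycle f) = (\<lambda>_ _. 0)" using kd_flag_cycle by (intro ext) simp
    then show "z f \<in> cycles ?t ?s" using z[OF f] kterm_flag_cycle f s by (simp add: koszul_cycles_iff)
  qed
  define L where "L = (\<lambda>c. \<Oplus>\<^bsub>?M\<^esub>i\<in>?D. c i \<odot>\<^bsub>?M\<^esub> z i)"
  have L: "L c \<in> UA" "coefs (L c) = (\<lambda>m J. \<Sum>f\<in>?D. c f * flag_cycle f m J)" for c
  proof -
    note * = coefs_finsum_cycles[OF finite_decreasing _ zc, of c]
    show "L c \<in> UA" using * by (auto simp: L_def koszul_cycles_iff)
    show "coefs (L c) = (\<lambda>m J. \<Sum>f\<in>?D. c f * flag_cycle f m J)" using * z by (simp add: L_def)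
  qed
  have "has_dim complex_ring (quot_module (?M) (boundaries ?t ?s)) (card ?D)"
  proof (rule quot_module_has_dim[OF module_cycles submodule_boundaries finite_decreasing])
    show "z \<in> ?D \<rightarrow> carrier (?M)" using zc by simp
    show "\<zero>\<^bsub>complex_ring\<^esub> \<noteq> \<one>\<^bsub>complex_ring\<^esub>" by (simp add: complex_ring_simps)
  next
    fix w assume "w \<in> carrier (?M)"
    then have w: "w \<in> UA" "kterm ?t (int r - 1) (coefs w)" "kd (coefs w) = (\<lambda>_ _. 0)"
      using s by (auto simp: koszul_cycles_iff)
    obtain v c where v: "kterm (Suc ?t) (int r - 2) v"
      "coefs w = (\<lambda>m J. kd v m J + (\<Sum>f\<in>?D. c f * flag_cycle f m J))"
      by (rule flag_cycles_span[OF w(2,3)])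
    have "kterm ?t (int ?s) (kd v)" using kterm_kd[of ?t "int ?s" v] v(1) s by simp
    then obtain h where h: "h \<in> UA" "coefs h = kd v" using coefs_surj by metis
    have "h \<in> boundaries ?t ?s" using h v(1) s by (auto simp: koszul_boundaries_iff)
    moreover have "w = h \<oplus>\<^bsub>chains SA\<^esub> L c"
      using v(2) h L by (intro coefs_inj w chains_closed) (auto simp: coefs_add)
    ultimately show "\<exists>c\<in>?D \<rightarrow> carrier complex_ring. \<exists>h\<in>boundaries ?t ?s. w = h \<oplus>\<^bsub>?M\<^esub>
        (\<Oplus>\<^bsub>?M\<^esub>i\<in>?D. c i \<odot>\<^bsub>?M\<^esub> z i)"
      unfolding L_def by (intro bexI[of _ c] bexI[of _ h]) (auto simp: complex_ring_simps)
  next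
    fix c c' h f
    assume h: "h \<in> boundaries ?t ?s" and f: "f \<in> ?D"
      and "(\<Oplus>\<^bsub>?M\<^esub>i\<in>?D. c i \<odot>\<^bsub>?M\<^esub> z i) =
        h \<oplus>\<^bsub>?M\<^esub> (\<Oplus>\<^bsub>?M\<^esub>i\<in>?D. c' i \<odot>\<^bsub>?M\<^esub> z i)"
    then have eq: "L c = h \<oplus>\<^bsub>chains SA\<^esub> L c'" by (simp add: L_def)
    obtain v where v: "h \<in> UA" "kterm (Suc ?t) (int r - 2) v" "coefs h = kd v"
      using h s by (auto simp: koszul_boundaries_iff)
    have "coefs (L c) = (\<lambda>m J. kd v m J + coefs (L c') m J)" using eq coefs_add[OF v(1) L(1)] v(3) by simp
    \<comment> \<open>Equality modulo boundaries becomes a single boundary equal to the combination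
      with coefficients \<open>c f - c' f\<close>, to which independence applies.\<close>
    then have "kd v = (\<lambda>m J. \<Sum>f\<in>?D. (c f - c' f) * flag_cycle f m J)"
      unfolding L(2) by (simp add: fun_eq_iff left_diff_distrib sum_subtractf)
    then have "c f - c' f = 0" using flag_cycles_independent[OF v(2), of "\<lambda>f. c f - c' f"] f by simp
    then show "c f = c' f" by simp
  qed
  then show ?thesis by (simp add: sr_Tor_eq card_decreasing)
qed

end

theorem theorem6p1:
  fixes n r :: nat and Bs :: "nat set set"
  assumes "matroid n Bs" and "loopless n Bs" and "r = rk Bs {1..n}" and "r > 0"
  shows "(\<forall>t s. t > n - r \<or> s > r - 1 \<longrightarrow> carrier (sr_Tor n Bs t s) = {\<zero>\<^bsub>sr_Tor n Bs t s\<^esub>}) \<and>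
    has_dim complex_ring (sr_Tor n Bs (n - r) (r - 1)) (card (NBC n Bs)) \<and>
    card (NBC n Bs) > 0"
proof -
  interpret loopless_matroid n Bs r by unfold_locales (use assms in auto)
  show ?thesis using sr_Tor_trivial sr_Tor_has_dim card_NBC_pos by blast
qed

end
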